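(* Let $y>0$ and $0<\varepsilon<\min\{y/2,1\}$. Let $X$ be a Lévy process with triplet $(\sigma^2,b,\nu)$ such that $\nu$ has a density $s$ which is bounded outside the interval $[-\varepsilon,\varepsilon]$ and which is continuous in a neighborhood of $y$. Assume also that $\sigma=0$ and $\int_{\{|x|\le1\}}|x|\,\nu(dx)<\infty$. Then the limit $$\frac{d_2}{2}:=\lim_{t\to0}\frac1t\left\{\frac1t\,\mathbb{P}(X_t\ge y)-\nu([y,\infty))\right\}$$ exists and $$\frac{d_2}{2}=b_0\,s(y)+\int\int_0^x s(y-u)\,du\;s_\varepsilon(x)\,dx+\frac12\int\int\mathbf 1_{\{x+u\ge y\}}\,\bar s_\varepsilon(u)\,\bar s_\varepsilon(x)\,du\,dx-\lambda_\varepsilon\,\nu([y,\infty)),$$ where $b_0:=b-\int_{|x|\le1}x\,\nu(dx)$.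
   Context: A Lévy process $X=(X_t)_{t\ge0}$ has triplet $(\sigma^2,b,\nu)$ if $X_t=bt+\sigma W_t+\int_0^t\int_{|x|\le1}x\,(\mu-\bar\mu)(dx,ds)+\int_0^t\int_{|x|>1}x\,\mu(dx,ds)$, where $W$ is a standard Brownian motion and $\mu$ is an independent Poisson random measure on $\mathbb{R}_+\times(\mathbb{R}\setminus\{0\})$ with mean measure $\bar\mu(dx,dt)=\nu(dx)\,dt$, $\nu$ being a Lévy measure. Fix a truncation function $c_\varepsilon\in C^\infty(\mathbb{R})$ with $\mathbf 1_{[-\varepsilon/2,\varepsilon/2]}\le c_\varepsilon\le\mathbf 1_{[-\varepsilon,\varepsilon]}$ and put $\bar c_\varepsilon:=1-c_\varepsilon$, $s_\varepsilon:=c_\varepsilon s$, $\bar s_\varepsilon:=\bar c_\varepsilon s$, $\lambda_\varepsilon:=\int\bar c_\varepsilon(x)\,\nu(dx)$. For $x<0$, $\int_0^x$ denotes $-\int_x^0$. *)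

theory Defs
  imports "HOL-Probability.Probability"
begin

definition indep_increments :: "'a measure \<Rightarrow> (real \<Rightarrow> 'a \<Rightarrow> real) \<Rightarrow> bool" where
  "indep_increments M X \<longleftrightarrow>
     (\<forall>\<tau> :: nat \<Rightarrow> real. \<forall>n. 0 \<le> \<tau> 0 \<longrightarrow> incseq \<tau> \<longrightarrow>
        prob_space.indep_vars M (\<lambda>_. borel) (\<lambda>i \<omega>. X (\<tau> (Suc i)) \<omega> - X (\<tau> i) \<omega>) {..<n})"

definition cadlag :: "(real \<Rightarrow> real) \<Rightarrow> bool" where
  "cadlag f \<longleftrightarrow> (\<forall>t\<ge>0. continuous (at_right t) f) \<and> (\<forall>t>0. \<exists>l. (f \<longlongrightarrow> l) (at_left t))"

text \<open>Processes are families indexed by all of \<^typ>\<open>real\<close>; only the values at times \<open>t \<ge> 0\<close> matter.\<close>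

definition levy_process :: "'a measure \<Rightarrow> (real \<Rightarrow> 'a \<Rightarrow> real) \<Rightarrow> bool" where
  "levy_process M X \<longleftrightarrow>
     prob_space M \<and>
     (\<forall>t\<ge>0. X t \<in> borel_measurable M) \<and>
     (AE \<omega> in M. X 0 \<omega> = 0) \<and>
     indep_increments M X \<and>
     (\<forall>r\<ge>0. \<forall>h\<ge>0. distr M borel (\<lambda>\<omega>. X (r + h) \<omega> - X r \<omega>) = distr M borel (X h)) \<and>
     (AE \<omega> in M. cadlag (\<lambda>t. X t \<omega>))"

definition standard_brownian_motion :: "'a measure \<Rightarrow> (real \<Rightarrow> 'a \<Rightarrow> real) \<Rightarrow> bool" where
  "standard_brownian_motion M W \<longleftrightarrow>
     prob_space M \<and>
     (\<forall>t\<ge>0. W t \<in> borel_measurable M) \<and>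
     (AE \<omega> in M. W 0 \<omega> = 0) \<and>
     indep_increments M W \<and>
     (\<forall>r\<ge>0. \<forall>t>r. distributed M lborel (\<lambda>\<omega>. W t \<omega> - W r \<omega>) (normal_density 0 (sqrt (t - r)))) \<and>
     (AE \<omega> in M. continuous_on {0..} (\<lambda>t. W t \<omega>))"

text \<open>Counts take values in \<^typ>\<open>ennreal\<close>; that they are integers or infinite holds almost surely
  because of the prescribed laws.\<close>

definition poisson_random_measure ::
  "'a measure \<Rightarrow> 'b measure \<Rightarrow> ('a \<Rightarrow> 'b measure) \<Rightarrow> bool" where
  "poisson_random_measure M m N \<longleftrightarrow>
     prob_space M \<and>
     (\<forall>\<omega>\<in>space M. sets (N \<omega>) = sets m) \<and>
     (\<forall>A\<in>sets m. (\<lambda>\<omega>. emeasure (N \<omega>) A) \<in> borel_measurable M) \<and>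
     (\<forall>A\<in>sets m. emeasure m A < \<infinity> \<longrightarrow>
        (\<forall>k::nat. measure M {\<omega> \<in> space M. emeasure (N \<omega>) A = of_nat k}
                    = exp (- measure m A) * measure m A ^ k / fact k)) \<and>
     (\<forall>A\<in>sets m. emeasure m A = \<infinity> \<longrightarrow> (AE \<omega> in M. emeasure (N \<omega>) A = \<infinity>)) \<and>
     (\<forall>A :: nat \<Rightarrow> 'b set. \<forall>n. A ` {..<n} \<subseteq> sets m \<longrightarrow> disjoint_family_on A {..<n} \<longrightarrow>
        prob_space.indep_vars M (\<lambda>_. borel) (\<lambda>i \<omega>. emeasure (N \<omega>) (A i)) {..<n})"

definition process_events :: "'a measure \<Rightarrow> (real \<Rightarrow> 'a \<Rightarrow> real) \<Rightarrow> 'a set set" where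
  "process_events M W =
     sigma_sets (space M) {W t -` B \<inter> space M | t B. 0 \<le> t \<and> B \<in> sets borel}"

definition random_measure_events :: "'a measure \<Rightarrow> 'b measure \<Rightarrow> ('a \<Rightarrow> 'b measure) \<Rightarrow> 'a set set" where
  "random_measure_events M m N =
     sigma_sets (space M)
       {(\<lambda>\<omega>. emeasure (N \<omega>) A) -` B \<inter> space M | A B. A \<in> sets m \<and> B \<in> sets borel}"

definition levy_measure :: "real measure \<Rightarrow> bool" where
  "levy_measure \<nu> \<longleftrightarrow>
     sets \<nu> = sets borel \<and> emeasure \<nu> {0} = 0 \<and> (\<integral>\<^sup>+ x. ennreal (min 1 (x\<^sup>2)) \<partial>\<nu>) < \<infinity>"

text \<open>The measure \<open>dt \<nu>(dx)\<close> on \<open>[0,\<infinity>) \<times> (\<real> - {0})\<close>; time is the first coordinate, jump size the second.\<close>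

definition levy_intensity :: "real measure \<Rightarrow> (real \<times> real) measure" where
  "levy_intensity \<nu> = restrict_space lborel {0..} \<Otimes>\<^sub>M restrict_space \<nu> (- {0})"

text \<open>\<open>J\<close> is (a version of) the compensated integral of \<open>x\<close> over \<open>[0,t] \<times> {\<bar>x\<bar> \<le> 1}\<close>. It need
  not be a pathwise integral; it is the limit in \<open>L\<^sup>2\<close>, as \<open>\<delta> \<down> 0\<close>, of the compensated integrals
  over \<open>[0,t] \<times> {\<delta> < \<bar>x\<bar> \<le> 1}\<close>.\<close>

definition compensated_small_jumps ::
  "'a measure \<Rightarrow> real measure \<Rightarrow> ('a \<Rightarrow> (real \<times> real) measure) \<Rightarrow> real \<Rightarrow> ('a \<Rightarrow> real) \<Rightarrow> bool" where
  "compensated_small_jumps M \<nu> N t J \<longleftrightarrow>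
     J \<in> borel_measurable M \<and>
     ((\<lambda>\<delta>. \<integral>\<^sup>+ \<omega>. ennreal
         ((J \<omega> - ((LINT p:{0..t} \<times> {x. \<delta> < \<bar>x\<bar> \<and> \<bar>x\<bar> \<le> 1}|N \<omega>. snd p)
                - (LINT p:{0..t} \<times> {x. \<delta> < \<bar>x\<bar> \<and> \<bar>x\<bar> \<le> 1}|levy_intensity \<nu>. snd p)))\<^sup>2) \<partial>M)
       \<longlongrightarrow> 0) (at_right 0)"

text \<open>\<open>X\<close> is a Levy process with triplet \<open>(v, b, \<nu>)\<close>, where \<open>v = \<sigma>\<^sup>2\<close>. The Levy-Ito
  representation is required almost surely for each fixed \<open>t\<close>.\<close>

definition levy_process_with_triplet ::
  "'a measure \<Rightarrow> (real \<Rightarrow> 'a \<Rightarrow> real) \<Rightarrow> real \<Rightarrow> real \<Rightarrow> real measure \<Rightarrow> bool" where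
  "levy_process_with_triplet M X v b \<nu> \<longleftrightarrow>
     levy_process M X \<and> 0 \<le> v \<and> levy_measure \<nu> \<and>
     (\<exists>W N J.
        standard_brownian_motion M W \<and>
        poisson_random_measure M (levy_intensity \<nu>) N \<and>
        prob_space.indep_set M (process_events M W)
          (random_measure_events M (levy_intensity \<nu>) N) \<and>
        (\<forall>t\<ge>0. compensated_small_jumps M \<nu> N t (J t) \<and>
           (AE \<omega> in M. X t \<omega> = b * t + sqrt v * W t \<omega> + J t \<omega>
                          + (LINT p:{0..t} \<times> {x. 1 < \<bar>x\<bar>}|N \<omega>. snd p))))"

definition smooth :: "(real \<Rightarrow> real) \<Rightarrow> bool" where
  "smooth f \<longleftrightarrow> (\<forall>k. (deriv ^^ k) f differentiable_on UNIV)"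

definition truncation_function :: "real \<Rightarrow> (real \<Rightarrow> real) \<Rightarrow> bool" where
  "truncation_function \<epsilon> c \<longleftrightarrow>
     smooth c \<and> (\<forall>x. indicator {-\<epsilon>/2..\<epsilon>/2} x \<le> c x \<and> c x \<le> indicator {-\<epsilon>..\<epsilon>} x)"

definition small_part :: "(real \<Rightarrow> real) \<Rightarrow> (real \<Rightarrow> real) \<Rightarrow> real \<Rightarrow> real" where
  "small_part c s x = c x * s x"

definition large_part :: "(real \<Rightarrow> real) \<Rightarrow> (real \<Rightarrow> real) \<Rightarrow> real \<Rightarrow> real" where
  "large_part c s x = (1 - c x) * s x"

definition large_mass :: "(real \<Rightarrow> real) \<Rightarrow> real measure \<Rightarrow> real" where
  "large_mass c \<nu> = (\<integral>x. 1 - c x \<partial>\<nu>)"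

end

theory Submission
  imports Defs
begin

text \<open>Since \<open>\<nu>\<close> has finite variation near \<open>0\<close>, \<open>X\<^sub>t\<close> is \<open>b\<^sub>0 t\<close> plus the sum of its jumps. For a hard
  threshold \<open>\<eta>\<close>, comparing characteristic functions shows that \<open>X\<^sub>t\<close> has the law of \<open>b\<^sub>0 t + S\<^sub>t\<close> (with
  \<open>S\<^sub>t\<close> the sum of the jumps of size at most \<open>\<eta>\<close>) plus an independent compound Poisson variable with
  jump density \<open>f = s\<close> off \<open>[-\<eta>, \<eta>]\<close>. Conditioning on \<open>0\<close>, \<open>1\<close> or \<open>2\<close> large jumps expands the tail
  probability up to \<open>O(t\<^sup>3)\<close>. An exponential moment bound gives \<open>P(\<bar>S\<^sub>t\<bar> \<ge> 3\<eta>) = O(t\<^sup>3)\<close>, so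
  no large jump contributes \<open>o(t\<^sup>2)\<close>; the two-jump term converges by continuity; and since the tail
  \<open>z \<mapsto> \<integral> 1{z + u \<ge> y} f(u) du\<close> has derivative \<open>s(y)\<close> at \<open>0\<close>, the one-jump term contributes
  \<open>b\<^sub>0 s(y)\<close> up to an error of order \<open>E\<bar>S\<^sub>t\<bar> / t = O(\<integral>\<^bsub>\<bar>x\<bar>\<le>\<eta>\<^esub> \<bar>x\<bar> \<nu>(dx))\<close>, which vanishes as
  \<open>\<eta> \<rightarrow> 0\<close>. The resulting constant, written with the hard threshold, differs from the claimed one by
  \<open>O(\<integral>\<^bsub>\<bar>x\<bar>\<le>\<eta>\<^esub> \<bar>x\<bar> \<nu>(dx))\<close> for every truncation function \<open>c\<close>.\<close>

section \<open>Integrals with respect to a Poisson random measure\<close>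

text \<open>The threshold must shrink: at a fixed one the small jumps change the one-jump term at
  first order in \<open>t\<close>, and this change does not vanish as \<open>t\<close> tends to 0.
  For the truncation function of the claim it is the double integral involving
  \<open>s (y - u)\<close>, whose direct computation would need the generator of the small-jump
  process. Here that contribution is bounded and never expanded. The order of limits is
  \<open>t\<close> to 0 at fixed \<eta>, then \<eta> to 0, so the result at fixed \<eta> is an
  eventual bound and not yet a limit.

  The double integral comes instead from the two-jump term. Jumps that the hard threshold calls
  large and the truncation function calls small can form a pair with a jump near or beyond
  \<open>y\<close>. Moving the start from 0 to \<open>x\<close> changes the tail by the mass of
  \<open>s\<close> between \<open>y - x\<close> and \<open>y\<close>, which is the inner integral.
  Only the part of that integral over jumps in [-\<eta>, \<eta>] is never produced, and boundedness
  of the density above \<open>y - \<epsilon>\<close> makes it small.\<close>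

lemma simple_function_disjoint_sum:
  fixes F :: "'b \<Rightarrow> real"
  assumes F: "simple_function m F"
  obtains n :: nat and A v where
    "\<And>i. i < n \<Longrightarrow> A i \<in> sets m" "\<And>i. i < n \<Longrightarrow> A i \<subseteq> {x \<in> space m. F x \<noteq> 0}"
    "disjoint_family_on A {..<n}"
    "\<And>x (h :: real \<Rightarrow> 'c :: real_vector). x \<in> space m \<Longrightarrow> h 0 = 0 \<Longrightarrow>
        h (F x) = (\<Sum>i<n. indicator (A i) x *\<^sub>R h (v i))"
proof -
  \<comment> \<open>Zero is left out of the enumerated values: this keeps every piece inside the
    support of \<open>F\<close>, and it is why \<open>h\<close> must vanish at 0.\<close>
  define V where "V = F ` space m - {0}"
  have fin: "finite V" using F by (auto simp: V_def simple_function_def)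
  obtain e where e: "bij_betw e {..<card V} V"
    using ex_bij_betw_nat_finite[OF fin] by (auto simp: lessThan_atLeast0)
  define A where "A i = F -` {e i} \<inter> space m" for i
  have eV: "e i \<in> V" if "i < card V" for i using e that by (auto simp: bij_betw_def)
  show thesis
  proof (rule that[of "card V" A e])
    show "A i \<in> sets m" if "i < card V" for i
      using F by (auto simp: A_def intro: simple_functionD)
    show "A i \<subseteq> {x \<in> space m. F x \<noteq> 0}" if "i < card V" for i
      using eV[OF that] by (auto simp: A_def V_def)
    show "disjoint_family_on A {..<card V}"
      using e by (auto simp: disjoint_family_on_def A_def bij_betw_def inj_on_def)
    fix x and h :: "real \<Rightarrow> 'c"
    assume x: "x \<in> space m" and h: "h 0 = 0"
    show "h (F x) = (\<Sum>i<card V. indicator (A i) x *\<^sub>R h (e i))"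
    proof (cases "F x = 0")
      case True
      then have "indicator (A i) x *\<^sub>R h (e i) = 0" if "i < card V" for i
        using eV[OF that] by (auto simp: A_def V_def)
      then have "(\<Sum>i<card V. indicator (A i) x *\<^sub>R h (e i)) = 0" by (intro sum.neutral) auto
      then show ?thesis using True h by (simp only:)
    next
      case False
      then have "F x \<in> V" using x by (auto simp: V_def)
      then have "F x \<in> e ` {..<card V}" using e by (simp add: bij_betw_def)
      then obtain j where j: "j < card V" "e j = F x" by auto
      have "indicator (A i) x *\<^sub>R h (e i) = (if i = j then h (F x) else 0)" if "i < card V" for i
      proof (cases "i = j")
        case True
        then show ?thesis using j x by (simp add: A_def)
      next
        case ne: False
        have "e i \<noteq> e j" using e j(1) that ne by (auto simp: bij_betw_def inj_on_def)
        then show ?thesis using j ne by (simp add: A_def indicator_def)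
      qed
      then have "(\<Sum>i<card V. indicator (A i) x *\<^sub>R h (e i)) = (\<Sum>i<card V. if i = j then h (F x) else 0)"
        by (intro sum.cong) auto
      then show ?thesis using j by simp
    qed
  qed
qed

locale poisson_rm = prob_space M for M :: "'a measure" +
  fixes m :: "'b measure" and N :: "'a \<Rightarrow> 'b measure"
  assumes prm: "poisson_random_measure M m N"
begin

lemma sets_N: "\<omega> \<in> space M \<Longrightarrow> sets (N \<omega>) = sets m"
  and measurable_count[measurable]: "A \<in> sets m \<Longrightarrow> (\<lambda>\<omega>. emeasure (N \<omega>) A) \<in> borel_measurable M"
  and prob_count: "A \<in> sets m \<Longrightarrow> emeasure m A < \<infinity> \<Longrightarrow>
    prob {\<omega> \<in> space M. emeasure (N \<omega>) A = of_nat k} = exp (- measure m A) * measure m A ^ k / fact k"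
  and indep_counts: "B ` {..<n::nat} \<subseteq> sets m \<Longrightarrow> disjoint_family_on B {..<n} \<Longrightarrow>
    indep_vars (\<lambda>_. borel) (\<lambda>i \<omega>. emeasure (N \<omega>) (B i)) {..<n}"
  using prm unfolding poisson_random_measure_def by auto

lemma space_N: "\<omega> \<in> space M \<Longrightarrow> space (N \<omega>) = space m"
  using sets_N by (rule sets_eq_imp_space_eq)

lemma measurable_measure_N[measurable]:
  "A \<in> sets m \<Longrightarrow> (\<lambda>\<omega>. measure (N \<omega>) A) \<in> borel_measurable M"
  unfolding measure_def by measurable

text \<open>The Poisson weights sum to 1 by the exponential series, which leaves no probability for
  an infinite or fractional count.\<close>

lemma AE_count_nat:
  assumes A: "A \<in> sets m" "emeasure m A < \<infinity>"
  shows "AE \<omega> in M. \<exists>k::nat. emeasure (N \<omega>) A = of_nat k"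
proof -
  let ?E = "\<lambda>k::nat. {\<omega> \<in> space M. emeasure (N \<omega>) A = of_nat k}"
  have [measurable]: "A \<in> sets m" by fact
  have E: "range ?E \<subseteq> events" by auto
  have dj: "disjoint_family ?E" by (auto simp: disjoint_family_on_def)
  have "(\<lambda>k. prob (?E k)) sums prob (\<Union>k. ?E k)"
    by (rule finite_measure_UNION[OF E dj])
  moreover have "(\<lambda>k. prob (?E k)) sums 1"
  proof -
    have "(\<lambda>k. measure m A ^ k /\<^sub>R fact k) sums exp (measure m A)" by (rule exp_converges)
    from sums_mult[OF this, of "exp (- measure m A)"] show ?thesis
      by (simp add: prob_count[OF A] exp_minus field_simps)
  qed
  ultimately have "prob (\<Union>k. ?E k) = 1" by (rule sums_unique2)
  then have "AE \<omega> in M. \<omega> \<in> (\<Union>k. ?E k)" using E by (subst prob_eq_1[symmetric]) auto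
  then show ?thesis by eventually_elim auto
qed

text \<open>A complex \<open>w\<close> lets one computation serve both characteristic functions and
  real exponential moments. The expectation is read off the prescribed probabilities by expanding
  over the value of the count.\<close>

lemma
  fixes w :: complex
  assumes A: "A \<in> sets m" "emeasure m A < \<infinity>"
  shows integrable_exp_count: "integrable M (\<lambda>\<omega>. exp (w * measure (N \<omega>) A))" (is ?int)
    and expectation_exp_count:
      "(\<integral>\<omega>. exp (w * measure (N \<omega>) A) \<partial>M) = exp (measure m A * (exp w - 1))" (is ?eq)
proof -
  let ?E = "\<lambda>k::nat. {\<omega> \<in> space M. emeasure (N \<omega>) A = of_nat k}"
  define f where "f k \<omega> = indicator (?E k) \<omega> *\<^sub>R exp w ^ k" for k :: nat and \<omega>
  have [measurable]: "A \<in> sets m" by fact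
  have [measurable]: "?E k \<in> events" for k by auto
  have fint: "integrable M (f k)" for k unfolding f_def
    by (intro integrable_scaleR_left) (auto simp: integrable_indicator_iff emeasure_eq_measure)
  have fE: "(\<integral>\<omega>. f k \<omega> \<partial>M) = exp (- measure m A) * ((measure m A * exp w) ^ k /\<^sub>R fact k)" for k
  proof -
    have "(\<integral>\<omega>. f k \<omega> \<partial>M) = prob (?E k) *\<^sub>R exp w ^ k"
      unfolding f_def
      by (intro has_bochner_integral_integral_eq has_bochner_integral_scaleR_left
        has_bochner_integral_real_indicator) (auto simp: emeasure_eq_measure)
    then show ?thesis unfolding prob_count[OF A]
      by (simp add: scaleR_conv_of_real power_mult_distrib field_simps)
  qed
  have eq: "AE \<omega> in M. summable (\<lambda>k. norm (f k \<omega>)) \<and> (\<Sum>k. f k \<omega>) = exp (w * measure (N \<omega>) A)"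
    using AE_count_nat[OF A] AE_space
  proof eventually_elim
    case (elim \<omega>)
    then obtain k where k: "emeasure (N \<omega>) A = of_nat k" by auto
    have "f j \<omega> = 0" if "j \<notin> {k}" for j using that k elim by (auto simp: f_def)
    then have "(\<lambda>j. norm (f j \<omega>)) sums (\<Sum>j\<in>{k}. norm (f j \<omega>))" "(\<lambda>j. f j \<omega>) sums (\<Sum>j\<in>{k}. f j \<omega>)"
      by (intro sums_finite; simp)+
    moreover have "f k \<omega> = exp (w * measure (N \<omega>) A)"
      using k elim by (auto simp: f_def measure_def exp_of_nat_mult[symmetric] mult.commute)
    ultimately show ?case by (auto simp: sums_iff)
  qed
  have "summable (\<lambda>k. \<integral>\<omega>. norm (f k \<omega>) \<partial>M)"
  proof -
    have "(\<integral>\<omega>. norm (f k \<omega>) \<partial>M) = exp (- measure m A) * ((measure m A * norm (exp w)) ^ k /\<^sub>R fact k)" for k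
    proof -
      have "(\<integral>\<omega>. norm (f k \<omega>) \<partial>M) = (\<integral>\<omega>. indicator (?E k) \<omega> *\<^sub>R norm (exp w) ^ k \<partial>M)"
        by (intro Bochner_Integration.integral_cong) (auto simp: f_def norm_power)
      also have "\<dots> = prob (?E k) *\<^sub>R norm (exp w) ^ k"
        by (intro has_bochner_integral_integral_eq has_bochner_integral_scaleR_left
          has_bochner_integral_real_indicator) (auto simp: emeasure_eq_measure)
      finally show ?thesis unfolding prob_count[OF A]
        by (simp add: power_mult_distrib field_simps)
    qed
    then show ?thesis by (simp only: summable_mult summable_exp_generic)
  qed
  have ae: "AE \<omega> in M. summable (\<lambda>k. norm (f k \<omega>))" using eq by eventually_elim auto
  note sm = integrable_suminf[OF fint ae \<open>summable _\<close>] sums_integral[OF fint ae \<open>summable _\<close>]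
  have ae2: "AE \<omega> in M. (\<Sum>k. f k \<omega>) = exp (w * measure (N \<omega>) A)" using eq by eventually_elim auto
  show ?int
    by (rule integrable_cong_AE_imp[OF sm(1)]) (use ae2 in auto)
  have "(\<integral>\<omega>. exp (w * measure (N \<omega>) A) \<partial>M) = (\<integral>\<omega>. (\<Sum>k. f k \<omega>) \<partial>M)"
    by (rule integral_cong_AE) (use ae2 sm(1) in auto)
  also have "\<dots> = exp (measure m A * (exp w - 1))"
  proof (rule sums_unique2[OF sm(2)])
    show "(\<lambda>k. integral\<^sup>L M (f k)) sums exp (measure m A * (exp w - 1))"
      using sums_mult[OF exp_converges[of "measure m A * exp w"], of "exp (- measure m A)"]
      by (simp add: fE exp_diff exp_minus algebra_simps divide_inverse exp_of_real)
  qed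
  finally show ?eq .
qed

text \<open>Independence of the counts of disjoint sets turns the exponential of the sum into a
  product of one-set formulas.\<close>

lemma
  fixes z :: complex and v :: "nat \<Rightarrow> real"
  assumes A: "\<And>i. i < n \<Longrightarrow> A i \<in> sets m" "\<And>i. i < n \<Longrightarrow> emeasure m (A i) < \<infinity>"
    and dj: "disjoint_family_on A {..<n}"
  shows integrable_exp_counts:
      "integrable M (\<lambda>\<omega>. exp (z * (\<Sum>i<n. v i * measure (N \<omega>) (A i))))" (is ?int)
    and expectation_exp_counts: "(\<integral>\<omega>. exp (z * (\<Sum>i<n. v i * measure (N \<omega>) (A i))) \<partial>M)
      = exp (\<Sum>i<n. measure m (A i) * (exp (z * v i) - 1))" (is ?eq)
proof -
  have e: "exp (z * (\<Sum>i<n. v i * measure (N \<omega>) (A i)))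
      = (\<Prod>i<n. exp ((z * v i) * measure (N \<omega>) (A i)))" for \<omega>
    by (simp add: exp_sum[symmetric] sum_distrib_left mult.assoc)
  have ind: "indep_vars (\<lambda>_. borel) (\<lambda>i \<omega>. exp ((z * v i) * measure (N \<omega>) (A i))) {..<n}"
    unfolding measure_def
    by (rule indep_vars_compose2[where Y="\<lambda>i x. exp ((z * v i) * enn2real x)", OF indep_counts])
      (use A dj in auto)
  have I: "integrable M (\<lambda>\<omega>. exp ((z * v i) * measure (N \<omega>) (A i)))" if "i \<in> {..<n}" for i
    using A that by (intro integrable_exp_count) auto
  show ?int unfolding e by (rule indep_vars_integrable[OF _ ind I]) auto
  have "(\<integral>\<omega>. exp (z * (\<Sum>i<n. v i * measure (N \<omega>) (A i))) \<partial>M)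
      = (\<Prod>i<n. \<integral>\<omega>. exp ((z * v i) * measure (N \<omega>) (A i)) \<partial>M)"
    unfolding e by (rule indep_vars_lebesgue_integral[OF _ ind I]) auto
  also have "\<dots> = (\<Prod>i<n. exp (measure m (A i) * (exp (z * v i) - 1)))"
    using A by (intro prod.cong refl expectation_exp_count) auto
  finally show ?eq by (simp add: exp_sum)
qed

text \<open>Campbell's formula for finitely many values. \<open>Y\<close> is a measurable version:
  the integral against \<open>N \<omega>\<close> is identified with it only where the counts of all
  pieces are finite, which holds almost surely.\<close>

lemma simple_exp_functional:
  fixes F :: "'b \<Rightarrow> real"
  assumes F: "simple_function m F" and fin: "emeasure m {x \<in> space m. F x \<noteq> 0} < \<infinity>"
  obtains Y where "Y \<in> borel_measurable M"
    "AE \<omega> in M. integrable (N \<omega>) F \<and> Y \<omega> = (\<integral>x. F x \<partial>N \<omega>)"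
    "\<And>z :: complex. integrable M (\<lambda>\<omega>. exp (z * Y \<omega>))"
    "\<And>z :: complex. (\<integral>\<omega>. exp (z * Y \<omega>) \<partial>M) = exp (\<integral>x. exp (z * F x) - 1 \<partial>m)"
proof -
  obtain n :: nat and A v where A: "\<And>i. i < n \<Longrightarrow> A i \<in> sets m"
    and Asub: "\<And>i. i < n \<Longrightarrow> A i \<subseteq> {x \<in> space m. F x \<noteq> 0}"
    and dj: "disjoint_family_on A {..<n}"
    and h: "\<And>x (h :: real \<Rightarrow> complex). x \<in> space m \<Longrightarrow> h 0 = 0 \<Longrightarrow>
        h (F x) = (\<Sum>i<n. indicator (A i) x *\<^sub>R h (v i))"
    by (rule simple_function_disjoint_sum[OF F, where 'c=complex]) blast
  have [measurable]: "F \<in> borel_measurable m" by (rule borel_measurable_simple_function[OF F])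
  \<comment> \<open>The decomposition was obtained for complex values. Taking \<open>h\<close> to be
    the embedding of the reals recovers \<open>F\<close> itself, while
    \<open>h u = exp (z * u) - 1\<close> gives the exponent below.\<close>
  have hF: "F x = (\<Sum>i<n. indicator (A i) x *\<^sub>R v i)" if "x \<in> space m" for x
  proof -
    have "complex_of_real (F x) = (\<Sum>i<n. indicator (A i) x *\<^sub>R complex_of_real (v i))"
      using h[OF that, of complex_of_real] by simp
    also have "\<dots> = complex_of_real (\<Sum>i<n. indicator (A i) x *\<^sub>R v i)"
      by (simp only: of_real_sum of_real_mult scaleR_conv_of_real of_real_eq_id id_apply)
    finally show ?thesis by (simp only: of_real_eq_iff)
  qed
  have Afin: "emeasure m (A i) < \<infinity>" if "i < n" for i
    by (rule le_less_trans[OF emeasure_mono[OF Asub[OF that]] fin]) simp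
  define Y where "Y \<omega> = (\<Sum>i<n. v i * measure (N \<omega>) (A i))" for \<omega>
  show thesis
  proof (rule that[of Y])
    show "Y \<in> borel_measurable M" unfolding Y_def using A by auto
    have "AE \<omega> in M. \<forall>i\<in>{..<n}. \<exists>k::nat. emeasure (N \<omega>) (A i) = of_nat k"
      using A Afin by (intro AE_ball_countable[THEN iffD2]) (auto intro!: AE_count_nat)
    then show "AE \<omega> in M. integrable (N \<omega>) F \<and> Y \<omega> = (\<integral>x. F x \<partial>N \<omega>)"
      using AE_space
    proof eventually_elim
      case (elim \<omega>)
      have f: "emeasure (N \<omega>) (A i) < \<infinity>" if "i < n" for i
        using elim(1) that by (force simp: of_nat_less_top)
      have hb: "has_bochner_integral (N \<omega>) (\<lambda>x. indicator (A i) x *\<^sub>R v i) (measure (N \<omega>) (A i) *\<^sub>R v i)"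
        if "i < n" for i
        using f[OF that] A[OF that] sets_N[OF elim(2)]
        by (intro has_bochner_integral_scaleR_left has_bochner_integral_real_indicator) auto
      have "has_bochner_integral (N \<omega>) (\<lambda>x. \<Sum>i<n. indicator (A i) x *\<^sub>R v i)
          (\<Sum>i<n. measure (N \<omega>) (A i) *\<^sub>R v i)"
        using hb by (intro has_bochner_integral_sum) auto
      then have "has_bochner_integral (N \<omega>) F (Y \<omega>)"
        by (subst has_bochner_integral_cong[OF refl _ refl])
          (auto simp: hF space_N[OF elim(2)] Y_def mult.commute)
      then show ?case by (auto simp: has_bochner_integral_iff)
    qed
    fix z :: complex
    show "integrable M (\<lambda>\<omega>. exp (z * Y \<omega>))"
      unfolding Y_def by (rule integrable_exp_counts[OF A Afin dj])
    have "has_bochner_integral m (\<lambda>x. \<Sum>i<n. indicator (A i) x *\<^sub>R (exp (z * v i) - 1))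
          (\<Sum>i<n. measure m (A i) *\<^sub>R (exp (z * v i) - 1))"
      using A Afin
      by (intro has_bochner_integral_sum has_bochner_integral_scaleR_left has_bochner_integral_real_indicator) auto
    then have "has_bochner_integral m (\<lambda>x. exp (z * F x) - 1) (\<Sum>i<n. measure m (A i) * (exp (z * v i) - 1))"
      by (subst has_bochner_integral_cong[OF refl _ refl])
        (auto simp: h[of _ "\<lambda>u. exp (z * u) - 1"] scaleR_conv_of_real)
    then show "(\<integral>\<omega>. exp (z * Y \<omega>) \<partial>M) = exp (\<integral>x. exp (z * F x) - 1 \<partial>m)"
      using expectation_exp_counts[OF A Afin dj, of z v] by (simp add: Y_def has_bochner_integral_iff)
  qed
qed

end

section \<open>Elementary bounds for exponentials and for supports of simple functions\<close>

text \<open>By convexity the curve lies below its chord over [0, \<eta>]. This turns the exponent in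
  Campbell's formula into a multiple of the first moment of the integrand.\<close>

lemma exp_minus_one_le_chord:
  fixes a x \<eta> :: real
  assumes "0 \<le> x" "x \<le> \<eta>" "0 < \<eta>"
  shows "exp (a * x) - 1 \<le> (exp (a * \<eta>) - 1) / \<eta> * x"
proof -
  have "exp ((1 - x / \<eta>) *\<^sub>R 0 + (x / \<eta>) *\<^sub>R (a * \<eta>)) \<le> (1 - x / \<eta>) * exp 0 + (x / \<eta>) * exp (a * \<eta>)"
    using assms exp_convex by (intro convex_onD) auto
  moreover have "(x / \<eta>) *\<^sub>R (a * \<eta>) = a * x" using assms by simp
  ultimately have "exp (a * x) \<le> (1 - x / \<eta>) + (x / \<eta>) * exp (a * \<eta>)" by simp
  then show ?thesis by (simp add: algebra_simps diff_divide_distrib)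
qed

text \<open>The trivial bound 2 serves for large \<open>x\<close>, the Lipschitz bound for small
  \<open>x\<close>; together they are governed by \<open>min 1 \<bar>x\<bar>\<close>, the weight
  that expresses finite variation.\<close>

lemma cmod_iexp_minus_one_le: "cmod (iexp (\<theta> * x) - 1) \<le> (2 + \<bar>\<theta>\<bar>) * min 1 \<bar>x\<bar>"
proof -
  have 1: "norm (iexp (\<theta> * x) - 1) \<le> 2" using norm_triangle_ineq4[of "iexp (\<theta> * x)" 1] by simp
  have 2: "norm (iexp (\<theta> * x) - 1) \<le> \<bar>\<theta>\<bar> * \<bar>x\<bar>"
    using iexp_approx1[of "\<theta> * x" 0] by (simp add: abs_mult)
  show ?thesis
  proof (cases "\<bar>x\<bar> \<le> 1")
    case True
    then show ?thesis using 2 by (simp add: algebra_simps)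
  next
    case False
    then show ?thesis using 1 by (simp add: algebra_simps)
  qed
qed

text \<open>A simple function has a smallest nonzero absolute value, so its support lies in a
  superlevel set of \<open>min 1 \<bar>f x\<bar>\<close>, which Markov's inequality makes finite.
  The factor 2 is the one that approximation by simple functions provides.\<close>

lemma finite_support_simple_function:
  fixes f F :: "'b \<Rightarrow> real"
  assumes F: "simple_function m F" and f: "integrable m (\<lambda>x. min 1 \<bar>f x\<bar>)"
    and le: "\<And>x. x \<in> space m \<Longrightarrow> \<bar>F x\<bar> \<le> 2 * \<bar>f x\<bar>"
  shows "emeasure m {x \<in> space m. F x \<noteq> 0} < \<infinity>"
proof -
  \<comment> \<open>The inserted 2 keeps the set nonempty when \<open>F\<close> vanishes and caps
    \<open>d\<close> at 1, so that \<open>d \<le> min 1 \<bar>f x\<bar>\<close> holds wherever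
    \<open>F\<close> is nonzero.\<close>
  define V where "V = insert 2 (abs ` (F ` space m - {0}))"
  have V: "finite V" "V \<noteq> {}" using F by (auto simp: V_def simple_function_def)
  define d where "d = Min V / 2"
  have d0: "0 < d" using V by (auto simp: d_def V_def)
  have d1: "d \<le> 1" using V by (auto simp: d_def V_def intro: min.coboundedI1)
  have dF: "d \<le> \<bar>F x\<bar> / 2" if "x \<in> space m" "F x \<noteq> 0" for x
    using V that by (auto simp: d_def V_def intro!: Min_le)
  have [measurable]: "(\<lambda>x. min 1 \<bar>f x\<bar>) \<in> borel_measurable m" using f by auto
  have [measurable]: "F \<in> borel_measurable m" by (rule borel_measurable_simple_function[OF F])
  have "emeasure m {x \<in> space m. F x \<noteq> 0} \<le> emeasure m {x \<in> space m. d \<le> min 1 \<bar>f x\<bar>}"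
  proof (intro emeasure_mono subsetI)
    fix x assume "x \<in> {x \<in> space m. F x \<noteq> 0}"
    then show "x \<in> {x \<in> space m. d \<le> min 1 \<bar>f x\<bar>}" using le[of x] dF[of x] d1 by auto
  qed measurable
  also have "\<dots> \<le> ennreal (1 / d) * (\<integral>\<^sup>+x. ennreal (min 1 \<bar>f x\<bar>) \<partial>m)"
  proof -
    have "emeasure m {x \<in> space m. 1 \<le> ennreal (1 / d) * ennreal (min 1 \<bar>f x\<bar>)}
        \<le> ennreal (1 / d) * (\<integral>\<^sup>+x. ennreal (min 1 \<bar>f x\<bar>) * indicator (space m) x \<partial>m)"
      by (rule nn_integral_Markov_inequality) auto
    also have "(\<integral>\<^sup>+x. ennreal (min 1 \<bar>f x\<bar>) * indicator (space m) x \<partial>m) = (\<integral>\<^sup>+x. ennreal (min 1 \<bar>f x\<bar>) \<partial>m)"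
      by (rule nn_integral_cong) auto
    also have "{x \<in> space m. 1 \<le> ennreal (1 / d) * ennreal (min 1 \<bar>f x\<bar>)} = {x \<in> space m. d \<le> min 1 \<bar>f x\<bar>}"
      using d0 by (auto simp: ennreal_mult''[symmetric] field_simps simp flip: ennreal_1)
    finally show ?thesis .
  qed
  also have "\<dots> < \<infinity>"
  proof -
    have "(\<integral>\<^sup>+x. ennreal (min 1 \<bar>f x\<bar>) \<partial>m) = (\<integral>\<^sup>+x. ennreal (norm (min 1 \<bar>f x\<bar>)) \<partial>m)"
      by (rule nn_integral_cong) auto
    also have "\<dots> < \<infinity>" using f by (auto simp: integrable_iff_bounded)
    finally show ?thesis by (auto simp: ennreal_mult_less_top)
  qed
  finally show ?thesis .
qed

section \<open>Integrands that are not simple: moments, integrability, characteristic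
  functions\<close>

context poisson_rm
begin

lemma simple_real_exp_functional:
  fixes F :: "'b \<Rightarrow> real"
  assumes F: "simple_function m F" and fin: "emeasure m {x \<in> space m. F x \<noteq> 0} < \<infinity>"
  obtains Y where "Y \<in> borel_measurable M"
    "AE \<omega> in M. integrable (N \<omega>) F \<and> Y \<omega> = (\<integral>x. F x \<partial>N \<omega>)"
    "\<And>a :: real. (\<integral>\<^sup>+\<omega>. ennreal (exp (a * Y \<omega>)) \<partial>M) = ennreal (exp (\<integral>x. exp (a * F x) - 1 \<partial>m))"
proof -
  obtain Y where Y: "Y \<in> borel_measurable M"
    "AE \<omega> in M. integrable (N \<omega>) F \<and> Y \<omega> = (\<integral>x. F x \<partial>N \<omega>)"
    "\<And>z :: complex. integrable M (\<lambda>\<omega>. exp (z * Y \<omega>))"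
    "\<And>z :: complex. (\<integral>\<omega>. exp (z * Y \<omega>) \<partial>M) = exp (\<integral>x. exp (z * F x) - 1 \<partial>m)"
    using simple_exp_functional[OF F fin] by blast
  have e: "complex_of_real (exp (a * u)) = exp (complex_of_real a * complex_of_real u)" for a u
    by (simp only: exp_of_real[symmetric] of_real_mult)
  show thesis
  proof (rule that[OF Y(1,2)])
    fix a :: real
    have int: "integrable M (\<lambda>\<omega>. exp (a * Y \<omega>))"
      using Y(3)[of "complex_of_real a"] by (simp only: e[symmetric] complex_of_real_integrable_eq)
    have "complex_of_real (\<integral>\<omega>. exp (a * Y \<omega>) \<partial>M) = (\<integral>\<omega>. exp (complex_of_real a * Y \<omega>) \<partial>M)"
      by (simp only: e[symmetric] integral_complex_of_real)
    also have "\<dots> = exp (\<integral>x. exp (complex_of_real a * F x) - 1 \<partial>m)" by (rule Y(4))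
    also have "(\<integral>x. exp (complex_of_real a * F x) - 1 \<partial>m) = complex_of_real (\<integral>x. exp (a * F x) - 1 \<partial>m)"
      by (subst integral_complex_of_real[symmetric]) (simp only: e of_real_diff of_real_1)
    finally have "(\<integral>\<omega>. exp (a * Y \<omega>) \<partial>M) = exp (\<integral>x. exp (a * F x) - 1 \<partial>m)"
      by (simp only: exp_of_real of_real_eq_iff)
    then show "(\<integral>\<^sup>+\<omega>. ennreal (exp (a * Y \<omega>)) \<partial>M) = ennreal (exp (\<integral>x. exp (a * F x) - 1 \<partial>m))"
      by (subst nn_integral_eq_integral[OF int]) auto
  qed
qed

text \<open>Simple functions approximating \<open>f\<close> from below reduce both claims to
  finitely many counts. The chord bound is uniform along the sequence, and Fatou carries it to the
  limit.\<close>

lemma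
  fixes f :: "'b \<Rightarrow> real"
  assumes f[measurable]: "f \<in> borel_measurable m" and int: "integrable m f"
    and bd: "\<And>x. x \<in> space m \<Longrightarrow> 0 \<le> f x \<and> f x \<le> \<eta>" and eta: "0 < \<eta>"
  shows AE_integrable_bounded: "AE \<omega> in M. integrable (N \<omega>) f" (is ?AE)
    and exp_moment_le: "0 \<le> a \<Longrightarrow>
      (\<integral>\<^sup>+\<omega>. ennreal (exp (a * (\<integral>x. f x \<partial>N \<omega>))) \<partial>M) \<le> ennreal (exp ((exp (a * \<eta>) - 1) / \<eta> * (\<integral>x. f x \<partial>m)))"
      (is "_ \<Longrightarrow> ?le a")
proof -
  obtain U where U: "\<And>i. simple_function m (U i)" "incseq U" "\<And>i x. U i x < top"
    "\<And>x. (SUP i. U i x) = ennreal (f x)"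
    using borel_measurable_implies_simple_function_sequence'[of "\<lambda>x. ennreal (f x)" m]
    by (auto simp: image_comp)
  define G where "G i x = enn2real (U i x)" for i x
  have G: "simple_function m (G i)" for i
    unfolding G_def by (rule simple_function_compose1[OF U(1)])
  have UG: "U i x = ennreal (G i x)" for i x using U(3)[of i x] by (simp add: G_def)
  have Gnn: "0 \<le> G i x" for i x by (simp add: G_def)
  have Gle: "G i x \<le> f x" if "x \<in> space m" for i x
  proof -
    have "ennreal (G i x) \<le> ennreal (f x)" unfolding UG[symmetric] U(4)[symmetric] by (rule SUP_upper) simp
    then show ?thesis using bd[OF that] by (simp add: ennreal_le_iff)
  qed
  have Glim: "(\<lambda>i. G i x) \<longlonglongrightarrow> f x" if "x \<in> space m" for x
  proof -
    have "(\<lambda>i. U i x) \<longlonglongrightarrow> (SUP i. U i x)"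
      using U(2) by (intro LIMSEQ_SUP) (auto simp: incseq_def le_fun_def)
    then have "(\<lambda>i. ennreal (G i x)) \<longlonglongrightarrow> ennreal (f x)" unfolding U(4) unfolding UG .
    then show ?thesis using bd[OF that] Gnn by (subst (asm) tendsto_ennreal_iff) auto
  qed
  have [measurable]: "G i \<in> borel_measurable m" for i by (rule borel_measurable_simple_function[OF G])
  have min_int: "integrable m (\<lambda>x. min 1 \<bar>f x\<bar>)"
    by (rule Bochner_Integration.integrable_bound[OF int]) auto
  have fs: "emeasure m {x \<in> space m. G i x \<noteq> 0} < \<infinity>" for i
  proof (rule finite_support_simple_function[OF G min_int])
    show "\<bar>G i x\<bar> \<le> 2 * \<bar>f x\<bar>" if "x \<in> space m" for x
      using Gle[OF that, of i] Gnn[of i x] by linarith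
  qed
  have "\<exists>Y. \<forall>i. Y i \<in> borel_measurable M \<and>
    (AE \<omega> in M. integrable (N \<omega>) (G i) \<and> Y i \<omega> = (\<integral>x. G i x \<partial>N \<omega>)) \<and>
    (\<forall>a :: real. (\<integral>\<^sup>+\<omega>. ennreal (exp (a * Y i \<omega>)) \<partial>M) = ennreal (exp (\<integral>x. exp (a * G i x) - 1 \<partial>m)))"
  proof (rule choice, rule allI)
    show "\<exists>Y. Y \<in> borel_measurable M \<and>
      (AE \<omega> in M. integrable (N \<omega>) (G i) \<and> Y \<omega> = (\<integral>x. G i x \<partial>N \<omega>)) \<and>
      (\<forall>a :: real. (\<integral>\<^sup>+\<omega>. ennreal (exp (a * Y \<omega>)) \<partial>M) = ennreal (exp (\<integral>x. exp (a * G i x) - 1 \<partial>m)))" for i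
      by (rule simple_real_exp_functional[OF G fs, of i]) blast
  qed
  then obtain Y where Y0: "\<forall>i. Y i \<in> borel_measurable M \<and>
    (AE \<omega> in M. integrable (N \<omega>) (G i) \<and> Y i \<omega> = (\<integral>x. G i x \<partial>N \<omega>)) \<and>
    (\<forall>a :: real. (\<integral>\<^sup>+\<omega>. ennreal (exp (a * Y i \<omega>)) \<partial>M) = ennreal (exp (\<integral>x. exp (a * G i x) - 1 \<partial>m)))" ..
  have [measurable]: "Y i \<in> borel_measurable M" for i using Y0 by blast
  have Y: "AE \<omega> in M. integrable (N \<omega>) (G i) \<and> Y i \<omega> = (\<integral>x. G i x \<partial>N \<omega>)" for i
    using Y0[THEN spec, of i] by (elim conjE)
  have YE: "(\<integral>\<^sup>+\<omega>. ennreal (exp (a * Y i \<omega>)) \<partial>M) = ennreal (exp (\<integral>x. exp (a * G i x) - 1 \<partial>m))" for i a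
    using Y0[THEN spec, of i] by (elim conjE) (erule spec)
  have YAE: "AE \<omega> in M. \<forall>i. integrable (N \<omega>) (G i) \<and> Y i \<omega> = (\<integral>x. G i x \<partial>N \<omega>)"
    using Y by (subst AE_all_countable) auto
  have bound: "(\<integral>\<^sup>+\<omega>. ennreal (exp (a * Y i \<omega>)) \<partial>M) \<le> ennreal (exp ((exp (a * \<eta>) - 1) / \<eta> * (\<integral>x. f x \<partial>m)))"
    if a: "0 \<le> a" for i a
  proof -
    have 1: "exp (a * G i x) - 1 \<le> (exp (a * \<eta>) - 1) / \<eta> * f x" if "x \<in> space m" for x
    proof -
      have "exp (a * G i x) - 1 \<le> exp (a * f x) - 1" using Gle[OF that] a by (simp add: mult_left_mono)
      also have "\<dots> \<le> (exp (a * \<eta>) - 1) / \<eta> * f x" using bd[OF that] eta by (intro exp_minus_one_le_chord) auto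
      finally show ?thesis .
    qed
    have "(\<integral>x. exp (a * G i x) - 1 \<partial>m) \<le> (\<integral>x. (exp (a * \<eta>) - 1) / \<eta> * f x \<partial>m)"
      using int a bd eta 1 by (intro integral_mono') auto
    then show ?thesis unfolding YE using int by (auto simp: ennreal_le_iff)
  qed
  show ae: ?AE
  proof -
    \<comment> \<open>The case \<open>a = 1\<close> with \<open>u \<le> exp u\<close> keeps the
      means of \<open>Y i\<close> bounded, so their liminf is finite almost surely. A second use of
      Fatou, against \<open>N \<omega>\<close>, turns this into integrability.\<close>
    have "(\<integral>\<^sup>+\<omega>. liminf (\<lambda>i. ennreal (Y i \<omega>)) \<partial>M) \<le> liminf (\<lambda>i. \<integral>\<^sup>+\<omega>. ennreal (Y i \<omega>) \<partial>M)"
      by (rule nn_integral_liminf) auto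
    also have "\<dots> \<le> ennreal (exp ((exp (1 * \<eta>) - 1) / \<eta> * (\<integral>x. f x \<partial>m)))"
    proof (rule Liminf_le)
      show "\<forall>\<^sub>F i in sequentially. (\<integral>\<^sup>+\<omega>. ennreal (Y i \<omega>) \<partial>M)
        \<le> ennreal (exp ((exp (1 * \<eta>) - 1) / \<eta> * (\<integral>x. f x \<partial>m)))"
      proof (rule always_eventually, rule allI)
        fix i
        have "u \<le> exp u" for u :: real using exp_ge_add_one_self[of u] by linarith
        then have "(\<integral>\<^sup>+\<omega>. ennreal (Y i \<omega>) \<partial>M) \<le> (\<integral>\<^sup>+\<omega>. ennreal (exp (1 * Y i \<omega>)) \<partial>M)"
          by (intro nn_integral_mono ennreal_leI) simp
        also have "\<dots> \<le> ennreal (exp ((exp (1 * \<eta>) - 1) / \<eta> * (\<integral>x. f x \<partial>m)))" by (rule bound) simp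
        finally show "(\<integral>\<^sup>+\<omega>. ennreal (Y i \<omega>) \<partial>M) \<le> ennreal (exp ((exp (1 * \<eta>) - 1) / \<eta> * (\<integral>x. f x \<partial>m)))" .
      qed
    qed simp
    finally have "(\<integral>\<^sup>+\<omega>. liminf (\<lambda>i. ennreal (Y i \<omega>)) \<partial>M) \<noteq> \<infinity>" by (auto simp: top_unique)
    then have "AE \<omega> in M. liminf (\<lambda>i. ennreal (Y i \<omega>)) \<noteq> \<infinity>"
      by (intro nn_integral_PInf_AE) auto
    then show ?AE using YAE AE_space
    proof eventually_elim
      case (elim \<omega>)
      have [measurable_cong]: "sets (N \<omega>) = sets m" using elim by (simp add: sets_N)
      have "(\<integral>\<^sup>+x. ennreal (f x) \<partial>N \<omega>) = (\<integral>\<^sup>+x. liminf (\<lambda>i. ennreal (G i x)) \<partial>N \<omega>)"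
        using Glim space_N[OF elim(3)]
        by (intro nn_integral_cong lim_imp_Liminf[symmetric] tendsto_ennrealI) auto
      also have "\<dots> \<le> liminf (\<lambda>i. \<integral>\<^sup>+x. ennreal (G i x) \<partial>N \<omega>)" by (rule nn_integral_liminf) auto
      also have "\<dots> = liminf (\<lambda>i. ennreal (Y i \<omega>))"
        using elim Gnn by (intro arg_cong[of _ _ liminf] ext) (simp add: nn_integral_eq_integral)
      finally have "(\<integral>\<^sup>+x. ennreal (f x) \<partial>N \<omega>) < \<infinity>" using elim by (auto simp: less_top top_unique)
      moreover have "(\<integral>\<^sup>+x. ennreal (norm (f x)) \<partial>N \<omega>) = (\<integral>\<^sup>+x. ennreal (f x) \<partial>N \<omega>)"
        using bd space_N[OF elim(3)] by (intro nn_integral_cong) auto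
      ultimately show ?case by (intro integrableI_bounded) auto
    qed
  qed
  show "?le a" if a: "0 \<le> a"
  proof -
    have "AE \<omega> in M. (\<lambda>i. ennreal (exp (a * Y i \<omega>))) \<longlonglongrightarrow> ennreal (exp (a * (\<integral>x. f x \<partial>N \<omega>)))"
      using ae YAE AE_space
    proof eventually_elim
      case (elim \<omega>)
      have [measurable_cong]: "sets (N \<omega>) = sets m" using elim by (simp add: sets_N)
      have "(\<lambda>i. \<integral>x. G i x \<partial>N \<omega>) \<longlonglongrightarrow> (\<integral>x. f x \<partial>N \<omega>)"
        using Glim Gle Gnn space_N[OF elim(3)]
        by (intro integral_dominated_convergence[where w=f] elim) auto
      then show ?case using elim by (auto intro!: tendsto_intros)
    qed
    then have "AE \<omega> in M. ennreal (exp (a * (\<integral>x. f x \<partial>N \<omega>))) = liminf (\<lambda>i. ennreal (exp (a * Y i \<omega>)))"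
      by eventually_elim (rule lim_imp_Liminf[symmetric], auto)
    \<comment> \<open>The integrand is replaced almost everywhere by a liminf of measurable
      functions, so Fatou applies without asking whether the pathwise integral depends measurably on
      \<omega>.\<close>
    then have "(\<integral>\<^sup>+\<omega>. ennreal (exp (a * (\<integral>x. f x \<partial>N \<omega>))) \<partial>M) = (\<integral>\<^sup>+\<omega>. liminf (\<lambda>i. ennreal (exp (a * Y i \<omega>))) \<partial>M)"
      by (rule nn_integral_cong_AE)
    also have "\<dots> \<le> liminf (\<lambda>i. \<integral>\<^sup>+\<omega>. ennreal (exp (a * Y i \<omega>)) \<partial>M)"
      by (rule nn_integral_liminf) auto
    also have "\<dots> \<le> ennreal (exp ((exp (a * \<eta>) - 1) / \<eta> * (\<integral>x. f x \<partial>m)))"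
      by (intro Liminf_le always_eventually allI bound[OF a]) simp
    finally show ?thesis .
  qed
qed

text \<open>The superlevel sets of \<open>\<bar>f\<bar>\<close> shrink to the empty set with finite
  mass, so the probability that one of them contains no point of \<open>N \<omega>\<close> tends to
  1. Hence \<open>f\<close> is almost surely bounded on the finitely many points that it
  charges.\<close>

lemma AE_integrable_finite_support:
  fixes f :: "'b \<Rightarrow> real"
  assumes f[measurable]: "f \<in> borel_measurable m" and fin: "emeasure m {x \<in> space m. f x \<noteq> 0} < \<infinity>"
  shows "AE \<omega> in M. integrable (N \<omega>) f"
proof -
  define B where "B n = {x \<in> space m. real n < \<bar>f x\<bar>}" for n :: nat
  have B[measurable]: "B n \<in> sets m" for n by (auto simp: B_def)
  have Bfin: "emeasure m (B n) < \<infinity>" for n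
    by (rule le_less_trans[OF emeasure_mono fin]) (auto simp: B_def)
  have dec: "decseq B" by (auto simp: decseq_def B_def)
  have "(\<Inter>n. B n) = {}"
  proof -
    have "\<exists>n. x \<notin> B n" for x
    proof -
      obtain n where "\<bar>f x\<bar> < real n" using reals_Archimedean2 by blast
      then have "x \<notin> B n" by (simp add: B_def)
      then show ?thesis ..
    qed
    then show ?thesis by blast
  qed
  then have "(\<lambda>n. measure m (B n)) \<longlonglongrightarrow> measure m {}"
    using Lim_measure_decseq[of B m] dec Bfin by (simp add: less_top image_subset_iff B)
  then have lim: "(\<lambda>n. exp (- measure m (B n))) \<longlonglongrightarrow> exp (- 0)"
    by (intro tendsto_intros) simp
  define E where "E = {\<omega> \<in> space M. \<exists>n. emeasure (N \<omega>) (B n) = 0}"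
  have [measurable]: "E \<in> events" unfolding E_def by measurable
  have "exp (- measure m (B n)) \<le> prob E" for n
  proof -
    have "exp (- measure m (B n)) = prob {\<omega> \<in> space M. emeasure (N \<omega>) (B n) = of_nat 0}"
      using prob_count[OF B Bfin, of n 0] by simp
    also have "\<dots> \<le> prob E" by (rule finite_measure_mono) (auto simp: E_def)
    finally show ?thesis .
  qed
  then have "1 \<le> prob E" using LIMSEQ_le_const2[OF lim] by auto
  then have "prob E = 1" using prob_le_1[of E] by linarith
  then have "AE \<omega> in M. \<omega> \<in> E" by (subst prob_eq_1[symmetric]) auto
  moreover have "AE \<omega> in M. \<exists>k::nat. emeasure (N \<omega>) {x \<in> space m. f x \<noteq> 0} = of_nat k"
    by (rule AE_count_nat[OF _ fin]) measurable
  ultimately show ?thesis using AE_space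
  proof eventually_elim
    case (elim \<omega>)
    have [measurable_cong]: "sets (N \<omega>) = sets m" using elim by (simp add: sets_N)
    obtain n where n: "emeasure (N \<omega>) (B n) = 0" using elim by (auto simp: E_def)
    have "AE x in N \<omega>. x \<notin> B n" using n by (intro AE_not_in) (auto simp: null_sets_def)
    then show ?case
      using elim(2) space_N[OF elim(3)]
      by (intro integrableI_bounded_set[where A="{x \<in> space m. f x \<noteq> 0}" and B="real n"])
        (auto simp: B_def of_nat_less_top)
  qed
qed

text \<open>Splitting at \<open>\<bar>f x\<bar> = 1\<close> leaves a bounded part that is integrable
  under the intensity and a part whose support has finite mass; each falls under one of the two
  preceding criteria.\<close>

lemma AE_integrable_N:
  fixes f :: "'b \<Rightarrow> real"
  assumes f[measurable]: "f \<in> borel_measurable m" and int: "integrable m (\<lambda>x. min 1 \<bar>f x\<bar>)"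
  shows "AE \<omega> in M. integrable (N \<omega>) f"
proof -
  let ?g = "\<lambda>x. indicator {x \<in> space m. \<bar>f x\<bar> \<le> 1} x * \<bar>f x\<bar>"
  let ?h = "\<lambda>x. indicator {x \<in> space m. 1 < \<bar>f x\<bar>} x * f x"
  have "integrable m ?g"
    by (rule Bochner_Integration.integrable_bound[OF int]) (auto split: split_indicator)
  then have 1: "AE \<omega> in M. integrable (N \<omega>) ?g"
    by (intro AE_integrable_bounded[where \<eta>=1]) (auto split: split_indicator)
  have "emeasure m {x \<in> space m. ?h x \<noteq> 0} < \<infinity>"
  proof -
    have "emeasure m {x \<in> space m. ?h x \<noteq> 0} \<le> emeasure m {x \<in> space m. 1 \<le> 1 * ennreal (min 1 \<bar>f x\<bar>)}"
      by (intro emeasure_mono) (auto split: split_indicator)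
    also have "\<dots> \<le> 1 * (\<integral>\<^sup>+x. ennreal (min 1 \<bar>f x\<bar>) * indicator (space m) x \<partial>m)"
      by (rule nn_integral_Markov_inequality) auto
    also have "(\<integral>\<^sup>+x. ennreal (min 1 \<bar>f x\<bar>) * indicator (space m) x \<partial>m) = (\<integral>\<^sup>+x. ennreal (norm (min 1 \<bar>f x\<bar>)) \<partial>m)"
      by (rule nn_integral_cong) auto
    also have "1 * \<dots> < \<infinity>" using int by (auto simp: integrable_iff_bounded)
    finally show ?thesis .
  qed
  then have 2: "AE \<omega> in M. integrable (N \<omega>) ?h" by (intro AE_integrable_finite_support) auto
  show ?thesis using 1 2 AE_space
  proof eventually_elim
    case (elim \<omega>)
    have [measurable_cong]: "sets (N \<omega>) = sets m" using elim by (simp add: sets_N)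
    have "integrable (N \<omega>) (\<lambda>x. ?g x + \<bar>?h x\<bar>)" using elim by auto
    then show ?case
      by (rule Bochner_Integration.integrable_bound)
        (auto simp: space_N[OF elim(3)] split: split_indicator)
  qed
qed

text \<open>The simple approximations are dominated on both sides: by
  \<open>2 * \<bar>f x\<bar>\<close> under almost every \<open>N \<omega>\<close>, and by a multiple
  of \<open>min 1 \<bar>f x\<bar>\<close> under the intensity. Integrands without a finite mean are
  thereby included.\<close>

lemma integral_char_functional:
  fixes f :: "'b \<Rightarrow> real"
  assumes f[measurable]: "f \<in> borel_measurable m" and int: "integrable m (\<lambda>x. min 1 \<bar>f x\<bar>)"
  obtains Y where "Y \<in> borel_measurable M" "AE \<omega> in M. Y \<omega> = (\<integral>x. f x \<partial>N \<omega>)"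
    "\<And>\<theta>. (\<integral>\<omega>. iexp (\<theta> * Y \<omega>) \<partial>M) = exp (\<integral>x. iexp (\<theta> * f x) - 1 \<partial>m)"
proof -
  obtain F where F: "\<And>i. simple_function m (F i)"
    and Flim: "\<And>x. x \<in> space m \<Longrightarrow> (\<lambda>i. F i x) \<longlonglongrightarrow> f x"
    and Fle: "\<And>i x. x \<in> space m \<Longrightarrow> \<bar>F i x\<bar> \<le> 2 * \<bar>f x\<bar>"
    using borel_measurable_implies_sequence_metric[OF f, of 0] unfolding dist_real_def diff_0_right by metis
  have [measurable]: "F i \<in> borel_measurable m" for i by (rule borel_measurable_simple_function[OF F])
  have fs: "emeasure m {x \<in> space m. F i x \<noteq> 0} < \<infinity>" for i
    by (rule finite_support_simple_function[OF F int Fle])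
  have "\<exists>Y. \<forall>i. Y i \<in> borel_measurable M \<and>
    (AE \<omega> in M. integrable (N \<omega>) (F i) \<and> Y i \<omega> = (\<integral>x. F i x \<partial>N \<omega>)) \<and>
    (\<forall>z :: complex. (\<integral>\<omega>. exp (z * Y i \<omega>) \<partial>M) = exp (\<integral>x. exp (z * F i x) - 1 \<partial>m))"
  proof (rule choice, rule allI)
    show "\<exists>Y. Y \<in> borel_measurable M \<and>
      (AE \<omega> in M. integrable (N \<omega>) (F i) \<and> Y \<omega> = (\<integral>x. F i x \<partial>N \<omega>)) \<and>
      (\<forall>z :: complex. (\<integral>\<omega>. exp (z * Y \<omega>) \<partial>M) = exp (\<integral>x. exp (z * F i x) - 1 \<partial>m))" for i
      by (rule simple_exp_functional[OF F fs, of i]) blast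
  qed
  then obtain Y where Y0: "\<forall>i. Y i \<in> borel_measurable M \<and>
    (AE \<omega> in M. integrable (N \<omega>) (F i) \<and> Y i \<omega> = (\<integral>x. F i x \<partial>N \<omega>)) \<and>
    (\<forall>z :: complex. (\<integral>\<omega>. exp (z * Y i \<omega>) \<partial>M) = exp (\<integral>x. exp (z * F i x) - 1 \<partial>m))" ..
  have [measurable]: "Y i \<in> borel_measurable M" for i using Y0 by blast
  have Y: "AE \<omega> in M. integrable (N \<omega>) (F i) \<and> Y i \<omega> = (\<integral>x. F i x \<partial>N \<omega>)" for i
    using Y0[THEN spec, of i] by (elim conjE)
  have YE: "(\<integral>\<omega>. exp (z * Y i \<omega>) \<partial>M) = exp (\<integral>x. exp (z * F i x) - 1 \<partial>m)" for i and z :: complex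
    using Y0[THEN spec, of i] by (elim conjE) (erule spec)
  have YAE: "AE \<omega> in M. \<forall>i. integrable (N \<omega>) (F i) \<and> Y i \<omega> = (\<integral>x. F i x \<partial>N \<omega>)"
    using Y by (subst AE_all_countable) auto
  have conv: "AE \<omega> in M. (\<lambda>i. Y i \<omega>) \<longlonglongrightarrow> (\<integral>x. f x \<partial>N \<omega>)"
    using AE_integrable_N[OF f int] YAE AE_space
  proof eventually_elim
    case (elim \<omega>)
    have [measurable_cong]: "sets (N \<omega>) = sets m" using elim by (simp add: sets_N)
    have "(\<lambda>i. \<integral>x. F i x \<partial>N \<omega>) \<longlonglongrightarrow> (\<integral>x. f x \<partial>N \<omega>)"
      using Flim Fle space_N[OF elim(3)] elim(1)
      by (intro integral_dominated_convergence[where w="\<lambda>x. 2 * \<bar>f x\<bar>"]) auto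
    then show ?case using elim by auto
  qed
  \<comment> \<open>The pointwise \<open>lim\<close> is defined for every \<omega>, which gives a
    measurable version; it equals the integral wherever the sequence converges to it.\<close>
  define Z where "Z \<omega> = lim (\<lambda>i. Y i \<omega>)" for \<omega>
  have [measurable]: "Z \<in> borel_measurable M" unfolding Z_def by (rule borel_measurable_lim_metric) auto
  show thesis
  proof (rule that[of Z])
    show "AE \<omega> in M. Z \<omega> = (\<integral>x. f x \<partial>N \<omega>)"
      using conv by eventually_elim (auto simp: Z_def intro: limI)
    have convZ: "AE \<omega> in M. (\<lambda>i. Y i \<omega>) \<longlonglongrightarrow> Z \<omega>"
      using conv
    proof eventually_elim
      case (elim \<omega>)
      then show ?case using limI[OF elim] by (simp add: Z_def)
    qed
    fix \<theta> :: real
    have "(\<lambda>i. \<integral>\<omega>. exp ((\<i> * \<theta>) * Y i \<omega>) \<partial>M) \<longlonglongrightarrow> (\<integral>\<omega>. iexp (\<theta> * Z \<omega>) \<partial>M)"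
    proof (rule integral_dominated_convergence[where w="\<lambda>_. 1"])
      show "AE \<omega> in M. (\<lambda>i. exp ((\<i> * \<theta>) * Y i \<omega>)) \<longlonglongrightarrow> iexp (\<theta> * Z \<omega>)"
        using convZ by eventually_elim (auto intro!: tendsto_eq_intros simp: mult.assoc)
    qed auto
    moreover have "(\<lambda>i. exp (\<integral>x. exp ((\<i> * \<theta>) * F i x) - 1 \<partial>m)) \<longlonglongrightarrow> exp (\<integral>x. iexp (\<theta> * f x) - 1 \<partial>m)"
    proof (intro tendsto_exp integral_dominated_convergence[where w="\<lambda>x. (4 + 2 * \<bar>\<theta>\<bar>) * min 1 \<bar>f x\<bar>"])
      show "AE x in m. (\<lambda>i. exp ((\<i> * \<theta>) * F i x) - 1) \<longlonglongrightarrow> iexp (\<theta> * f x) - 1"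
        unfolding mult.assoc of_real_mult by (intro AE_I2 tendsto_intros Flim)
      show "AE x in m. norm (exp ((\<i> * \<theta>) * F i x) - 1) \<le> (4 + 2 * \<bar>\<theta>\<bar>) * min 1 \<bar>f x\<bar>" for i
      proof (rule AE_I2)
        fix x assume x: "x \<in> space m"
        have "cmod (iexp (\<theta> * F i x) - 1) \<le> (2 + \<bar>\<theta>\<bar>) * min 1 \<bar>F i x\<bar>" by (rule cmod_iexp_minus_one_le)
        also have "\<dots> \<le> (2 + \<bar>\<theta>\<bar>) * (2 * min 1 \<bar>f x\<bar>)"
          using Fle[OF x, of i] by (intro mult_left_mono) (auto simp: min_def)
        finally have "cmod (iexp (\<theta> * F i x) - 1) \<le> (4 + 2 * \<bar>\<theta>\<bar>) * min 1 \<bar>f x\<bar>" by (simp add: algebra_simps)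
        then show "norm (exp ((\<i> * \<theta>) * F i x) - 1) \<le> (4 + 2 * \<bar>\<theta>\<bar>) * min 1 \<bar>f x\<bar>"
          by (simp add: mult.assoc)
      qed
    qed (use int in auto)
    ultimately show "(\<integral>\<omega>. iexp (\<theta> * Z \<omega>) \<partial>M) = exp (\<integral>x. iexp (\<theta> * f x) - 1 \<partial>m)"
      unfolding YE by (rule LIMSEQ_unique)
  qed measurable
qed

end

section \<open>Levy processes of finite variation\<close>

text \<open>Integrated against \<open>N \<omega>\<close>, this is the sum of \<open>g\<close> over
  the jumps made up to time \<open>t\<close>. Values in a vector space allow the complex integrands
  \<open>iexp (\<theta> * x) - 1\<close>.\<close>

definition jump_function :: "real \<Rightarrow> (real \<Rightarrow> 'c :: real_vector) \<Rightarrow> real \<times> real \<Rightarrow> 'c" where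
  "jump_function t g p = indicator {0..t} (fst p) *\<^sub>R g (snd p)"

lemma measurable_fst_levy_intensity[measurable]: "fst \<in> levy_intensity \<nu> \<rightarrow>\<^sub>M borel"
proof -
  have "(\<lambda>r. r) \<in> restrict_space lborel {0::real..} \<rightarrow>\<^sub>M borel"
    by (rule measurable_restrict_space1) simp
  from measurable_compose[OF measurable_fst this] show ?thesis by (simp add: levy_intensity_def)
qed

lemma measurable_snd_levy_intensity:
  assumes "sets \<nu> = sets borel"
  shows "snd \<in> levy_intensity \<nu> \<rightarrow>\<^sub>M borel"
proof -
  have "(\<lambda>x. x) \<in> restrict_space \<nu> (- {0::real}) \<rightarrow>\<^sub>M borel"
    by (intro measurable_restrict_space1 measurable_ident_sets assms)
  from measurable_compose[OF measurable_snd this] show ?thesis by (simp add: levy_intensity_def)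
qed

lemma measurable_jump_function:
  fixes g :: "real \<Rightarrow> 'c :: {real_normed_vector, second_countable_topology}"
  assumes \<nu>: "sets \<nu> = sets borel" and [measurable]: "g \<in> borel_measurable borel"
  shows "jump_function t g \<in> borel_measurable (levy_intensity \<nu>)"
proof -
  note measurable_snd_levy_intensity[OF \<nu>, measurable]
  show ?thesis unfolding jump_function_def by measurable
qed

text \<open>Fubini for time and jump size. The intensity omits the jump size 0 while \<nu> is a
  measure on all reals; \<open>g 0 = 0\<close> makes the two integrals agree.\<close>

lemma
  fixes g :: "real \<Rightarrow> 'c :: {banach, second_countable_topology}"
  assumes sf: "sigma_finite_measure \<nu>" and \<nu>: "sets \<nu> = sets borel"
    and g[measurable]: "g \<in> borel_measurable borel" and int: "integrable \<nu> g" and g0: "g 0 = 0" and t: "0 \<le> t"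
  shows integrable_jump_function: "integrable (levy_intensity \<nu>) (jump_function t g)" (is ?I)
    and integral_jump_function: "(\<integral>p. jump_function t g p \<partial>levy_intensity \<nu>) = t *\<^sub>R (\<integral>x. g x \<partial>\<nu>)" (is ?E)
proof -
  let ?P = "restrict_space lborel {0::real..}" and ?Q = "restrict_space \<nu> (- {0})"
  have sp: "space \<nu> = UNIV" using sets_eq_imp_space_eq[OF \<nu>] by simp
  interpret P: sigma_finite_measure ?P
    by (rule sigma_finite_measure_restrict_space) (auto simp: sigma_finite_lborel)
  interpret Q: sigma_finite_measure ?Q
    by (rule sigma_finite_measure_restrict_space[OF sf]) (auto simp: \<nu>)
  interpret pair_sigma_finite ?P ?Q ..
  have Qint: "integrable ?Q h \<longleftrightarrow> integrable \<nu> h" "(\<integral>x. h x \<partial>?Q) = (\<integral>x. h x \<partial>\<nu>)"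
    if "h 0 = 0" for h :: "real \<Rightarrow> 'd :: {banach, second_countable_topology}"
  proof -
    have "indicator (- {0}) x *\<^sub>R h x = h x" for x using that by (cases "x = 0") auto
    then show "integrable ?Q h \<longleftrightarrow> integrable \<nu> h" "(\<integral>x. h x \<partial>?Q) = (\<integral>x. h x \<partial>\<nu>)"
      using \<nu> sp by (simp_all add: integrable_restrict_space integral_restrict_space set_integrable_def
        set_lebesgue_integral_def)
  qed
  have Pind: "integrable ?P (\<lambda>r. indicator {0..t} r *\<^sub>R c)" "(\<integral>r. indicator {0..t} r *\<^sub>R c \<partial>?P) = t *\<^sub>R c"
    for c :: "'d :: {banach, second_countable_topology}"
  proof -
    have "indicator {0..} r *\<^sub>R indicator {0..t} r *\<^sub>R c = indicator {0..t} r *\<^sub>R c" for r :: real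
      by (auto split: split_indicator)
    moreover have "has_bochner_integral lborel (\<lambda>r. indicator {0..t} r *\<^sub>R c) (measure lborel {0..t} *\<^sub>R c)"
      using t by (intro has_bochner_integral_scaleR_left has_bochner_integral_real_indicator) auto
    moreover have r: "{0::real..} \<inter> space lborel \<in> sets lborel" by simp
    ultimately show "integrable ?P (\<lambda>r. indicator {0..t} r *\<^sub>R c)" "(\<integral>r. indicator {0..t} r *\<^sub>R c \<partial>?P) = t *\<^sub>R c"
      using t by (simp_all only: integrable_restrict_space[OF r] integral_restrict_space[OF r] set_integrable_def
        set_lebesgue_integral_def has_bochner_integral_iff) simp_all
  qed
  have meas: "jump_function t g \<in> borel_measurable (?P \<Otimes>\<^sub>M ?Q)"
    using measurable_jump_function[OF \<nu> g] by (simp add: levy_intensity_def)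
  have I: "integrable (?P \<Otimes>\<^sub>M ?Q) (jump_function t g)"
  proof (rule Fubini_integrable[OF meas])
    have "(\<integral>x. norm (jump_function t g (r, x)) \<partial>?Q) = indicator {0..t} r *\<^sub>R (\<integral>x. norm (g x) \<partial>\<nu>)" for r
      using Qint(2)[of "\<lambda>x. norm (g x)"] g0 by (simp add: jump_function_def)
    then show "integrable ?P (\<lambda>r. \<integral>x. norm (jump_function t g (r, x)) \<partial>?Q)"
      using Pind(1)[of "\<integral>x. norm (g x) \<partial>\<nu>"] by simp
    show "AE r in ?P. integrable ?Q (\<lambda>x. jump_function t g (r, x))"
      using Qint(1)[of g] int g0 by (simp add: jump_function_def)
  qed
  then show ?I by (simp add: levy_intensity_def)
  have "(\<integral>p. jump_function t g p \<partial>levy_intensity \<nu>) = (\<integral>r. (\<integral>x. jump_function t g (r, x) \<partial>?Q) \<partial>?P)"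
    unfolding levy_intensity_def by (rule integral_fst'[OF I, symmetric])
  also have "\<dots> = (\<integral>r. indicator {0..t} r *\<^sub>R (\<integral>x. g x \<partial>\<nu>) \<partial>?P)"
    using Qint(2)[of g] g0 by (simp add: jump_function_def)
  also have "\<dots> = t *\<^sub>R (\<integral>x. g x \<partial>\<nu>)" by (rule Pind(2))
  finally show ?E .
qed

text \<open>The single condition \<open>fv\<close> packs together finite variation of the small
  jumps and finite mass of the large ones.\<close>

locale poisson_jumps = poisson_rm M "levy_intensity \<nu>" N
  for M :: "'a measure" and \<nu> :: "real measure" and N +
  assumes sf: "sigma_finite_measure \<nu>" and \<nu>: "sets \<nu> = sets borel"
    and fv: "integrable \<nu> (\<lambda>x. min 1 \<bar>x\<bar>)"
begin

lemma truncated_jump_integrable: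
  fixes g :: "real \<Rightarrow> real"
  assumes [measurable]: "g \<in> borel_measurable borel" and g: "\<And>x. \<bar>g x\<bar> \<le> \<bar>x\<bar>" and t: "0 \<le> t"
  shows "integrable (levy_intensity \<nu>) (\<lambda>p. min 1 \<bar>jump_function t g p\<bar>)"
proof -
  have [measurable_cong]: "sets \<nu> = sets borel" by (rule \<nu>)
  have m: "integrable \<nu> (\<lambda>x. min 1 \<bar>g x\<bar>)"
  proof (rule Bochner_Integration.integrable_bound[OF fv])
    show "AE x in \<nu>. norm (min 1 \<bar>g x\<bar>) \<le> norm (min 1 \<bar>x\<bar>)"
      using g by (auto intro!: AE_I2 min.coboundedI2 simp: min_le_iff_disj)
  qed measurable
  have "min 1 \<bar>jump_function t g p\<bar> = jump_function t (\<lambda>x. min 1 \<bar>g x\<bar>) p" for p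
    by (auto simp: jump_function_def split: split_indicator)
  then show ?thesis
    using integrable_jump_function[OF sf \<nu> _ m _ t] g[of 0] by simp
qed

text \<open>The condition \<open>\<bar>g x\<bar> \<le> \<bar>x\<bar>\<close> covers the identity and
  all of its truncations, with \<open>min 1 \<bar>x\<bar>\<close> as the common majorant.\<close>

lemma jump_char_functional:
  fixes g :: "real \<Rightarrow> real"
  assumes g[measurable]: "g \<in> borel_measurable borel" and le: "\<And>x. \<bar>g x\<bar> \<le> \<bar>x\<bar>" and t: "0 \<le> t"
  obtains Y where "Y \<in> borel_measurable M" "AE \<omega> in M. Y \<omega> = (\<integral>p. jump_function t g p \<partial>N \<omega>)"
    "\<And>\<theta>. (\<integral>\<omega>. iexp (\<theta> * Y \<omega>) \<partial>M) = exp (t * (\<integral>x. iexp (\<theta> * g x) - 1 \<partial>\<nu>))"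
proof -
  have [measurable_cong]: "sets \<nu> = sets borel" by (rule \<nu>)
  obtain Y where Y: "Y \<in> borel_measurable M" "AE \<omega> in M. Y \<omega> = (\<integral>p. jump_function t g p \<partial>N \<omega>)"
    "\<And>\<theta>. (\<integral>\<omega>. iexp (\<theta> * Y \<omega>) \<partial>M) = exp (\<integral>p. iexp (\<theta> * jump_function t g p) - 1 \<partial>levy_intensity \<nu>)"
    by (rule integral_char_functional[OF measurable_jump_function[OF \<nu> g] truncated_jump_integrable[OF g le t]])
      blast
  have g0: "g 0 = 0" using le[of 0] by simp
  have "(\<integral>\<omega>. iexp (\<theta> * Y \<omega>) \<partial>M) = exp (t * (\<integral>x. iexp (\<theta> * g x) - 1 \<partial>\<nu>))" for \<theta>
  proof -
    have i: "integrable \<nu> (\<lambda>x. iexp (\<theta> * g x) - 1)"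
    proof (rule Bochner_Integration.integrable_bound)
      show "integrable \<nu> (\<lambda>x. (2 + \<bar>\<theta>\<bar>) * min 1 \<bar>x\<bar>)" using fv by simp
      show "AE x in \<nu>. norm (iexp (\<theta> * g x) - 1) \<le> norm ((2 + \<bar>\<theta>\<bar>) * min 1 \<bar>x\<bar>)"
      proof (rule AE_I2)
        fix x
        have "cmod (iexp (\<theta> * g x) - 1) \<le> (2 + \<bar>\<theta>\<bar>) * min 1 \<bar>g x\<bar>" by (rule cmod_iexp_minus_one_le)
        also have "\<dots> \<le> (2 + \<bar>\<theta>\<bar>) * min 1 \<bar>x\<bar>" using le[of x] by (intro mult_left_mono) auto
        finally have "cmod (iexp (\<theta> * g x) - 1) \<le> (2 + \<bar>\<theta>\<bar>) * min 1 \<bar>x\<bar>" .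
        then show "norm (iexp (\<theta> * g x) - 1) \<le> norm ((2 + \<bar>\<theta>\<bar>) * min 1 \<bar>x\<bar>)" by simp
      qed
    qed measurable
    \<comment> \<open>Outside the time window the exponent is 0 and \<open>iexp 0 - 1\<close>
      vanishes, so this transformation commutes with the cut-off in time.\<close>
    have "iexp (\<theta> * jump_function t g p) - 1 = jump_function t (\<lambda>x. iexp (\<theta> * g x) - 1) p" for p
      by (auto simp: jump_function_def split: split_indicator)
    then show ?thesis
      unfolding Y(3) using integral_jump_function[OF sf \<nu> _ i _ t] g0 by (simp add: scaleR_conv_of_real)
  qed
  then show thesis using that Y by blast
qed

lemma AE_integrable_jump_function:
  fixes g :: "real \<Rightarrow> real"
  assumes g[measurable]: "g \<in> borel_measurable borel" and le: "\<And>x. \<bar>g x\<bar> \<le> \<bar>x\<bar>" and t: "0 \<le> t"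
  shows "AE \<omega> in M. integrable (N \<omega>) (jump_function t g)"
  by (rule AE_integrable_N[OF measurable_jump_function[OF \<nu> g] truncated_jump_integrable[OF g le t]])

text \<open>The absolute value of the sum is at most the sum of the absolute jumps, a bounded
  nonnegative integrand to which the exponential moment bound applies. Only the law is handed on,
  since later arguments never refer to the underlying variable.\<close>

lemma small_jumps_distribution:
  assumes \<eta>: "0 < \<eta>" "\<eta> \<le> 1" and t: "0 \<le> t"
  obtains S where "real_distribution S"
    "\<And>\<theta>. char S \<theta> = exp (t * (\<integral>x. indicator {-\<eta>..\<eta>} x *\<^sub>R (iexp (\<theta> * x) - 1) \<partial>\<nu>))"
    "\<And>a. 0 \<le> a \<Longrightarrow> (\<integral>\<^sup>+x. ennreal (exp (a * \<bar>x\<bar>)) \<partial>S)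
        \<le> ennreal (exp ((exp (a * \<eta>) - 1) / \<eta> * (t * (\<integral>x. indicator {-\<eta>..\<eta>} x * \<bar>x\<bar> \<partial>\<nu>))))"
proof -
  have [measurable_cong]: "sets \<nu> = sets borel" by (rule \<nu>)
  let ?g = "\<lambda>x. indicator {-\<eta>..\<eta>} x * x :: real" and ?h = "\<lambda>x. indicator {-\<eta>..\<eta>} x * \<bar>x\<bar> :: real"
  have gm: "?g \<in> borel_measurable borel" and hm: "?h \<in> borel_measurable borel" by measurable
  have gle: "\<bar>?g x\<bar> \<le> \<bar>x\<bar>" and hle: "\<bar>?h x\<bar> \<le> \<bar>x\<bar>" for x by (auto split: split_indicator)
  obtain Y where Y: "Y \<in> borel_measurable M" "AE \<omega> in M. Y \<omega> = (\<integral>p. jump_function t ?g p \<partial>N \<omega>)"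
    "\<And>\<theta>. (\<integral>\<omega>. iexp (\<theta> * Y \<omega>) \<partial>M) = exp (t * (\<integral>x. iexp (\<theta> * ?g x) - 1 \<partial>\<nu>))"
    using jump_char_functional[OF gm gle t] by blast
  note Y(1)[measurable]
  have hint: "integrable \<nu> ?h"
    using \<eta> by (intro Bochner_Integration.integrable_bound[OF fv]) (auto split: split_indicator)
  note J = measurable_jump_function[OF \<nu> hm] integrable_jump_function[OF sf \<nu> hm hint _ t]
  have bd: "0 \<le> jump_function t ?h p \<and> jump_function t ?h p \<le> \<eta>" for p
    using \<eta> by (auto simp: jump_function_def split: split_indicator)
  show thesis
  proof (rule that[of "distr M borel Y"])
    show "real_distribution (distr M borel Y)" by (rule real_distribution_distr) measurable
    fix \<theta>
    have "iexp (\<theta> * ?g x) - 1 = indicator {-\<eta>..\<eta>} x *\<^sub>R (iexp (\<theta> * x) - 1)" for x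
      by (auto split: split_indicator)
    then show "char (distr M borel Y) \<theta> = exp (t * (\<integral>x. indicator {-\<eta>..\<eta>} x *\<^sub>R (iexp (\<theta> * x) - 1) \<partial>\<nu>))"
      using Y(3)[of \<theta>] by (simp add: char_def integral_distr)
  next
    fix a :: real assume a: "0 \<le> a"
    have "(\<integral>\<^sup>+x. ennreal (exp (a * \<bar>x\<bar>)) \<partial>distr M borel Y) = (\<integral>\<^sup>+\<omega>. ennreal (exp (a * \<bar>Y \<omega>\<bar>)) \<partial>M)"
      by (subst nn_integral_distr) measurable
    also have "\<dots> \<le> (\<integral>\<^sup>+\<omega>. ennreal (exp (a * (\<integral>p. jump_function t ?h p \<partial>N \<omega>))) \<partial>M)"
    proof (rule nn_integral_mono_AE)
      show "AE \<omega> in M. ennreal (exp (a * \<bar>Y \<omega>\<bar>)) \<le> ennreal (exp (a * (\<integral>p. jump_function t ?h p \<partial>N \<omega>)))"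
        using Y(2)
      proof eventually_elim
        case (elim \<omega>)
        have "\<bar>\<integral>p. jump_function t ?g p \<partial>N \<omega>\<bar> \<le> (\<integral>p. norm (jump_function t ?g p) \<partial>N \<omega>)"
          using integral_norm_bound[of "N \<omega>" "jump_function t ?g"] by simp
        also have "\<dots> = (\<integral>p. jump_function t ?h p \<partial>N \<omega>)"
          by (rule Bochner_Integration.integral_cong) (auto simp: jump_function_def split: split_indicator)
        finally show ?case using a elim by (intro ennreal_leI) (simp add: mult_left_mono)
      qed
    qed
    also have "\<dots> \<le> ennreal (exp ((exp (a * \<eta>) - 1) / \<eta> * (\<integral>p. jump_function t ?h p \<partial>levy_intensity \<nu>)))"
      by (rule exp_moment_le[OF J(1) J(2) bd \<eta>(1) a]) simp
    also have "(\<integral>p. jump_function t ?h p \<partial>levy_intensity \<nu>) = t * (\<integral>x. ?h x \<partial>\<nu>)"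
      by (subst integral_jump_function[OF sf \<nu> hm hint _ t]) auto
    finally show "(\<integral>\<^sup>+x. ennreal (exp (a * \<bar>x\<bar>)) \<partial>distr M borel Y)
        \<le> ennreal (exp ((exp (a * \<eta>) - 1) / \<eta> * (t * (\<integral>x. ?h x \<partial>\<nu>))))" .
  qed
qed

lemma jump_integral_levy_intensity:
  assumes "0 \<le> t" "0 < \<delta>"
  shows "(LINT p:{0..t} \<times> {x. \<delta> < \<bar>x\<bar> \<and> \<bar>x\<bar> \<le> 1}|levy_intensity \<nu>. snd p)
    = t * (\<integral>x. indicator {x. \<delta> < \<bar>x\<bar> \<and> \<bar>x\<bar> \<le> 1} x * x \<partial>\<nu>)"
proof -
  have [measurable_cong]: "sets \<nu> = sets borel" by (rule \<nu>)
  let ?g = "\<lambda>x. indicator {x. \<delta> < \<bar>x\<bar> \<and> \<bar>x\<bar> \<le> 1} x * x :: real"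
  have m: "?g \<in> borel_measurable borel" by measurable
  have i: "integrable \<nu> ?g"
    by (intro Bochner_Integration.integrable_bound[OF fv]) (auto split: split_indicator)
  have "(LINT p:{0..t} \<times> {x. \<delta> < \<bar>x\<bar> \<and> \<bar>x\<bar> \<le> 1}|levy_intensity \<nu>. snd p)
      = (\<integral>p. jump_function t ?g p \<partial>levy_intensity \<nu>)"
    unfolding set_lebesgue_integral_def
    by (rule Bochner_Integration.integral_cong) (auto simp: jump_function_def split: split_indicator)
  then show ?thesis using integral_jump_function[OF sf \<nu> m i _ assms(1)] by simp
qed

text \<open>With jumps of finite variation the compensated integral is a pathwise integral: the \<open>L\<^sup>2\<close>-limit
  and the almost sure limit of the truncated integrals agree.\<close>

lemma compensated_small_jumps_eq:
  assumes J: "compensated_small_jumps M \<nu> N t J" and t: "0 \<le> t"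
  shows "AE \<omega> in M. J \<omega> = (\<integral>p. jump_function t (\<lambda>x. indicator {-1..1} x * x) p \<partial>N \<omega>)
    - t * (\<integral>x. indicator {-1..1} x * x \<partial>\<nu>)"
proof -
  have [measurable_cong]: "sets \<nu> = sets borel" by (rule \<nu>)
  \<comment> \<open>Almost sure statements can be combined only countably often, so the continuous
    parameter of the mean-square limit is replaced by a sequence tending to 0 from the
    right.\<close>
  define \<delta> where "\<delta> n = 1 / real (Suc n)" for n
  have \<delta>: "0 < \<delta> n" for n by (simp add: \<delta>_def)
  have \<delta>0: "\<delta> \<longlonglongrightarrow> 0" unfolding \<delta>_def by (rule LIMSEQ_Suc[OF lim_1_over_n])
  then have \<delta>r: "filterlim \<delta> (at_right 0) sequentially"
    using \<delta> by (simp add: filterlim_at less_imp_neq[THEN not_sym])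
  let ?g = "\<lambda>x. indicator {-1..1} x * x :: real"
  let ?g' = "\<lambda>n x. indicator {x. \<delta> n < \<bar>x\<bar> \<and> \<bar>x\<bar> \<le> 1} x * x :: real"
  have glim: "(\<lambda>n. ?g' n x) \<longlonglongrightarrow> ?g x" for x
  proof (cases "x = 0")
    case False
    then have "\<forall>\<^sub>F n in sequentially. \<delta> n < \<bar>x\<bar>" using \<delta>0 by (intro order_tendstoD) auto
    then have "\<forall>\<^sub>F n in sequentially. ?g' n x = ?g x"
      by eventually_elim (auto simp: indicator_def abs_le_iff)
    then show ?thesis by (rule tendsto_eventually)
  qed auto
  have gm: "?g \<in> borel_measurable borel" and g'm: "?g' n \<in> borel_measurable borel" for n by measurable
  have gle: "\<bar>?g x\<bar> \<le> \<bar>x\<bar>" and g'le: "\<bar>?g' n x\<bar> \<le> \<bar>x\<bar>" and g'g: "\<bar>?g' n x\<bar> \<le> \<bar>?g x\<bar>" for n x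
    by (auto split: split_indicator)
  have [measurable]: "J \<in> borel_measurable M" using J by (simp add: compensated_small_jumps_def)
  obtain Y where Y[measurable]: "Y \<in> borel_measurable M"
    and YAE: "AE \<omega> in M. Y \<omega> = (\<integral>p. jump_function t ?g p \<partial>N \<omega>)"
    using jump_char_functional[OF gm gle t] by blast
  have "\<exists>Y. \<forall>n. Y n \<in> borel_measurable M \<and> (AE \<omega> in M. Y n \<omega> = (\<integral>p. jump_function t (?g' n) p \<partial>N \<omega>))"
  proof (rule choice, rule allI)
    show "\<exists>Y. Y \<in> borel_measurable M \<and> (AE \<omega> in M. Y \<omega> = (\<integral>p. jump_function t (?g' n) p \<partial>N \<omega>))" for n
      by (rule jump_char_functional[OF g'm g'le t]) blast
  qed
  then obtain Z where Z0: "\<forall>n. Z n \<in> borel_measurable M \<and> (AE \<omega> in M. Z n \<omega> = (\<integral>p. jump_function t (?g' n) p \<partial>N \<omega>))" ..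
  have [measurable]: "Z n \<in> borel_measurable M" for n using Z0 by blast
  have ZAE: "AE \<omega> in M. \<forall>n. Z n \<omega> = (\<integral>p. jump_function t (?g' n) p \<partial>N \<omega>)"
    using Z0 by (subst AE_all_countable) blast
  let ?c = "\<lambda>n. t * (\<integral>x. ?g' n x \<partial>\<nu>)" and ?C = "t * (\<integral>x. ?g x \<partial>\<nu>)"
  have clim: "?c \<longlonglongrightarrow> ?C"
  proof (intro tendsto_intros integral_dominated_convergence[where w="\<lambda>x. min 1 \<bar>x\<bar>"])
    show "AE x in \<nu>. norm (?g' n x) \<le> min 1 \<bar>x\<bar>" for n by (auto split: split_indicator)
  qed (use glim fv in auto)
  have Zlim: "AE \<omega> in M. (\<lambda>n. Z n \<omega>) \<longlonglongrightarrow> Y \<omega>"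
    using ZAE YAE AE_integrable_jump_function[OF gm gle t] AE_space
  proof eventually_elim
    case (elim \<omega>)
    have [measurable_cong]: "sets (N \<omega>) = sets (levy_intensity \<nu>)" using elim by (simp add: sets_N)
    note [measurable] = measurable_jump_function[OF \<nu> gm] measurable_jump_function[OF \<nu> g'm]
    have "(\<lambda>n. \<integral>p. jump_function t (?g' n) p \<partial>N \<omega>) \<longlonglongrightarrow> (\<integral>p. jump_function t ?g p \<partial>N \<omega>)"
    proof (rule integral_dominated_convergence[where w="\<lambda>p. norm (jump_function t ?g p)"])
      show "integrable (N \<omega>) (\<lambda>p. norm (jump_function t ?g p))" using elim by (intro integrable_norm)
      show "AE p in N \<omega>. norm (jump_function t (?g' n) p) \<le> norm (jump_function t ?g p)" for n
        by (rule AE_I2) (auto simp: jump_function_def split: split_indicator)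
      show "AE p in N \<omega>. (\<lambda>n. jump_function t (?g' n) p) \<longlonglongrightarrow> jump_function t ?g p"
        unfolding jump_function_def by (intro AE_I2 tendsto_intros glim)
    qed measurable
    then show ?case using elim by simp
  qed
  have int0: "(\<lambda>n. \<integral>\<^sup>+\<omega>. ennreal ((J \<omega> - (Z n \<omega> - ?c n))\<^sup>2) \<partial>M) \<longlonglongrightarrow> 0"
  proof -
    let ?D = "\<lambda>d. \<integral>\<^sup>+ \<omega>. ennreal
         ((J \<omega> - ((LINT p:{0..t} \<times> {x. d < \<bar>x\<bar> \<and> \<bar>x\<bar> \<le> 1}|N \<omega>. snd p)
                - (LINT p:{0..t} \<times> {x. d < \<bar>x\<bar> \<and> \<bar>x\<bar> \<le> 1}|levy_intensity \<nu>. snd p)))\<^sup>2) \<partial>M"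
    have "(?D \<longlongrightarrow> 0) (at_right 0)" using J by (simp add: compensated_small_jumps_def)
    from filterlim_compose[OF this \<delta>r] have "(\<lambda>n. ?D (\<delta> n)) \<longlonglongrightarrow> 0" .
    moreover have "?D (\<delta> n) = (\<integral>\<^sup>+\<omega>. ennreal ((J \<omega> - (Z n \<omega> - ?c n))\<^sup>2) \<partial>M)" for n
    proof (rule nn_integral_cong_AE)
      show "AE \<omega> in M. ennreal
         ((J \<omega> - ((LINT p:{0..t} \<times> {x. \<delta> n < \<bar>x\<bar> \<and> \<bar>x\<bar> \<le> 1}|N \<omega>. snd p)
                - (LINT p:{0..t} \<times> {x. \<delta> n < \<bar>x\<bar> \<and> \<bar>x\<bar> \<le> 1}|levy_intensity \<nu>. snd p)))\<^sup>2)
         = ennreal ((J \<omega> - (Z n \<omega> - ?c n))\<^sup>2)"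
        using ZAE
      proof eventually_elim
        case (elim \<omega>)
        have "(LINT p:{0..t} \<times> {x. \<delta> n < \<bar>x\<bar> \<and> \<bar>x\<bar> \<le> 1}|N \<omega>. snd p) = (\<integral>p. jump_function t (?g' n) p \<partial>N \<omega>)"
          unfolding set_lebesgue_integral_def
          by (rule Bochner_Integration.integral_cong) (auto simp: jump_function_def split: split_indicator)
        then show ?case using elim jump_integral_levy_intensity[OF t \<delta>] by simp
      qed
    qed
    ultimately show ?thesis by simp
  qed
  \<comment> \<open>Fatou: the mean squared distance from \<open>J\<close> to the almost sure limit
    is at most the liminf of the distances to the truncated integrals, which is 0.\<close>
  have "(\<integral>\<^sup>+\<omega>. ennreal ((J \<omega> - (Y \<omega> - ?C))\<^sup>2) \<partial>M) = (\<integral>\<^sup>+\<omega>. liminf (\<lambda>n. ennreal ((J \<omega> - (Z n \<omega> - ?c n))\<^sup>2)) \<partial>M)"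
  proof (rule nn_integral_cong_AE)
    show "AE \<omega> in M. ennreal ((J \<omega> - (Y \<omega> - ?C))\<^sup>2) = liminf (\<lambda>n. ennreal ((J \<omega> - (Z n \<omega> - ?c n))\<^sup>2))"
      using Zlim
    proof eventually_elim
      case (elim \<omega>)
      have "(\<lambda>n. ennreal ((J \<omega> - (Z n \<omega> - ?c n))\<^sup>2)) \<longlonglongrightarrow> ennreal ((J \<omega> - (Y \<omega> - ?C))\<^sup>2)"
        by (intro tendsto_intros tendsto_ennrealI elim clim)
      then show ?case by (rule lim_imp_Liminf[symmetric, rotated]) simp
    qed
  qed
  also have "\<dots> \<le> liminf (\<lambda>n. \<integral>\<^sup>+\<omega>. ennreal ((J \<omega> - (Z n \<omega> - ?c n))\<^sup>2) \<partial>M)"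
    by (rule nn_integral_liminf) measurable
  also have "\<dots> = 0" by (rule lim_imp_Liminf[OF _ int0]) simp
  finally have "(\<integral>\<^sup>+\<omega>. ennreal ((J \<omega> - (Y \<omega> - ?C))\<^sup>2) \<partial>M) = 0" by simp
  then have "AE \<omega> in M. ennreal ((J \<omega> - (Y \<omega> - ?C))\<^sup>2) = 0"
    by (subst (asm) nn_integral_0_iff_AE) auto
  then show ?thesis using YAE by eventually_elim (simp add: ennreal_eq_0_iff)
qed

end

text \<open>The Gaussian part has coefficient 0. The compensator is a finite number times
  \<open>t\<close> and joins the drift, after which the jumps up to 1 and beyond 1 recombine into
  one uncompensated sum.\<close>

lemma char_levy_finite_variation:
  assumes X: "levy_process_with_triplet M X 0 b \<nu>" and sf: "sigma_finite_measure \<nu>"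
    and fv: "integrable \<nu> (\<lambda>x. min 1 \<bar>x\<bar>)" and t: "0 \<le> t"
  shows "char (distr M borel (X t)) \<theta>
    = exp (t * (\<i> * \<theta> * (b - (\<integral>x. indicator {-1..1} x * x \<partial>\<nu>)) + (\<integral>x. iexp (\<theta> * x) - 1 \<partial>\<nu>)))"
proof -
  obtain W N J where PRM: "poisson_random_measure M (levy_intensity \<nu>) N"
    and J: "compensated_small_jumps M \<nu> N t (J t)"
    and rep: "AE \<omega> in M. X t \<omega> = b * t + sqrt 0 * W t \<omega> + J t \<omega>
                          + (LINT p:{0..t} \<times> {x. 1 < \<bar>x\<bar>}|N \<omega>. snd p)"
    using X t unfolding levy_process_with_triplet_def by blast
  have \<nu>: "sets \<nu> = sets borel" and Xm[measurable]: "X t \<in> borel_measurable M"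
    using X t by (auto simp: levy_process_with_triplet_def levy_measure_def levy_process_def)
  have [measurable_cong]: "sets \<nu> = sets borel" by (rule \<nu>)
  interpret prob_space M using PRM by (simp add: poisson_random_measure_def)
  interpret poisson_rm M "levy_intensity \<nu>" N by unfold_locales (rule PRM)
  interpret poisson_jumps M \<nu> N
    by (intro poisson_jumps.intro poisson_rm_axioms poisson_jumps_axioms.intro sf \<nu> fv)
  let ?g = "\<lambda>x. indicator {-1..1} x * x :: real" and ?h = "\<lambda>x. indicator {x. 1 < \<bar>x\<bar>} x * x :: real"
  have gm: "?g \<in> borel_measurable borel" and hm: "?h \<in> borel_measurable borel" by measurable
  have gle: "\<bar>?g x\<bar> \<le> \<bar>x\<bar>" and hle: "\<bar>?h x\<bar> \<le> \<bar>x\<bar>" for x by (auto split: split_indicator)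
  obtain Y where Y[measurable]: "Y \<in> borel_measurable M"
    and YAE: "AE \<omega> in M. Y \<omega> = (\<integral>p. jump_function t (\<lambda>x. x) p \<partial>N \<omega>)"
    and YE: "\<And>\<theta>. (\<integral>\<omega>. iexp (\<theta> * Y \<omega>) \<partial>M) = exp (t * (\<integral>x. iexp (\<theta> * x) - 1 \<partial>\<nu>))"
    by (rule jump_char_functional[OF _ _ t, of "\<lambda>x. x"]) auto
  let ?b = "b - (\<integral>x. ?g x \<partial>\<nu>)"
  have "AE \<omega> in M. X t \<omega> = ?b * t + Y \<omega>"
    using rep YAE compensated_small_jumps_eq[OF J t] AE_integrable_jump_function[OF gm gle t]
      AE_integrable_jump_function[OF hm hle t]
  proof eventually_elim
    case (elim \<omega>)
    have "(LINT p:{0..t} \<times> {x. 1 < \<bar>x\<bar>}|N \<omega>. snd p) = (\<integral>p. jump_function t ?h p \<partial>N \<omega>)"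
      unfolding set_lebesgue_integral_def
      by (rule Bochner_Integration.integral_cong) (auto simp: jump_function_def split: split_indicator)
    moreover have "(\<integral>p. jump_function t ?g p \<partial>N \<omega>) + (\<integral>p. jump_function t ?h p \<partial>N \<omega>)
        = (\<integral>p. jump_function t ?g p + jump_function t ?h p \<partial>N \<omega>)"
      using elim by (intro Bochner_Integration.integral_add[symmetric])
    moreover have "\<dots> = (\<integral>p. jump_function t (\<lambda>x. x) p \<partial>N \<omega>)"
      by (rule Bochner_Integration.integral_cong) (auto simp: jump_function_def split: split_indicator)
    ultimately show ?case using elim by (simp add: algebra_simps)
  qed
  then have eq: "AE \<omega> in M. iexp (\<theta> * X t \<omega>) = iexp (\<theta> * (?b * t)) * iexp (\<theta> * Y \<omega>)"
  proof eventually_elim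
    case (elim \<omega>)
    show ?case unfolding elim exp_add[symmetric] distrib_left of_real_add ..
  qed
  then have "(\<integral>\<omega>. iexp (\<theta> * X t \<omega>) \<partial>M) = (\<integral>\<omega>. iexp (\<theta> * (?b * t)) * iexp (\<theta> * Y \<omega>) \<partial>M)"
    by (rule integral_cong_AE[rotated 2]) measurable
  also have "\<dots> = iexp (\<theta> * (?b * t)) * exp (t * (\<integral>x. iexp (\<theta> * x) - 1 \<partial>\<nu>))"
    by (simp only: integral_mult_right_zero YE)
  also have "\<dots> = exp (t * (\<i> * \<theta> * ?b + (\<integral>x. iexp (\<theta> * x) - 1 \<partial>\<nu>)))"
    unfolding exp_add[symmetric] by (simp add: algebra_simps)
  finally show ?thesis by (simp add: char_def integral_distr)
qed

section \<open>Adding a compound Poisson variable\<close>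

lemma real_distribution_convolution:
  assumes "real_distribution \<mu>" "real_distribution F"
  shows "real_distribution (\<mu> \<star> F)"
proof -
  interpret \<mu>: real_distribution \<mu> by fact
  interpret F: real_distribution F by fact
  interpret P: pair_prob_space \<mu> F ..
  show ?thesis unfolding convolution_def by (rule P.real_distribution_distr) measurable
qed

lemma integral_convolution:
  fixes h :: "real \<Rightarrow> 'c :: {banach, second_countable_topology}"
  assumes \<mu>: "real_distribution \<mu>" and F: "real_distribution F"
    and h[measurable]: "h \<in> borel_measurable borel" and bd: "\<And>x. norm (h x) \<le> B"
  shows "(\<integral>x. h x \<partial>(\<mu> \<star> F)) = (\<integral>x. (\<integral>u. h (x + u) \<partial>F) \<partial>\<mu>)"
proof -
  interpret \<mu>: real_distribution \<mu> by fact
  interpret F: real_distribution F by fact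
  interpret P: pair_prob_space \<mu> F ..
  have I: "integrable (\<mu> \<Otimes>\<^sub>M F) (\<lambda>p. h (fst p + snd p))"
    by (rule P.integrable_const_bound[where B=B]) (auto simp: bd)
  have "(\<integral>x. h x \<partial>(\<mu> \<star> F)) = (\<integral>p. h (fst p + snd p) \<partial>(\<mu> \<Otimes>\<^sub>M F))"
    unfolding convolution_def by (subst integral_distr) (auto simp: case_prod_beta)
  also have "\<dots> = (\<integral>x. (\<integral>u. h (x + u) \<partial>F) \<partial>\<mu>)"
    by (subst P.integral_fst'[OF I, symmetric]) simp
  finally show ?thesis .
qed

lemma char_convolution:
  assumes \<mu>: "real_distribution \<mu>" and F: "real_distribution F"
  shows "char (\<mu> \<star> F) \<theta> = char \<mu> \<theta> * char F \<theta>"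
proof -
  have "char (\<mu> \<star> F) \<theta> = (\<integral>x. (\<integral>u. iexp (\<theta> * (x + u)) \<partial>F) \<partial>\<mu>)"
    unfolding char_def by (rule integral_convolution[OF \<mu> F, where B=1]) auto
  also have "\<dots> = (\<integral>x. iexp (\<theta> * x) * (\<integral>u. iexp (\<theta> * u) \<partial>F) \<partial>\<mu>)"
    by (simp add: distrib_left exp_add)
  also have "\<dots> = char \<mu> \<theta> * char F \<theta>" by (simp only: char_def integral_mult_left_zero)
  finally show ?thesis .
qed

text \<open>\<^const>\<open>poisson_pmf\<close> is specified for a positive rate only.\<close>

definition poisson0_pmf :: "real \<Rightarrow> nat pmf" where
  "poisson0_pmf a = (if a = 0 then return_pmf 0 else poisson_pmf a)"

lemma pmf_poisson0: "0 \<le> a \<Longrightarrow> pmf (poisson0_pmf a) k = a ^ k / fact k * exp (- a)"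
  by (cases k) (auto simp: poisson0_pmf_def)

primrec add_jumps :: "real measure \<Rightarrow> real measure \<Rightarrow> nat \<Rightarrow> real measure" where
  "add_jumps \<rho> F 0 = \<rho>"
| "add_jumps \<rho> F (Suc k) = (add_jumps \<rho> F k \<star> F)"

text \<open>The law of a \<open>\<rho>\<close>-distributed variable plus an independent compound
  Poisson variable. Keeping the number of jumps as mixing variable makes conditioning on it an
  integral over a pmf.\<close>

definition add_poisson_jumps :: "real measure \<Rightarrow> real measure \<Rightarrow> real \<Rightarrow> real measure" where
  "add_poisson_jumps \<rho> F a = measure_pmf (poisson0_pmf a) \<bind> add_jumps \<rho> F"

lemma integral_poisson0:
  fixes f :: "nat \<Rightarrow> complex"
  assumes a: "0 \<le> a" and bd: "\<And>k. norm (f k) \<le> B"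
  shows "(\<lambda>k. (a ^ k / fact k * exp (- a)) *\<^sub>R f k) sums (\<integral>k. f k \<partial>measure_pmf (poisson0_pmf a))"
proof -
  have "integrable (measure_pmf (poisson0_pmf a)) f"
    by (rule measure_pmf.integrable_const_bound[where B=B]) (auto simp: bd)
  then have "integrable (count_space UNIV) (\<lambda>k. pmf (poisson0_pmf a) k *\<^sub>R f k)"
    by (subst (asm) measure_pmf_eq_density, subst (asm) integrable_density) auto
  then have "(\<lambda>k. pmf (poisson0_pmf a) k *\<^sub>R f k) sums (\<integral>k. pmf (poisson0_pmf a) k *\<^sub>R f k \<partial>count_space UNIV)"
    by (rule sums_integral_count_space_nat)
  also have "(\<integral>k. pmf (poisson0_pmf a) k *\<^sub>R f k \<partial>count_space UNIV) = (\<integral>k. f k \<partial>measure_pmf (poisson0_pmf a))"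
    by (subst measure_pmf_eq_density, subst integral_density) auto
  finally show ?thesis using a by (simp add: pmf_poisson0)
qed

text \<open>The two sides differ only through counts of at least 3, and \<open>h\<close> is at most
  1 there; what remains is to bound the probability of such counts.\<close>

lemma poisson0_tail:
  fixes h :: "nat \<Rightarrow> real"
  assumes a: "0 \<le> a" and h: "\<And>k. 0 \<le> h k" "\<And>k. h k \<le> 1"
  shows "\<bar>(\<integral>k. h k \<partial>measure_pmf (poisson0_pmf a)) - exp (- a) * (h 0 + a * h 1 + a\<^sup>2 / 2 * h 2)\<bar> \<le> a ^ 3"
proof -
  let ?p = "poisson0_pmf a"
  have I: "integrable (measure_pmf ?p) g" if "\<And>k. \<bar>g k\<bar> \<le> 1" for g :: "nat \<Rightarrow> real"
    using that by (intro measure_pmf.integrable_const_bound[where B=1]) auto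
  have split: "(\<integral>k. g k \<partial>measure_pmf ?p) = exp (- a) * (g 0 + a * g 1 + a\<^sup>2 / 2 * g 2)
      + (\<integral>k. g k * indicator {3..} k \<partial>measure_pmf ?p)" if g: "\<And>k. \<bar>g k\<bar> \<le> 1" for g
  proof -
    have "g k = (\<Sum>j<3. indicator {j} k *\<^sub>R g j) + g k * indicator {3..} k" for k
    proof -
      consider "k = 0" | "k = 1" | "k = 2" | "3 \<le> k" by linarith
      then show ?thesis by cases (auto simp: numeral_3_eq_3 numeral_2_eq_2)
    qed
    note gk = this
    have hb: "has_bochner_integral (measure_pmf ?p) (\<lambda>k. \<Sum>j<3. indicator {j} k *\<^sub>R g j)
        (\<Sum>j<3. measure (measure_pmf ?p) {j} *\<^sub>R g j)"
      by (intro has_bochner_integral_sum has_bochner_integral_scaleR_left has_bochner_integral_real_indicator)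
        (auto simp: measure_pmf.emeasure_eq_measure)
    from gk have "(\<integral>k. g k \<partial>measure_pmf ?p)
      = (\<integral>k. (\<Sum>j<3. indicator {j} k *\<^sub>R g j) + g k * indicator {3..} k \<partial>measure_pmf ?p)" by presburger
    also have "\<dots> = (\<Sum>j<3. measure (measure_pmf ?p) {j} *\<^sub>R g j) + (\<integral>k. g k * indicator {3..} k \<partial>measure_pmf ?p)"
    proof (subst Bochner_Integration.integral_add)
      show "integrable (measure_pmf ?p) (\<lambda>k. g k * indicator {3..} k)"
        using g by (intro I) (auto simp: indicator_def)
    qed (use hb in \<open>simp_all only: has_bochner_integral_iff\<close>)
    also have "(\<Sum>j<3. measure (measure_pmf ?p) {j} *\<^sub>R g j) = exp (- a) * (g 0 + a * g 1 + a\<^sup>2 / 2 * g 2)"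
      using a by (simp add: measure_pmf_single pmf_poisson0 numeral_3_eq_3 numeral_2_eq_2 algebra_simps)
    finally show ?thesis .
  qed
  have "0 \<le> (\<integral>k. h k * indicator {3..} k \<partial>measure_pmf ?p)" using h by auto
  moreover have "(\<integral>k. h k * indicator {3..} k \<partial>measure_pmf ?p) \<le> (\<integral>k. 1 * indicator {3..} k \<partial>measure_pmf ?p)"
    using h by (intro integral_mono I) (auto simp: indicator_def)
  moreover have "(\<integral>k. 1 * indicator {3..} k \<partial>measure_pmf ?p) = 1 - exp (- a) * (1 + a + a\<^sup>2 / 2)"
    using split[of "\<lambda>_. 1"] by simp
  moreover have "1 - exp (- a) * (1 + a + a\<^sup>2 / 2) \<le> a ^ 3"
  proof -
    \<comment> \<open>The difference vanishes at 0 and is nondecreasing: all but the quadratic terms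
      of the derivative cancel, and \<open>exp (- x) \<le> 1\<close> handles those.\<close>
    have "(\<lambda>x. x ^ 3 - 1 + exp (- x) * (1 + x + x\<^sup>2 / 2)) 0 \<le> (\<lambda>x. x ^ 3 - 1 + exp (- x) * (1 + x + x\<^sup>2 / 2)) a"
    proof (rule DERIV_nonneg_imp_nondecreasing[OF a])
      fix x :: real assume x: "0 \<le> x"
      have "exp (- x) * x\<^sup>2 \<le> 1 * x\<^sup>2" using x by (intro mult_right_mono) auto
      then have "0 \<le> 3 * x\<^sup>2 - exp (- x) * (x\<^sup>2 / 2)" using zero_le_power2[of x] by linarith
      moreover have "((\<lambda>x. x ^ 3 - 1 + exp (- x) * (1 + x + x\<^sup>2 / 2)) has_real_derivative
          3 * x\<^sup>2 - exp (- x) * (x\<^sup>2 / 2)) (at x)"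
        by (auto intro!: derivative_eq_intros simp: field_simps power2_eq_square)
      ultimately show "\<exists>y. ((\<lambda>x. x ^ 3 - 1 + exp (- x) * (1 + x + x\<^sup>2 / 2)) has_real_derivative y) (at x) \<and> 0 \<le> y"
        by blast
    qed
    then show ?thesis by simp
  qed
  ultimately show ?thesis using split[of h] h by (auto simp: abs_le_iff)
qed

context
  fixes \<rho> F :: "real measure"
  assumes \<rho>: "real_distribution \<rho>" and F: "real_distribution F"
begin

lemma real_distribution_add_jumps: "real_distribution (add_jumps \<rho> F k)"
  by (induction k) (auto simp: \<rho> F real_distribution_convolution)

lemma char_add_jumps: "char (add_jumps \<rho> F k) \<theta> = char \<rho> \<theta> * char F \<theta> ^ k"
  by (induction k) (auto simp: char_convolution real_distribution_add_jumps F)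

lemma measurable_add_jumps:
  "add_jumps \<rho> F \<in> measure_pmf (poisson0_pmf a) \<rightarrow>\<^sub>M subprob_algebra borel"
proof -
  have "add_jumps \<rho> F k \<in> space (subprob_algebra borel)" for k
    using real_distribution_add_jumps[of k]
    by (auto simp: space_subprob_algebra real_distribution_def real_distribution_axioms_def
        intro: prob_space_imp_subprob_space)
  then show ?thesis by (simp add: measurable_cong_sets[OF sets_measure_pmf_count_space refl])
qed

lemma real_distribution_add_poisson_jumps: "real_distribution (add_poisson_jumps \<rho> F a)"
proof -
  have "prob_space (add_poisson_jumps \<rho> F a)"
    unfolding add_poisson_jumps_def
    by (rule measure_pmf.prob_space_bind[OF _ measurable_add_jumps])
      (use real_distribution_add_jumps in \<open>auto simp: real_distribution_def\<close>)
  moreover have "sets (add_poisson_jumps \<rho> F a) = sets borel"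
    unfolding add_poisson_jumps_def
    by (rule sets_bind[where N=borel])
      (use real_distribution_add_jumps in \<open>auto simp: real_distribution_def real_distribution_axioms_def\<close>)
  ultimately show ?thesis
    by (simp add: real_distribution_def real_distribution_axioms_def)
qed

lemma char_add_poisson_jumps:
  assumes a: "0 \<le> a"
  shows "char (add_poisson_jumps \<rho> F a) \<theta> = char \<rho> \<theta> * exp (a * (char F \<theta> - 1))"
proof -
  let ?p = "measure_pmf (poisson0_pmf a)"
  have int: "integrable \<mu> (\<lambda>x. iexp (\<theta> * x))" if "real_distribution \<mu>" for \<mu>
  proof -
    interpret real_distribution \<mu> by fact
    show ?thesis by (rule integrable_const_bound[where B=1]) auto
  qed
  have Re: "Re (char \<mu> \<theta>) = (\<integral>x. cos (\<theta> * x) \<partial>\<mu>)" and Im: "Im (char \<mu> \<theta>) = (\<integral>x. sin (\<theta> * x) \<partial>\<mu>)"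
    if "real_distribution \<mu>" for \<mu>
    unfolding char_def using int[OF that] by (simp_all add: Re_exp Im_exp flip: integral_Re integral_Im)
  note rd = real_distribution_add_jumps real_distribution_add_poisson_jumps
  have ip: "integrable ?p (\<lambda>k. char (add_jumps \<rho> F k) \<theta>)"
    by (rule measure_pmf.integrable_const_bound[where B=1])
      (auto simp: real_distribution.cmod_char_le_1[OF rd(1)])
  \<comment> \<open>The mixture identity is used for real integrands, so the cosine and sine parts
    of the characteristic function are treated separately.\<close>
  have bind: "(\<integral>x. f x \<partial>add_poisson_jumps \<rho> F a) = (\<integral>k. (\<integral>x. f x \<partial>add_jumps \<rho> F k) \<partial>?p)"
    if [measurable]: "f \<in> borel_measurable borel" and "\<And>x. \<bar>f x\<bar> \<le> 1" for f :: "real \<Rightarrow> real"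
    unfolding add_poisson_jumps_def
  proof (rule integral_bind[OF _ _ measurable_add_jumps, where B=1 and B'=1])
    show "AE k in ?p. emeasure (add_jumps \<rho> F k) (space (add_jumps \<rho> F k)) \<le> ennreal 1"
      using rd(1) by (auto simp: real_distribution_def prob_space.emeasure_space_1)
    show "finite_measure ?p" by unfold_locales
  qed (use that in auto)
  have "char (add_poisson_jumps \<rho> F a) \<theta> = (\<integral>k. char (add_jumps \<rho> F k) \<theta> \<partial>?p)"
  proof (rule complex_eqI)
    show "Re (char (add_poisson_jumps \<rho> F a) \<theta>) = Re (\<integral>k. char (add_jumps \<rho> F k) \<theta> \<partial>?p)"
      unfolding integral_Re[OF ip, symmetric] Re[OF rd(1)] Re[OF rd(2)] by (rule bind) auto
    show "Im (char (add_poisson_jumps \<rho> F a) \<theta>) = Im (\<integral>k. char (add_jumps \<rho> F k) \<theta> \<partial>?p)"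
      unfolding integral_Im[OF ip, symmetric] Im[OF rd(1)] Im[OF rd(2)] by (rule bind) auto
  qed
  moreover have "(\<lambda>k. (a ^ k / fact k * exp (- a)) *\<^sub>R char (add_jumps \<rho> F k) \<theta>) sums
      (\<integral>k. char (add_jumps \<rho> F k) \<theta> \<partial>?p)"
    by (rule integral_poisson0[OF a]) (rule real_distribution.cmod_char_le_1[OF rd(1)])
  moreover have "(\<lambda>k. (a ^ k / fact k * exp (- a)) *\<^sub>R char (add_jumps \<rho> F k) \<theta>) sums
      (char \<rho> \<theta> * exp (a * (char F \<theta> - 1)))"
    using sums_mult[OF exp_converges[of "a * char F \<theta>"], of "exp (- a) * char \<rho> \<theta>"]
    by (simp add: char_add_jumps scaleR_conv_of_real power_mult_distrib right_diff_distrib exp_diff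
        exp_minus exp_of_real divide_inverse mult_ac)
  ultimately show ?thesis by (metis sums_unique2)
qed

lemma measure_add_poisson_jumps:
  assumes a: "0 \<le> a" and [measurable]: "A \<in> sets borel"
  shows "\<bar>measure (add_poisson_jumps \<rho> F a) A - exp (- a) * (measure \<rho> A + a * measure (\<rho> \<star> F) A
    + a\<^sup>2 / 2 * measure ((\<rho> \<star> F) \<star> F) A)\<bar> \<le> a ^ 3"
proof -
  have "measure (add_jumps \<rho> F k) A \<le> 1" for k
    using real_distribution_add_jumps[of k] by (simp add: real_distribution_def prob_space.prob_le_1)
  then have "\<bar>(\<integral>k. measure (add_jumps \<rho> F k) A \<partial>measure_pmf (poisson0_pmf a)) - exp (- a) *
    (measure (add_jumps \<rho> F 0) A + a * measure (add_jumps \<rho> F 1) A + a\<^sup>2 / 2 * measure (add_jumps \<rho> F 2) A)\<bar> \<le> a ^ 3"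
    by (intro poisson0_tail[OF a]) auto
  moreover have "measure (add_poisson_jumps \<rho> F a) A = (\<integral>k. measure (add_jumps \<rho> F k) A \<partial>measure_pmf (poisson0_pmf a))"
    unfolding add_poisson_jumps_def by (rule measure_pmf.measure_bind[OF measurable_add_jumps]) simp
  ultimately show ?thesis by (simp add: numeral_2_eq_2)
qed

end

section \<open>Tail functionals of a jump density and its normalization\<close>

text \<open>Off [-\<eta>, \<eta>] the weight \<open>min 1 \<bar>x\<bar>\<close> is at least \<eta>,
  so dividing by it costs only a constant. This supplies integrability for every cut-off density
  below.\<close>

lemma integrable_away_zero:
  fixes s h :: "real \<Rightarrow> real"
  assumes int: "integrable lborel (\<lambda>x. s x * min 1 \<bar>x\<bar>)" and [measurable]: "h \<in> borel_measurable borel"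
    and h: "\<And>x. 0 \<le> h x" "\<And>x. h x \<le> s x" and zero: "\<And>x. \<bar>x\<bar> \<le> \<eta> \<Longrightarrow> h x = 0"
    and \<eta>: "0 < \<eta>" "\<eta> \<le> 1"
  shows "integrable lborel h"
proof (rule Bochner_Integration.integrable_bound)
  show "integrable lborel (\<lambda>x. (1 / \<eta>) * (s x * min 1 \<bar>x\<bar>))" using int by simp
  show "AE x in lborel. norm (h x) \<le> norm ((1 / \<eta>) * (s x * min 1 \<bar>x\<bar>))"
  proof (rule AE_I2)
    fix x
    have s: "0 \<le> s x" using h[of x] by linarith
    show "norm (h x) \<le> norm ((1 / \<eta>) * (s x * min 1 \<bar>x\<bar>))"
    proof (cases "\<bar>x\<bar> \<le> \<eta>")
      case False
      then have "1 \<le> min 1 \<bar>x\<bar> / \<eta>" using \<eta> by (auto simp: min_def)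
      then have "s x * 1 \<le> s x * (min 1 \<bar>x\<bar> / \<eta>)" using s by (intro mult_left_mono)
      then show ?thesis using h[of x] s \<eta> by (simp add: mult.commute)
    qed (simp add: zero)
  qed
qed measurable

text \<open>For \<open>f\<close> of total mass \<open>L\<close> this is \<open>L\<close> times the
  probability that \<open>z\<close> plus one jump reaches \<open>y\<close>. It is left unnormalized
  because \<open>L\<close> may be 0.\<close>

definition tail_conv :: "(real \<Rightarrow> real) \<Rightarrow> real \<Rightarrow> real \<Rightarrow> real" where
  "tail_conv f y z = (\<integral>u. indicator {y..} (z + u) * f u \<partial>lborel)"

text \<open>Likewise \<open>L\<^sup>2\<close> times the probability for two independent jumps; at
  \<open>z = 0\<close> it is the double integral over pairs of large jumps in the claim.\<close>

definition tail_conv2 :: "(real \<Rightarrow> real) \<Rightarrow> real \<Rightarrow> real \<Rightarrow> real" where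
  "tail_conv2 f y z = (\<integral>u. tail_conv f y (z + u) * f u \<partial>lborel)"

lemma measurable_tail_conv[measurable (raw)]:
  assumes [measurable]: "f \<in> borel_measurable borel" "h \<in> borel_measurable N"
  shows "(\<lambda>x. tail_conv f y (h x)) \<in> borel_measurable N"
  unfolding tail_conv_def by measurable

lemma measurable_tail_conv2[measurable (raw)]:
  assumes [measurable]: "f \<in> borel_measurable borel" "h \<in> borel_measurable N"
  shows "(\<lambda>x. tail_conv2 f y (h x)) \<in> borel_measurable N"
  unfolding tail_conv2_def by measurable

lemma
  assumes f: "integrable lborel f" and nn: "\<And>x. 0 \<le> f x"
  shows tail_conv_nonneg: "0 \<le> tail_conv f y z"
    and tail_conv_le: "tail_conv f y z \<le> (\<integral>x. f x \<partial>lborel)"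
    and tail_conv2_nonneg: "0 \<le> tail_conv2 f y z"
    and tail_conv2_le: "tail_conv2 f y z \<le> (\<integral>x. f x \<partial>lborel)\<^sup>2"
proof -
  have [measurable]: "f \<in> borel_measurable borel" using f by auto
  show 1: "0 \<le> tail_conv f y z" for z unfolding tail_conv_def using nn by simp
  show 2: "tail_conv f y z \<le> (\<integral>x. f x \<partial>lborel)" for z unfolding tail_conv_def
    using f nn by (intro integral_mono') (auto simp: indicator_def)
  show "0 \<le> tail_conv2 f y z" unfolding tail_conv2_def using nn 1 by simp
  have "tail_conv2 f y z \<le> (\<integral>u. (\<integral>x. f x \<partial>lborel) * f u \<partial>lborel)" unfolding tail_conv2_def
    using f nn 2 by (intro integral_mono') (auto intro!: mult_right_mono)
  then show "tail_conv2 f y z \<le> (\<integral>x. f x \<partial>lborel)\<^sup>2" by (simp add: power2_eq_square)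
qed

text \<open>In the absence of mass the point mass at 0 is an arbitrary default: jumps then arrive at
  rate 0, and the formulas carry the mass as a factor.\<close>

definition normalized_density :: "(real \<Rightarrow> real) \<Rightarrow> real measure" where
  "normalized_density f = (if (\<integral>x. f x \<partial>lborel) = 0 then return borel 0
     else density lborel (\<lambda>x. ennreal (f x / (\<integral>x. f x \<partial>lborel))))"

context
  fixes f :: "real \<Rightarrow> real"
  assumes f: "integrable lborel f" and nn: "\<And>x. 0 \<le> f x"
begin

lemma real_distribution_normalized_density: "real_distribution (normalized_density f)"
proof (cases "(\<integral>x. f x \<partial>lborel) = 0")
  case True
  then show ?thesis
    by (auto simp: normalized_density_def real_distribution_def real_distribution_axioms_def prob_space_return)
next
  case False
  then have pos: "0 < (\<integral>x. f x \<partial>lborel)" using nn by (simp add: less_le)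
  have [measurable]: "f \<in> borel_measurable borel" using f by auto
  have "prob_space (density lborel (\<lambda>x. ennreal (f x / (\<integral>x. f x \<partial>lborel))))"
  proof
    have "(\<integral>\<^sup>+x. ennreal (f x / (\<integral>x. f x \<partial>lborel)) \<partial>lborel) = ennreal (\<integral>x. f x / (\<integral>x. f x \<partial>lborel) \<partial>lborel)"
      using f nn pos by (intro nn_integral_eq_integral) auto
    then show "emeasure (density lborel (\<lambda>x. ennreal (f x / (\<integral>x. f x \<partial>lborel))))
        (space (density lborel (\<lambda>x. ennreal (f x / (\<integral>x. f x \<partial>lborel))))) = 1"
      using pos by (simp add: emeasure_density)
  qed
  then show ?thesis using False
    by (simp add: normalized_density_def real_distribution_def real_distribution_axioms_def)
qed

text \<open>Multiplying by the mass instead of dividing keeps the degenerate case true: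
  \<open>f\<close> then vanishes almost everywhere and both sides are 0.\<close>

lemma integral_normalized_density:
  fixes h :: "real \<Rightarrow> 'c :: {banach, second_countable_topology}"
  assumes [measurable]: "h \<in> borel_measurable borel"
  shows "(\<integral>x. f x \<partial>lborel) *\<^sub>R (\<integral>x. h x \<partial>normalized_density f) = (\<integral>x. f x *\<^sub>R h x \<partial>lborel)"
proof (cases "(\<integral>x. f x \<partial>lborel) = 0")
  case True
  then have "AE x in lborel. f x = 0"
    using integral_nonneg_eq_0_iff_AE[OF f] nn by simp
  then have "AE x in lborel. f x *\<^sub>R h x = 0" by eventually_elim simp
  then show ?thesis using True by (simp add: integral_eq_zero_AE)
next
  case False
  then have pos: "0 < (\<integral>x. f x \<partial>lborel)" using nn by (simp add: less_le)
  have [measurable]: "f \<in> borel_measurable borel" using f by auto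
  have "(\<integral>x. h x \<partial>normalized_density f) = (\<integral>x. (f x / (\<integral>x. f x \<partial>lborel)) *\<^sub>R h x \<partial>lborel)"
    using False nn pos unfolding normalized_density_def by (simp add: integral_density)
  also have "\<dots> = (\<integral>x. (1 / (\<integral>x. f x \<partial>lborel)) *\<^sub>R (f x *\<^sub>R h x) \<partial>lborel)" by simp
  also have "\<dots> = (1 / (\<integral>x. f x \<partial>lborel)) *\<^sub>R (\<integral>x. f x *\<^sub>R h x \<partial>lborel)"
    by (rule integral_scaleR_right)
  finally show ?thesis using pos by simp
qed

end

lemma
  assumes f: "integrable lborel f" and nn: "\<And>x. 0 \<le> f x" and \<rho>: "real_distribution \<rho>"
  defines "F \<equiv> normalized_density f" and "L \<equiv> \<integral>x. f x \<partial>lborel"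
  shows measure_convolution_normalized: "L * measure (\<rho> \<star> F) {y..} = (\<integral>x. tail_conv f y x \<partial>\<rho>)"
    and measure_convolution2_normalized: "L\<^sup>2 * measure ((\<rho> \<star> F) \<star> F) {y..} = (\<integral>x. tail_conv2 f y x \<partial>\<rho>)"
proof -
  have F: "real_distribution F" unfolding F_def by (rule real_distribution_normalized_density[OF f nn])
  have [measurable]: "f \<in> borel_measurable borel" using f by auto
  \<comment> \<open>The starting law is arbitrary because the identity is used twice, for
    \<open>\<rho>\<close> and for \<open>\<rho> \<star> F\<close>.\<close>
  have step: "L * measure (\<mu> \<star> F) {y..} = (\<integral>x. tail_conv f y x \<partial>\<mu>)" if \<mu>: "real_distribution \<mu>" for \<mu>
  proof -
    have "L * (\<integral>u. indicator {y..} (x + u) \<partial>F) = tail_conv f y x" for x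
      using integral_normalized_density[OF f nn, of "\<lambda>u. indicator {y..} (x + u) :: real"]
      by (simp add: tail_conv_def F_def L_def mult.commute)
    moreover have "measure (\<mu> \<star> F) {y..} = (\<integral>x. (\<integral>u. indicator {y..} (x + u) \<partial>F) \<partial>\<mu>)"
      by (subst integral_convolution[OF \<mu> F, where B=1, symmetric]) auto
    ultimately show ?thesis by (simp flip: integral_mult_right_zero)
  qed
  show "L * measure (\<rho> \<star> F) {y..} = (\<integral>x. tail_conv f y x \<partial>\<rho>)" by (rule step[OF \<rho>])
  have "L\<^sup>2 * measure ((\<rho> \<star> F) \<star> F) {y..} = L * (\<integral>x. tail_conv f y x \<partial>(\<rho> \<star> F))"
    by (simp add: step[OF real_distribution_convolution[OF \<rho> F], symmetric] power2_eq_square)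
  also have "\<dots> = L * (\<integral>x. (\<integral>u. tail_conv f y (x + u) \<partial>F) \<partial>\<rho>)"
    using tail_conv_nonneg[OF f nn] tail_conv_le[OF f nn]
    by (subst integral_convolution[OF \<rho> F, where B=L]) (auto simp: L_def)
  also have "\<dots> = (\<integral>x. L * (\<integral>u. tail_conv f y (x + u) \<partial>F) \<partial>\<rho>)" by simp
  also have "\<dots> = (\<integral>x. tail_conv2 f y x \<partial>\<rho>)"
    using integral_normalized_density[OF f nn, of "\<lambda>u. tail_conv f y (x + u)" for x]
    by (simp add: tail_conv2_def F_def L_def mult.commute)
  finally show "L\<^sup>2 * measure ((\<rho> \<star> F) \<star> F) {y..} = (\<integral>x. tail_conv2 f y x \<partial>\<rho>)" .
qed

text \<open>Only the law of \<open>X t\<close> at one time enters, so matching characteristic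
  functions suffices and no joint statement about the small and large jumps of \<open>N\<close> has
  to be proved. \<open>S\<close> is the law of the small jumps without drift; the drift appears as
  the shift \<open>b\<^sub>0 * t\<close>.\<close>

lemma levy_tail_expansion:
  fixes s :: "real \<Rightarrow> real" and \<eta> :: real
  assumes X: "levy_process_with_triplet M X 0 b \<nu>" and s[measurable]: "s \<in> borel_measurable borel"
    and nn: "\<And>x. 0 \<le> s x" and \<nu>: "\<nu> = density lborel (\<lambda>x. ennreal (s x))"
    and fv: "integrable \<nu> (\<lambda>x. min 1 \<bar>x\<bar>)" and t: "0 \<le> t" and \<eta>: "0 < \<eta>" "\<eta> \<le> 1"
  defines "f \<equiv> \<lambda>x. indicator (- {-\<eta>..\<eta>}) x * s x"
    and "b\<^sub>0 \<equiv> b - (\<integral>x. indicator {-1..1} x * x \<partial>\<nu>)"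
  defines "L \<equiv> \<integral>x. f x \<partial>lborel"
  obtains S where "real_distribution S"
    "\<And>a. 0 \<le> a \<Longrightarrow> (\<integral>\<^sup>+x. ennreal (exp (a * \<bar>x\<bar>)) \<partial>S)
        \<le> ennreal (exp ((exp (a * \<eta>) - 1) / \<eta> * (t * (\<integral>x. indicator {-\<eta>..\<eta>} x * \<bar>x\<bar> \<partial>\<nu>))))"
    "\<bar>measure M {\<omega> \<in> space M. X t \<omega> \<ge> y} - exp (- (L * t)) * (measure S {x. y \<le> b\<^sub>0 * t + x}
      + t * (\<integral>x. tail_conv f y (b\<^sub>0 * t + x) \<partial>S) + t\<^sup>2 / 2 * (\<integral>x. tail_conv2 f y (b\<^sub>0 * t + x) \<partial>S))\<bar>
      \<le> (L * t) ^ 3"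
proof -
  have sets\<nu>[measurable_cong]: "sets \<nu> = sets borel" by (simp add: \<nu>)
  have [measurable]: "f \<in> borel_measurable borel" unfolding f_def by measurable
  have sf: "sigma_finite_measure \<nu>"
    unfolding \<nu> by (subst sigma_finite_measure.sigma_finite_iff_density_finite[OF sigma_finite_lborel]) auto
  have dens: "integrable \<nu> h \<longleftrightarrow> integrable lborel (\<lambda>x. s x *\<^sub>R h x)" "(\<integral>x. h x \<partial>\<nu>) = (\<integral>x. s x *\<^sub>R h x \<partial>lborel)"
    if [measurable]: "h \<in> borel_measurable borel" for h :: "real \<Rightarrow> 'd :: {banach, second_countable_topology}"
    unfolding \<nu> using nn by (auto simp: integrable_density integral_density)
  have fnn: "0 \<le> f x" for x using nn by (simp add: f_def)
  have fint: "integrable lborel f"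
    using fv dens(1)[of "\<lambda>x. min 1 \<bar>x\<bar>"] nn \<eta>
    by (intro integrable_away_zero[of s f \<eta>]) (auto simp: f_def split: split_indicator)
  have lam0: "0 \<le> L" unfolding L_def using fnn by simp
  interpret prob_space M using X by (simp add: levy_process_with_triplet_def levy_process_def)
  have Xm[measurable]: "X t \<in> borel_measurable M"
    using X t by (auto simp: levy_process_with_triplet_def levy_process_def)
  obtain N where PRM: "poisson_random_measure M (levy_intensity \<nu>) N"
    using X unfolding levy_process_with_triplet_def by blast
  interpret poisson_rm M "levy_intensity \<nu>" N by unfold_locales (rule PRM)
  interpret poisson_jumps M \<nu> N
    by (intro poisson_jumps.intro poisson_rm_axioms poisson_jumps_axioms.intro sf sets\<nu> fv)
  obtain S where S: "real_distribution S"
    and charS: "\<And>\<theta>. char S \<theta> = exp (t * (\<integral>x. indicator {-\<eta>..\<eta>} x *\<^sub>R (iexp (\<theta> * x) - 1) \<partial>\<nu>))"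
    and mgf: "\<And>a. 0 \<le> a \<Longrightarrow> (\<integral>\<^sup>+x. ennreal (exp (a * \<bar>x\<bar>)) \<partial>S)
        \<le> ennreal (exp ((exp (a * \<eta>) - 1) / \<eta> * (t * (\<integral>x. indicator {-\<eta>..\<eta>} x * \<bar>x\<bar> \<partial>\<nu>))))"
    using small_jumps_distribution[OF \<eta> t] by blast
  interpret S: real_distribution S by (rule S)
  define \<rho> where "\<rho> = distr S borel (\<lambda>x. b\<^sub>0 * t + x)"
  have \<rho>: "real_distribution \<rho>" unfolding \<rho>_def by (rule S.real_distribution_distr) measurable
  define F where "F = normalized_density f"
  have F: "real_distribution F" unfolding F_def by (rule real_distribution_normalized_density[OF fint fnn])
  interpret F: real_distribution F by (rule F)
  have law: "distr M borel (X t) = add_poisson_jumps \<rho> F (L * t)"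
  proof (rule Levy_uniqueness)
    show "real_distribution (distr M borel (X t))" by (rule real_distribution_distr) measurable
    show "real_distribution (add_poisson_jumps \<rho> F (L * t))" by (rule real_distribution_add_poisson_jumps[OF \<rho> F])
    show "char (distr M borel (X t)) = char (add_poisson_jumps \<rho> F (L * t))"
    proof
      fix \<theta>
      let ?e = "\<lambda>x. iexp (\<theta> * x) - 1"
      have I: "integrable \<nu> (\<lambda>x. indicator A x *\<^sub>R ?e x)" if [measurable]: "A \<in> sets borel" for A
      proof (rule Bochner_Integration.integrable_bound)
        show "integrable \<nu> (\<lambda>x. (2 + \<bar>\<theta>\<bar>) * min 1 \<bar>x\<bar>)" using fv by simp
        show "AE x in \<nu>. norm (indicator A x *\<^sub>R ?e x) \<le> norm ((2 + \<bar>\<theta>\<bar>) * min 1 \<bar>x\<bar>)"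
          using cmod_iexp_minus_one_le[of \<theta>] by (auto split: split_indicator)
      qed measurable
      have "char \<rho> \<theta> = (\<integral>x. iexp (\<theta> * (b\<^sub>0 * t)) * iexp (\<theta> * x) \<partial>S)"
        unfolding \<rho>_def char_def by (subst integral_distr) (auto simp: distrib_left exp_add)
      then have c\<rho>: "char \<rho> \<theta> = iexp (\<theta> * (b\<^sub>0 * t)) * char S \<theta>" by (simp only: char_def integral_mult_right_zero)
      have "char F \<theta> - 1 = (\<integral>x. ?e x \<partial>F)"
      proof -
        have "integrable F (\<lambda>x. iexp (\<theta> * x))" by (rule F.integrable_const_bound[where B=1]) auto
        then show ?thesis unfolding char_def
          by (subst Bochner_Integration.integral_diff) (auto simp: F.prob_space simp del: F.space_eq_univ)
      qed
      \<comment> \<open>The rate cancels the normalization, so the exponent becomes an integral over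
        \<nu> again and joins that of \<open>char S\<close> to cover all of \<nu>.\<close>
      then have "L * (char F \<theta> - 1) = L *\<^sub>R (\<integral>x. ?e x \<partial>F)" by (simp add: scaleR_conv_of_real)
      also have "\<dots> = (\<integral>x. f x *\<^sub>R ?e x \<partial>lborel)"
        unfolding L_def F_def by (rule integral_normalized_density[OF fint fnn]) measurable
      also have "\<dots> = (\<integral>x. indicator (- {-\<eta>..\<eta>}) x *\<^sub>R ?e x \<partial>\<nu>)"
        by (subst dens(2)) (auto simp: f_def mult.commute)
      finally have cF: "L * (char F \<theta> - 1) = (\<integral>x. indicator (- {-\<eta>..\<eta>}) x *\<^sub>R ?e x \<partial>\<nu>)" .
      have sum: "(\<integral>x. indicator {-\<eta>..\<eta>} x *\<^sub>R ?e x \<partial>\<nu>) + (\<integral>x. indicator (- {-\<eta>..\<eta>}) x *\<^sub>R ?e x \<partial>\<nu>)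
          = (\<integral>x. ?e x \<partial>\<nu>)"
        by (subst Bochner_Integration.integral_add[symmetric, OF I I])
          (auto intro!: Bochner_Integration.integral_cong split: split_indicator)
      have "char (add_poisson_jumps \<rho> F (L * t)) \<theta> = char \<rho> \<theta> * exp (t * (L * (char F \<theta> - 1)))"
        using lam0 t by (subst char_add_poisson_jumps[OF \<rho> F]) (auto simp: mult_ac)
      also have "\<dots> = exp (t * (\<i> * \<theta> * b\<^sub>0 + (\<integral>x. ?e x \<partial>\<nu>)))"
        unfolding c\<rho> charS cF sum[symmetric] exp_add[symmetric] by (simp add: algebra_simps)
      finally show "char (distr M borel (X t)) \<theta> = char (add_poisson_jumps \<rho> F (L * t)) \<theta>"
        unfolding b\<^sub>0_def using char_levy_finite_variation[OF X sf fv t] by simp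
    qed
  qed
  have m0: "measure M {\<omega> \<in> space M. X t \<omega> \<ge> y} = measure (add_poisson_jumps \<rho> F (L * t)) {y..}"
    unfolding law[symmetric] by (subst measure_distr) (auto intro!: arg_cong[where f="measure M"])
  have m1: "measure \<rho> {y..} = measure S {x. y \<le> b\<^sub>0 * t + x}"
    unfolding \<rho>_def by (subst measure_distr) (auto intro!: arg_cong[where f="measure S"])
  have m2: "(L * t) * measure (\<rho> \<star> F) {y..} = t * (\<integral>x. tail_conv f y (b\<^sub>0 * t + x) \<partial>S)"
    using measure_convolution_normalized[OF fint fnn \<rho>, of y]
    by (simp add: F_def L_def \<rho>_def integral_distr mult_ac)
  have m3: "(L * t)\<^sup>2 / 2 * measure ((\<rho> \<star> F) \<star> F) {y..} = t\<^sup>2 / 2 * (\<integral>x. tail_conv2 f y (b\<^sub>0 * t + x) \<partial>S)"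
    using measure_convolution2_normalized[OF fint fnn \<rho>, of y]
    by (simp add: F_def L_def \<rho>_def integral_distr power_mult_distrib mult_ac)
  have "0 \<le> L * t" using lam0 t by simp
  from measure_add_poisson_jumps[OF \<rho> F this, of "{y..}"]
  show thesis unfolding m0[symmetric] m1 m2 m3 by (intro that[OF S mgf]) auto
qed

section \<open>Tail integrals of a density\<close>

lemma tail_conv_add:
  assumes "integrable lborel f" "integrable lborel g"
  shows "tail_conv (\<lambda>x. f x + g x) y z = tail_conv f y z + tail_conv g y z"
proof -
  have "integrable lborel (\<lambda>u. indicator {y..} (z + u) * h u)" if "integrable lborel h" for h :: "real \<Rightarrow> real"
    using that by (rule Bochner_Integration.integrable_bound) (use that in \<open>auto split: split_indicator\<close>)
  then show ?thesis unfolding tail_conv_def using assms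
    by (subst Bochner_Integration.integral_add[symmetric]) (auto simp: distrib_left)
qed

text \<open>The indicator is discontinuous in its argument only at \<open>u = y - z\<close>, a null
  set for the density, so dominated convergence applies.\<close>

lemma isCont_tail_conv:
  assumes f: "integrable lborel f"
  shows "isCont (tail_conv f y) z"
  unfolding continuous_at_sequentially comp_def
proof safe
  fix Z assume Z: "Z \<longlonglongrightarrow> z"
  have [measurable]: "f \<in> borel_measurable borel" using f by auto
  have ae: "AE u in lborel. u \<noteq> y - z" by (rule AE_lborel_singleton)
  show "(\<lambda>n. tail_conv f y (Z n)) \<longlonglongrightarrow> tail_conv f y z"
    unfolding tail_conv_def
  proof (rule integral_dominated_convergence[where w="\<lambda>u. \<bar>f u\<bar>"])
    show "AE u in lborel. (\<lambda>n. indicator {y..} (Z n + u) * f u) \<longlonglongrightarrow> indicator {y..} (z + u) * f u"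
      using ae
    proof eventually_elim
      case (elim u)
      have l: "(\<lambda>n. Z n + u) \<longlonglongrightarrow> z + u" using Z by (intro tendsto_intros)
      have "\<forall>\<^sub>F n in sequentially. indicator {y..} (Z n + u) = (indicator {y..} (z + u) :: real)"
      proof (cases "y < z + u")
        case True
        then show ?thesis using order_tendstoD(1)[OF l True] by (auto elim!: eventually_mono)
      next
        case False
        then have "z + u < y" using elim by auto
        then show ?thesis using order_tendstoD(2)[OF l, of y] by (auto elim!: eventually_mono)
      qed
      then show ?case by (intro tendsto_intros tendsto_eventually)
    qed
    show "AE u in lborel. norm (indicator {y..} (Z n + u) * f u) \<le> \<bar>f u\<bar>" for n
      by (auto split: split_indicator)
  qed (use f in auto)
qed

lemma isCont_tail_conv2:
  assumes f: "integrable lborel f" and nn: "\<And>x. 0 \<le> f x"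
  shows "isCont (tail_conv2 f y) z"
  unfolding continuous_at_sequentially comp_def
proof safe
  fix Z assume Z: "Z \<longlonglongrightarrow> z"
  have [measurable]: "f \<in> borel_measurable borel" using f by auto
  show "(\<lambda>n. tail_conv2 f y (Z n)) \<longlonglongrightarrow> tail_conv2 f y z"
    unfolding tail_conv2_def
  proof (rule integral_dominated_convergence[where w="\<lambda>u. (\<integral>x. f x \<partial>lborel) * f u"])
    show "AE u in lborel. (\<lambda>n. tail_conv f y (Z n + u) * f u) \<longlonglongrightarrow> tail_conv f y (z + u) * f u"
      using Z by (intro AE_I2 tendsto_intros isCont_tendsto_compose[OF isCont_tail_conv[OF f]])
    show "AE u in lborel. norm (tail_conv f y (Z n + u) * f u) \<le> (\<integral>x. f x \<partial>lborel) * f u" for n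
      using tail_conv_nonneg[OF f nn] tail_conv_le[OF f nn] nn
      by (auto simp: abs_mult intro!: mult_right_mono)
  qed (use f in auto)
qed

text \<open>The condition that two jumps add up to at least \<open>y\<close> is symmetric in them;
  Fubini does the rest. It makes the two mixed terms of a pair expansion equal.\<close>

lemma tail_conv_swap:
  assumes f: "integrable lborel f" and g: "integrable lborel g"
    and fnn: "\<And>x. 0 \<le> f x" and gnn: "\<And>x. 0 \<le> g x"
  shows "(\<integral>x. tail_conv f y x * g x \<partial>lborel) = (\<integral>x. tail_conv g y x * f x \<partial>lborel)"
proof -
  have [measurable]: "f \<in> borel_measurable borel" "g \<in> borel_measurable borel" using f g by auto
  let ?h = "\<lambda>p. indicator {y..} (fst p + snd p) * f (snd p) * g (fst p) :: real"
  have I: "integrable (lborel \<Otimes>\<^sub>M lborel) ?h"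
  proof (rule lborel_pair.Fubini_integrable)
    have eq: "(\<integral>u. norm (?h (x, u)) \<partial>lborel) = tail_conv f y x * g x" for x
      using fnn gnn by (simp add: tail_conv_def abs_mult)
    show "integrable lborel (\<lambda>x. \<integral>u. norm (?h (x, u)) \<partial>lborel)" unfolding eq
    proof (rule Bochner_Integration.integrable_bound)
      show "integrable lborel (\<lambda>x. (\<integral>x. f x \<partial>lborel) * g x)" using g by simp
      show "AE x in lborel. norm (tail_conv f y x * g x) \<le> norm ((\<integral>x. f x \<partial>lborel) * g x)"
        using tail_conv_nonneg[OF f fnn] tail_conv_le[OF f fnn] gnn
        by (auto simp: abs_mult intro!: mult_right_mono order_trans[OF tail_conv_le[OF f fnn]])
    qed measurable
    have "integrable lborel (\<lambda>u. indicator {y..} (x + u) * f u)" for x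
      using f by (rule Bochner_Integration.integrable_bound) (auto split: split_indicator)
    then show "AE x in lborel. integrable lborel (\<lambda>u. ?h (x, u))" by simp
  qed measurable
  have "(\<integral>x. tail_conv f y x * g x \<partial>lborel) = (\<integral>x. (\<integral>u. ?h (x, u) \<partial>lborel) \<partial>lborel)"
    by (simp add: tail_conv_def)
  also have "\<dots> = (\<integral>u. (\<integral>x. ?h (x, u) \<partial>lborel) \<partial>lborel)"
  proof -
    have "integrable (lborel \<Otimes>\<^sub>M lborel) (\<lambda>(x, u). ?h (x, u))" using I by (simp add: case_prod_beta')
    from lborel_pair.Fubini_integral[OF this] show ?thesis by (rule sym)
  qed
  also have "\<dots> = (\<integral>x. tail_conv g y x * f x \<partial>lborel)"
    by (simp add: tail_conv_def mult_ac add.commute)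
  finally show ?thesis .
qed

text \<open>Expanding the pair of jumps gives four terms. Two jumps from \<open>r\<close> add up to
  at most \<open>2 * \<epsilon> < y\<close> and contribute nothing, and the two mixed terms coincide
  by symmetry.\<close>

lemma tail_conv2_add_small:
  assumes f: "integrable lborel f" and r: "integrable lborel r"
    and fnn: "\<And>x. 0 \<le> f x" and rnn: "\<And>x. 0 \<le> r x"
    and supp: "\<And>x. \<epsilon> < \<bar>x\<bar> \<Longrightarrow> r x = 0" and \<epsilon>: "2 * \<epsilon> < y"
  shows "tail_conv2 (\<lambda>x. f x + r x) y 0 = tail_conv2 f y 0 + 2 * (\<integral>x. tail_conv f y x * r x \<partial>lborel)"
proof -
  have [measurable]: "f \<in> borel_measurable borel" "r \<in> borel_measurable borel" using f r by auto
  have I: "integrable lborel (\<lambda>x. tail_conv g y x * h x)"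
    if g: "integrable lborel g" "\<And>x. 0 \<le> g x" and h: "integrable lborel h" "\<And>x. 0 \<le> h x" for g h :: "real \<Rightarrow> real"
  proof (rule Bochner_Integration.integrable_bound)
    have [measurable]: "g \<in> borel_measurable borel" "h \<in> borel_measurable borel" using g h by auto
    show "integrable lborel (\<lambda>x. (\<integral>x. g x \<partial>lborel) * h x)" using h by simp
    show "AE x in lborel. norm (tail_conv g y x * h x) \<le> norm ((\<integral>x. g x \<partial>lborel) * h x)"
      using tail_conv_nonneg[OF g] tail_conv_le[OF g] h
      by (auto simp: abs_mult intro!: mult_right_mono order_trans[OF tail_conv_le[OF g]])
    show "(\<lambda>x. tail_conv g y x * h x) \<in> borel_measurable lborel" by measurable
  qed
  have rr: "tail_conv r y x * r x = 0" for x
  proof (cases "\<epsilon> < \<bar>x\<bar>")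
    case False
    have "indicator {y..} (x + u) * r u = 0" for u
      using False \<epsilon> supp[of u] by (cases "\<epsilon> < \<bar>u\<bar>") (auto simp: indicator_def)
    then show ?thesis by (simp only: tail_conv_def integral_zero mult_zero_left)
  qed (simp add: supp)
  have "tail_conv2 (\<lambda>x. f x + r x) y 0
      = (\<integral>x. tail_conv f y x * f x + tail_conv f y x * r x + tail_conv r y x * f x \<partial>lborel)"
    unfolding tail_conv2_def tail_conv_add[OF f r]
    by (rule Bochner_Integration.integral_cong) (use rr in \<open>auto simp: algebra_simps\<close>)
  also have "\<dots> = (\<integral>x. tail_conv f y x * f x \<partial>lborel) + (\<integral>x. tail_conv f y x * r x \<partial>lborel)
      + (\<integral>x. tail_conv r y x * f x \<partial>lborel)"
    using I[OF f fnn f fnn] I[OF f fnn r rnn] I[OF r rnn f fnn] by simp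
  also have "(\<integral>x. tail_conv r y x * f x \<partial>lborel) = (\<integral>x. tail_conv f y x * r x \<partial>lborel)"
    by (rule tail_conv_swap[OF r f rnn fnn])
  finally show ?thesis by (simp add: tail_conv2_def)
qed

lemma tail_conv_diff:
  assumes f: "integrable lborel f" and le: "a \<le> b"
  shows "tail_conv f y b - tail_conv f y a = (\<integral>u. indicator {y - b..<y - a} u * f u \<partial>lborel)"
proof -
  have I: "integrable lborel (\<lambda>u. indicator {y..} (z + u) * f u)" for z
    using f by (rule Bochner_Integration.integrable_bound) (use f in \<open>auto split: split_indicator\<close>)
  show ?thesis unfolding tail_conv_def
    by (subst Bochner_Integration.integral_diff[symmetric, OF I I])
      (use le in \<open>auto intro!: Bochner_Integration.integral_cong split: split_indicator\<close>)
qed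

lemma interval_integral_reflect:
  fixes s :: "real \<Rightarrow> real"
  assumes "a \<le> b" and [measurable]: "s \<in> borel_measurable borel"
  shows "(LBINT u=ereal a..ereal b. s (y - u)) = (\<integral>u. indicator {y - b..<y - a} u * s u \<partial>lborel)"
proof -
  have "(\<integral>u. indicator {y - b..<y - a} u * s u \<partial>lborel)
      = (\<integral>u. indicator {y - b..<y - a} (y - u) * s (y - u) \<partial>lborel)"
    by (subst lborel_integral_real_affine[where c="-1" and t=y]) auto
  also have "\<dots> = (\<integral>u. indicator {a<..<b} u * s (y - u) \<partial>lborel)"
  proof (rule integral_cong_AE)
    \<comment> \<open>Reflection sends the half-open interval to \<open>(a, b]\<close>, which
      differs from the open interval of \<open>LBINT\<close> in the null point
      \<open>b\<close>.\<close>
    have "AE u in lborel. u \<noteq> b" by (rule AE_lborel_singleton)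
    then show "AE u in lborel. indicator {y - b..<y - a} (y - u) * s (y - u) = indicator {a<..<b} u * s (y - u)"
      by eventually_elim (auto split: split_indicator)
  qed measurable
  finally show ?thesis using assms(1)
    by (simp add: interval_lebesgue_integral_def set_lebesgue_integral_def)
qed

text \<open>This is the origin of the inner integral of the claim. The values of \<open>f\<close>
  involved lie between \<open>y\<close> and \<open>y - x\<close>, where it agrees with
  \<open>s\<close>, and the orientation of the integral supplies the sign for negative
  \<open>x\<close>.\<close>

lemma tail_conv_diff_interval_integral:
  assumes f: "integrable lborel f" and s[measurable]: "s \<in> borel_measurable borel"
    and eq: "\<And>u. y - \<epsilon> \<le> u \<Longrightarrow> f u = s u" and x: "\<bar>x\<bar> \<le> \<epsilon>"
  shows "tail_conv f y x - tail_conv f y 0 = (LBINT u=0..ereal x. s (y - u))"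
proof (cases "0 \<le> x")
  case True
  have "(LBINT u=0..ereal x. s (y - u)) = (\<integral>u. indicator {y - x..<y - 0} u * s u \<partial>lborel)"
    using interval_integral_reflect[OF True s, of y] by (simp add: zero_ereal_def)
  also have "\<dots> = (\<integral>u. indicator {y - x..<y - 0} u * f u \<partial>lborel)"
    using x eq by (intro Bochner_Integration.integral_cong) (auto split: split_indicator)
  finally show ?thesis using tail_conv_diff[OF f True, of y] by simp
next
  case False
  have "(LBINT u=0..ereal x. s (y - u)) = - (LBINT u=ereal x..0. s (y - u))"
    by (rule interval_integral_endpoints_reverse)
  also have "(LBINT u=ereal x..0. s (y - u)) = (\<integral>u. indicator {y - 0..<y - x} u * s u \<partial>lborel)"
    using interval_integral_reflect[of x 0 s y] False by (simp add: zero_ereal_def)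
  also have "\<dots> = (\<integral>u. indicator {y - 0..<y - x} u * f u \<partial>lborel)"
    using x eq by (intro Bochner_Integration.integral_cong) (auto split: split_indicator)
  finally show ?thesis using tail_conv_diff[OF f, of x 0 y] False by simp
qed

text \<open>Two uses are intended: with \<open>m = s y\<close> and small \<open>e\<close> it gives
  the derivative of the tail at 0, and with \<open>m = 0\<close> it is a Lipschitz bound.\<close>

lemma tail_conv_diff_bound:
  assumes f: "integrable lborel f" and bd: "\<And>u. \<bar>u - y\<bar> \<le> \<bar>x\<bar> \<Longrightarrow> \<bar>f u - m\<bar> \<le> e"
  shows "\<bar>tail_conv f y x - tail_conv f y 0 - m * x\<bar> \<le> e * \<bar>x\<bar>"
proof -
  have key: "\<bar>(\<integral>u. indicator {a..<b} u * f u \<partial>lborel) - m * (b - a)\<bar> \<le> e * (b - a)"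
    if ab: "a \<le> b" and bd': "\<And>u. a \<le> u \<Longrightarrow> u < b \<Longrightarrow> \<bar>f u - m\<bar> \<le> e" for a b
  proof -
    have I: "integrable lborel (\<lambda>u. indicator {a..<b} u * f u)"
      using f by (rule Bochner_Integration.integrable_bound) (use f in \<open>auto split: split_indicator\<close>)
    have hb: "has_bochner_integral lborel (\<lambda>u. indicator {a..<b} u *\<^sub>R k) (measure lborel {a..<b} *\<^sub>R k)" for k :: real
      using ab by (intro has_bochner_integral_scaleR_left has_bochner_integral_real_indicator) auto
    have J: "integrable lborel (\<lambda>u. indicator {a..<b} u * k)" "(\<integral>u. indicator {a..<b} u * k \<partial>lborel) = k * (b - a)" for k :: real
      using hb[of k] ab by (auto simp: has_bochner_integral_iff mult.commute)
    have "(\<integral>u. indicator {a..<b} u * f u \<partial>lborel) - m * (b - a)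
        = (\<integral>u. indicator {a..<b} u * f u - indicator {a..<b} u * m \<partial>lborel)"
      by (simp only: Bochner_Integration.integral_diff[OF I J(1)] J(2))
    also have "\<bar>\<dots>\<bar> \<le> (\<integral>u. \<bar>indicator {a..<b} u * f u - indicator {a..<b} u * m\<bar> \<partial>lborel)"
      by (rule integral_abs_bound)
    also have "\<dots> \<le> (\<integral>u. indicator {a..<b} u * e \<partial>lborel)"
      using I J bd' by (intro integral_mono) (auto split: split_indicator)
    finally show ?thesis by (simp only: J(2))
  qed
  show ?thesis
  proof (cases "0 \<le> x")
    case True
    have "\<bar>(\<integral>u. indicator {y - x..<y - 0} u * f u \<partial>lborel) - m * (y - 0 - (y - x))\<bar> \<le> e * (y - 0 - (y - x))"
      using True by (intro key bd) auto
    then show ?thesis using tail_conv_diff[OF f True, of y] True by simp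
  next
    case False
    have "\<bar>(\<integral>u. indicator {y - 0..<y - x} u * f u \<partial>lborel) - m * (y - x - (y - 0))\<bar> \<le> e * (y - x - (y - 0))"
      using False by (intro key bd) auto
    then show ?thesis using tail_conv_diff[OF f, of x 0 y] False by simp
  qed
qed

section \<open>Small-time asymptotics\<close>

text \<open>The tail bound uses the exponential moment with parameter \<open>ln (1 / t) / \<eta>\<close>, for which
  \<open>exp (a * \<eta>) = 1 / t\<close> balances the exponent \<open>t * exp (a * \<eta>)\<close>.\<close>

lemma
  fixes S :: "real measure"
  assumes S: "real_distribution S" and \<eta>: "0 < \<eta>" "\<eta> \<le> 1" and t: "0 < t" "t < 1" and k: "0 \<le> k"
    and mgf: "\<And>a. 0 \<le> a \<Longrightarrow> (\<integral>\<^sup>+x. ennreal (exp (a * \<bar>x\<bar>)) \<partial>S)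
        \<le> ennreal (exp ((exp (a * \<eta>) - 1) / \<eta> * (t * k)))"
  shows small_jumps_integrable: "integrable S (\<lambda>x. \<bar>x\<bar>)"
    and small_jumps_moment: "(\<integral>x. \<bar>x\<bar> \<partial>S) \<le> exp (2 * k * t) - 1"
    and small_jumps_tail: "measure S {x. 3 * \<eta> \<le> \<bar>x\<bar>} \<le> t ^ 3 * exp (k / \<eta>)"
proof -
  interpret real_distribution S by fact
  \<comment> \<open>With \<open>a = 1\<close> the chord slope is at most 2 because
    \<open>\<eta> \<le> 1\<close>; this is the 2 in \<open>exp (2 * k * t) - 1\<close>.\<close>
  have "(exp (1 * \<eta>) - 1) / \<eta> \<le> 2"
  proof -
    have "exp \<eta> \<le> 1 + \<eta> + \<eta>\<^sup>2" using \<eta> by (intro exp_bound) auto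
    also have "\<dots> \<le> 1 + 2 * \<eta>" using \<eta> by (simp add: power2_eq_square mult_left_le)
    finally show ?thesis using \<eta> by (simp add: field_simps)
  qed
  then have c: "(exp (1 * \<eta>) - 1) / \<eta> * (t * k) \<le> 2 * (t * k)"
    using k t by (intro mult_right_mono) auto
  have "(\<integral>\<^sup>+x. ennreal (norm (exp \<bar>x\<bar>)) \<partial>S) \<le> ennreal (exp ((exp (1 * \<eta>) - 1) / \<eta> * (t * k)))"
    using mgf[of 1] by simp
  also have "\<dots> \<le> ennreal (exp (2 * k * t))" using c by (intro ennreal_leI) (simp add: mult_ac)
  finally have E: "(\<integral>\<^sup>+x. ennreal (norm (exp \<bar>x\<bar>)) \<partial>S) \<le> ennreal (exp (2 * k * t))" .
  have Ei: "integrable S (\<lambda>x. exp \<bar>x\<bar>)"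
    by (rule integrableI_bounded) (use E in \<open>auto intro: le_less_trans\<close>)
  have le: "\<bar>x\<bar> \<le> exp \<bar>x\<bar> - 1" for x :: real using exp_ge_add_one_self[of "\<bar>x\<bar>"] by linarith
  show int: "integrable S (\<lambda>x. \<bar>x\<bar>)"
  proof (rule Bochner_Integration.integrable_bound[OF Ei])
    show "AE x in S. norm \<bar>x\<bar> \<le> norm (exp \<bar>x\<bar>)"
    proof (rule AE_I2)
      show "norm \<bar>x\<bar> \<le> norm (exp \<bar>x\<bar>)" for x :: real using le[of x] by simp
    qed
  qed measurable
  have "(\<integral>x. \<bar>x\<bar> \<partial>S) \<le> (\<integral>x. exp \<bar>x\<bar> - 1 \<partial>S)"
    using int Ei le by (intro integral_mono) auto
  also have "\<dots> = (\<integral>x. exp \<bar>x\<bar> \<partial>S) - 1"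
    using Ei prob_space by (subst Bochner_Integration.integral_diff) auto
  also have "(\<integral>x. exp \<bar>x\<bar> \<partial>S) \<le> exp (2 * k * t)"
    using E nn_integral_eq_integral[OF Ei] by (simp add: ennreal_le_iff)
  finally show "(\<integral>x. \<bar>x\<bar> \<partial>S) \<le> exp (2 * k * t) - 1" by simp
  define a where "a = ln (1 / t) / \<eta>"
  have a0: "0 \<le> a" using t \<eta> by (simp add: a_def ln_div divide_nonpos_pos)
  have ea: "exp (a * \<eta>) = 1 / t" using t \<eta> by (simp add: a_def)
  \<comment> \<open>Reaching three thresholds is weighted by \<open>(1 / t) ^ 3\<close>, so Markov's
    inequality yields \<open>t ^ 3\<close>, negligible after division by
    \<open>t\<^sup>2\<close>.\<close>
  have e3: "exp (a * (3 * \<eta>)) = (1 / t) ^ 3"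
    unfolding ea[symmetric] exp_of_nat_mult[symmetric] by simp
  have "emeasure S {x \<in> space S. 1 \<le> ennreal (t ^ 3) * ennreal (exp (a * \<bar>x\<bar>))}
      \<le> ennreal (t ^ 3) * (\<integral>\<^sup>+x. ennreal (exp (a * \<bar>x\<bar>)) * indicator (space S) x \<partial>S)"
    by (rule nn_integral_Markov_inequality) auto
  also have "(\<integral>\<^sup>+x. ennreal (exp (a * \<bar>x\<bar>)) * indicator (space S) x \<partial>S) \<le> ennreal (exp ((exp (a * \<eta>) - 1) / \<eta> * (t * k)))"
    using mgf[OF a0] by simp
  also have "ennreal (t ^ 3) * ennreal (exp ((exp (a * \<eta>) - 1) / \<eta> * (t * k))) \<le> ennreal (t ^ 3 * exp (k / \<eta>))"
  proof -
    have "(exp (a * \<eta>) - 1) / \<eta> * (t * k) = (1 - t) * (k / \<eta>)"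
      unfolding ea using t \<eta> by (simp add: field_simps)
    also have "\<dots> \<le> 1 * (k / \<eta>)" using k \<eta> t by (intro mult_right_mono) auto
    finally show ?thesis using t by (simp add: ennreal_mult''[symmetric] ennreal_le_iff)
  qed
  finally have "emeasure S {x \<in> space S. 1 \<le> ennreal (t ^ 3) * ennreal (exp (a * \<bar>x\<bar>))} \<le> ennreal (t ^ 3 * exp (k / \<eta>))"
    by (simp add: mult_left_mono)
  moreover have "{x. 3 * \<eta> \<le> \<bar>x\<bar>} \<subseteq> {x \<in> space S. 1 \<le> ennreal (t ^ 3) * ennreal (exp (a * \<bar>x\<bar>))}"
  proof
    fix x assume "x \<in> {x. 3 * \<eta> \<le> \<bar>x\<bar>}"
    then have "exp (a * (3 * \<eta>)) \<le> exp (a * \<bar>x\<bar>)" using a0 by (simp add: mult_left_mono)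
    then have "t ^ 3 * (1 / t) ^ 3 \<le> t ^ 3 * exp (a * \<bar>x\<bar>)" unfolding e3 using t by (intro mult_left_mono) auto
    then have "1 \<le> t ^ 3 * exp (a * \<bar>x\<bar>)" using t by (simp add: power_mult_distrib[symmetric])
    then show "x \<in> {x \<in> space S. 1 \<le> ennreal (t ^ 3) * ennreal (exp (a * \<bar>x\<bar>))}"
      using t by (simp add: ennreal_mult''[symmetric] flip: ennreal_1)
  qed
  then have "emeasure S {x. 3 * \<eta> \<le> \<bar>x\<bar>} \<le> emeasure S {x \<in> space S. 1 \<le> ennreal (t ^ 3) * ennreal (exp (a * \<bar>x\<bar>))}"
    by (rule emeasure_mono) measurable
  ultimately have "emeasure S {x. 3 * \<eta> \<le> \<bar>x\<bar>} \<le> ennreal (t ^ 3 * exp (k / \<eta>))"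
    by (rule order_trans[rotated])
  then show "measure S {x. 3 * \<eta> \<le> \<bar>x\<bar>} \<le> t ^ 3 * exp (k / \<eta>)"
    using t by (simp add: emeasure_eq_measure ennreal_le_iff)
qed

section \<open>Expectations under laws concentrating at 0\<close>

lemma linear_approximation_expectation:
  fixes S :: "real measure" and g :: "real \<Rightarrow> real"
  assumes S: "real_distribution S" and int: "integrable S (\<lambda>x. \<bar>x\<bar>)"
    and g[measurable]: "g \<in> borel_measurable borel" and bd: "\<And>z. 0 \<le> g z \<and> g z \<le> L"
    and lin: "\<And>z. \<bar>z\<bar> \<le> r \<Longrightarrow> \<bar>g z - g 0 - m * z\<bar> \<le> e * \<bar>z\<bar>"
    and m: "0 \<le> m" and e: "0 \<le> e" and d: "\<bar>d\<bar> \<le> r / 2" and q: "q \<le> r / 2"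
  shows "\<bar>(\<integral>x. g (d + x) \<partial>S) - g 0 - m * d\<bar>
    \<le> e * (\<bar>d\<bar> + (\<integral>x. \<bar>x\<bar> \<partial>S)) + m * (\<integral>x. \<bar>x\<bar> \<partial>S) + L * measure S {x. q \<le> \<bar>x\<bar>}"
proof -
  interpret real_distribution S by fact
  have gi: "integrable S (\<lambda>x. g (d + x))"
    by (rule integrable_const_bound[where B=L]) (use bd in auto)
  have L: "0 \<le> L" using bd[of 0] by linarith
  have hb: "has_bochner_integral S (indicator {x. q \<le> \<bar>x\<bar>} :: real \<Rightarrow> real) (measure S {x. q \<le> \<bar>x\<bar>})"
    by (rule has_bochner_integral_real_indicator) (auto simp: emeasure_eq_measure)
  then have ii: "integrable S (indicator {x. q \<le> \<bar>x\<bar>} :: real \<Rightarrow> real)"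
    and ie: "(\<integral>x. indicator {x. q \<le> \<bar>x\<bar>} x \<partial>S) = measure S {x. q \<le> \<bar>x\<bar>}"
    by (simp_all only: has_bochner_integral_iff)
  have "(\<integral>x. g (d + x) \<partial>S) - g 0 - m * d = (\<integral>x. g (d + x) - (g 0 + m * d) \<partial>S)"
    using gi prob_space by (subst Bochner_Integration.integral_diff) auto
  also have "\<bar>\<dots>\<bar> \<le> (\<integral>x. \<bar>g (d + x) - (g 0 + m * d)\<bar> \<partial>S)" by (rule integral_abs_bound)
  also have "\<dots> \<le> (\<integral>x. e * (\<bar>d\<bar> + \<bar>x\<bar>) + m * \<bar>x\<bar> + L * indicator {x. q \<le> \<bar>x\<bar>} x \<partial>S)"
  proof (rule integral_mono)
    fix x
    have ex: "0 \<le> e * (\<bar>d\<bar> + \<bar>x\<bar>)" "0 \<le> m * \<bar>x\<bar>" using e m by auto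
    show "\<bar>g (d + x) - (g 0 + m * d)\<bar> \<le> e * (\<bar>d\<bar> + \<bar>x\<bar>) + m * \<bar>x\<bar> + L * indicator {x. q \<le> \<bar>x\<bar>} x"
    proof (cases "\<bar>d + x\<bar> \<le> r")
      case True
      have "\<bar>g (d + x) - g 0 - m * (d + x)\<bar> \<le> e * \<bar>d + x\<bar>" by (rule lin[OF True])
      also have "\<dots> \<le> e * (\<bar>d\<bar> + \<bar>x\<bar>)" using e by (intro mult_left_mono) auto
      finally have 1: "\<bar>g (d + x) - g 0 - m * (d + x)\<bar> \<le> e * (\<bar>d\<bar> + \<bar>x\<bar>)" .
      have 2: "\<bar>m * x\<bar> = m * \<bar>x\<bar>" using m by (simp add: abs_mult)
      have 3: "0 \<le> L * indicator {x. q \<le> \<bar>x\<bar>} x" using L by simp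
      show ?thesis using 1 2 3 by (simp add: algebra_simps) linarith
    next
      case False
      then have x: "r / 2 \<le> \<bar>x\<bar>" using d by linarith
      then have i: "indicator {x. q \<le> \<bar>x\<bar>} x = (1::real)" using q by simp
      have "\<bar>m * d\<bar> \<le> m * \<bar>x\<bar>" unfolding abs_mult using m d x by (auto intro!: mult_left_mono)
      moreover have "\<bar>g (d + x) - g 0\<bar> \<le> L" using bd[of "d + x"] bd[of 0] by linarith
      ultimately show ?thesis using ex unfolding i by linarith
    qed
  qed (use gi int ii in auto)
  also have "\<dots> = e * (\<bar>d\<bar> + (\<integral>x. \<bar>x\<bar> \<partial>S)) + m * (\<integral>x. \<bar>x\<bar> \<partial>S) + L * measure S {x. q \<le> \<bar>x\<bar>}"
    using int ii ie prob_space by simp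
  finally show ?thesis .
qed

text \<open>The argument is Markov's inequality under the integral sign: where
  \<open>\<bar>d t + x\<bar> \<ge> \<delta>\<close>, the bound \<open>L\<close> is at most
  \<open>L / \<delta> * (\<bar>d t\<bar> + \<bar>x\<bar>)\<close>, whose mean tends to 0.\<close>

lemma isCont_expectation_tendsto:
  fixes S :: "real \<Rightarrow> real measure" and q :: "real \<Rightarrow> real"
  assumes S: "\<forall>\<^sub>F t in at_right 0. real_distribution (S t) \<and> integrable (S t) (\<lambda>x. \<bar>x\<bar>)"
    and lim: "((\<lambda>t. \<integral>x. \<bar>x\<bar> \<partial>S t) \<longlongrightarrow> 0) (at_right 0)" and d: "(d \<longlongrightarrow> 0) (at_right 0)"
    and q[measurable]: "q \<in> borel_measurable borel" and bd: "\<And>z. 0 \<le> q z \<and> q z \<le> L" and cont: "isCont q 0"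
  shows "((\<lambda>t. \<integral>x. q (d t + x) \<partial>S t) \<longlongrightarrow> q 0) (at_right 0)"
proof (rule tendstoI)
  fix e :: real assume e: "0 < e"
  have L: "0 \<le> L" using bd[of 0] by linarith
  obtain \<delta> where \<delta>: "0 < \<delta>" "\<And>z. \<bar>z\<bar> < \<delta> \<Longrightarrow> \<bar>q z - q 0\<bar> < e / 2"
    using cont e unfolding continuous_at_eps_delta by (metis dist_real_def diff_0_right half_gt_zero)
  have "((\<lambda>t. e / 2 + L / \<delta> * (\<bar>d t\<bar> + (\<integral>x. \<bar>x\<bar> \<partial>S t))) \<longlongrightarrow> e / 2 + L / \<delta> * (\<bar>0\<bar> + 0)) (at_right 0)"
    by (intro tendsto_intros lim d)
  then have "\<forall>\<^sub>F t in at_right 0. e / 2 + L / \<delta> * (\<bar>d t\<bar> + (\<integral>x. \<bar>x\<bar> \<partial>S t)) < e"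
    by (rule order_tendstoD(2)) (use e in simp)
  then show "\<forall>\<^sub>F t in at_right 0. dist (\<integral>x. q (d t + x) \<partial>S t) (q 0) < e"
    using S
  proof eventually_elim
    case (elim t)
    interpret real_distribution "S t" using elim by simp
    have int: "integrable (S t) (\<lambda>x. \<bar>x\<bar>)" using elim by simp
    have qi: "integrable (S t) (\<lambda>x. q (d t + x))"
      by (rule integrable_const_bound[where B=L]) (use bd in auto)
    have "(\<integral>x. q (d t + x) \<partial>S t) - q 0 = (\<integral>x. q (d t + x) - q 0 \<partial>S t)"
      using qi prob_space by (subst Bochner_Integration.integral_diff) auto
    also have "\<bar>\<dots>\<bar> \<le> (\<integral>x. \<bar>q (d t + x) - q 0\<bar> \<partial>S t)" by (rule integral_abs_bound)
    also have "\<dots> \<le> (\<integral>x. e / 2 + L / \<delta> * (\<bar>d t\<bar> + \<bar>x\<bar>) \<partial>S t)"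
    proof (rule integral_mono)
      fix x
      have p: "0 \<le> L / \<delta> * (\<bar>d t\<bar> + \<bar>x\<bar>)" using L \<delta> by simp
      show "\<bar>q (d t + x) - q 0\<bar> \<le> e / 2 + L / \<delta> * (\<bar>d t\<bar> + \<bar>x\<bar>)"
      proof (cases "\<bar>d t + x\<bar> < \<delta>")
        case True
        then show ?thesis using \<delta>(2)[OF True] p by linarith
      next
        case False
        then have "1 \<le> (\<bar>d t\<bar> + \<bar>x\<bar>) / \<delta>" using \<delta> by (simp add: field_simps)
        then have "L * 1 \<le> L * ((\<bar>d t\<bar> + \<bar>x\<bar>) / \<delta>)" using L by (rule mult_left_mono)
        moreover have "\<bar>q (d t + x) - q 0\<bar> \<le> L" using bd[of "d t + x"] bd[of 0] by linarith
        ultimately show ?thesis using e by simp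
      qed
    qed (use qi int in auto)
    also have "\<dots> = e / 2 + L / \<delta> * (\<bar>d t\<bar> + (\<integral>x. \<bar>x\<bar> \<partial>S t))"
      using int prob_space by simp
    finally show ?case using elim by (simp add: dist_real_def)
  qed
qed

section \<open>The second-order estimate at a fixed threshold\<close>

text \<open>At fixed \<eta> the small jumps leave an error proportional to \<open>k\<close>, their
  first moment under \<nu>, which no small time removes. The number \<open>e\<close> measures how
  far the tail is from linear near 0, and \<open>\<delta>\<close> absorbs everything that vanishes
  with \<open>t\<close>.\<close>

lemma levy_second_order_estimate:
  fixes s :: "real \<Rightarrow> real" and \<eta> :: real
  assumes X: "levy_process_with_triplet M X 0 b \<nu>" and s[measurable]: "s \<in> borel_measurable borel"
    and nn: "\<And>x. 0 \<le> s x" and \<nu>: "\<nu> = density lborel (\<lambda>x. ennreal (s x))"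
    and fv: "integrable \<nu> (\<lambda>x. min 1 \<bar>x\<bar>)" and \<eta>: "0 < \<eta>" "\<eta> \<le> 1" "6 * \<eta> \<le> y" "6 * \<eta> \<le> r"
  defines "f \<equiv> \<lambda>x. indicator (- {-\<eta>..\<eta>}) x * s x"
    and "b\<^sub>0 \<equiv> b - (\<integral>x. indicator {-1..1} x * x \<partial>\<nu>)"
    and "k \<equiv> \<integral>x. indicator {-\<eta>..\<eta>} x * \<bar>x\<bar> \<partial>\<nu>"
  defines "L \<equiv> \<integral>x. f x \<partial>lborel"
  assumes lin: "\<And>z. \<bar>z\<bar> \<le> r \<Longrightarrow> \<bar>tail_conv f y z - tail_conv f y 0 - m * z\<bar> \<le> e * \<bar>z\<bar>"
    and m: "0 \<le> m" and e: "0 \<le> e" and \<delta>: "0 < \<delta>"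
  shows "\<forall>\<^sub>F t in at_right 0. \<bar>1 / t * (1 / t * measure M {\<omega> \<in> space M. X t \<omega> \<ge> y} - tail_conv f y 0)
    - (b\<^sub>0 * m + tail_conv2 f y 0 / 2 - L * tail_conv f y 0)\<bar> \<le> e * (\<bar>b\<^sub>0\<bar> + 4 * k) + 4 * m * k + \<delta>"
proof -
  have [measurable]: "f \<in> borel_measurable borel" unfolding f_def by measurable
  have fint: "integrable lborel f"
    using fv nn \<eta> unfolding \<nu>
    by (intro integrable_away_zero[of s f \<eta>]) (auto simp: f_def integrable_density split: split_indicator)
  have fnn: "0 \<le> f x" for x using nn by (simp add: f_def)
  have L: "0 \<le> L" unfolding L_def using fnn by simp
  have k: "0 \<le> k" unfolding k_def by simp
  let ?P = "\<lambda>t. measure M {\<omega> \<in> space M. X t \<omega> \<ge> y}"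
  let ?C = "exp (k / \<eta>)"
  \<comment> \<open>The small-jump laws are supplied separately for each time; a choice gives a
    family along which \<open>t\<close> can tend to 0.\<close>
  have "\<exists>S. \<forall>t. 0 \<le> t \<longrightarrow> real_distribution (S t) \<and>
    (\<forall>a\<ge>0. (\<integral>\<^sup>+x. ennreal (exp (a * \<bar>x\<bar>)) \<partial>S t) \<le> ennreal (exp ((exp (a * \<eta>) - 1) / \<eta> * (t * k)))) \<and>
    \<bar>?P t - exp (- (L * t)) * (measure (S t) {x. y \<le> b\<^sub>0 * t + x}
      + t * (\<integral>x. tail_conv f y (b\<^sub>0 * t + x) \<partial>S t) + t\<^sup>2 / 2 * (\<integral>x. tail_conv2 f y (b\<^sub>0 * t + x) \<partial>S t))\<bar>
      \<le> (L * t) ^ 3"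
  proof (rule choice, rule allI)
    fix t :: real
    show "\<exists>S. 0 \<le> t \<longrightarrow> real_distribution S \<and>
      (\<forall>a\<ge>0. (\<integral>\<^sup>+x. ennreal (exp (a * \<bar>x\<bar>)) \<partial>S) \<le> ennreal (exp ((exp (a * \<eta>) - 1) / \<eta> * (t * k)))) \<and>
      \<bar>?P t - exp (- (L * t)) * (measure S {x. y \<le> b\<^sub>0 * t + x}
        + t * (\<integral>x. tail_conv f y (b\<^sub>0 * t + x) \<partial>S) + t\<^sup>2 / 2 * (\<integral>x. tail_conv2 f y (b\<^sub>0 * t + x) \<partial>S))\<bar>
        \<le> (L * t) ^ 3"
    proof (cases "0 \<le> t")
      case True
      show ?thesis unfolding L_def b\<^sub>0_def k_def f_def
        by (rule levy_tail_expansion[OF X s nn \<nu> fv True \<eta>(1,2), of y]) blast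
    qed simp
  qed
  then obtain S where S0: "\<forall>t. 0 \<le> t \<longrightarrow> real_distribution (S t) \<and>
    (\<forall>a\<ge>0. (\<integral>\<^sup>+x. ennreal (exp (a * \<bar>x\<bar>)) \<partial>S t) \<le> ennreal (exp ((exp (a * \<eta>) - 1) / \<eta> * (t * k)))) \<and>
    \<bar>?P t - exp (- (L * t)) * (measure (S t) {x. y \<le> b\<^sub>0 * t + x}
      + t * (\<integral>x. tail_conv f y (b\<^sub>0 * t + x) \<partial>S t) + t\<^sup>2 / 2 * (\<integral>x. tail_conv2 f y (b\<^sub>0 * t + x) \<partial>S t))\<bar>
      \<le> (L * t) ^ 3" ..
  define G where "G t = (\<integral>x. tail_conv f y (b\<^sub>0 * t + x) \<partial>S t)" for t
  define Q where "Q t = (\<integral>x. tail_conv2 f y (b\<^sub>0 * t + x) \<partial>S t)" for t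
  define p where "p t = measure (S t) {x. y \<le> b\<^sub>0 * t + x}" for t
  have S: "real_distribution (S t)" and mgf: "\<And>a. 0 \<le> a \<Longrightarrow>
      (\<integral>\<^sup>+x. ennreal (exp (a * \<bar>x\<bar>)) \<partial>S t) \<le> ennreal (exp ((exp (a * \<eta>) - 1) / \<eta> * (t * k)))"
    and R: "\<bar>?P t - exp (- (L * t)) * (p t + t * G t + t\<^sup>2 / 2 * Q t)\<bar> \<le> (L * t) ^ 3" if "0 \<le> t" for t
    using S0[THEN spec, of t] that unfolding G_def Q_def p_def by auto
  have t1: "\<forall>\<^sub>F t in at_right (0::real). 0 < t \<and> t < 1"
    by (auto simp: eventually_at_right_field intro!: exI[of _ 1])
  have small: "integrable (S t) (\<lambda>x. \<bar>x\<bar>)" "(\<integral>x. \<bar>x\<bar> \<partial>S t) \<le> exp (2 * k * t) - 1"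
    "measure (S t) {x. 3 * \<eta> \<le> \<bar>x\<bar>} \<le> t ^ 3 * ?C" if "0 < t" "t < 1" for t
    using that by (auto intro!: small_jumps_integrable[OF S \<eta>(1,2) _ _ k mgf] small_jumps_moment[OF S \<eta>(1,2) _ _ k mgf]
      small_jumps_tail[OF S \<eta>(1,2) _ _ k mgf])
  have Elim: "((\<lambda>t. \<integral>x. \<bar>x\<bar> \<partial>S t) \<longlongrightarrow> 0) (at_right 0)"
  proof (rule tendsto_sandwich[of "\<lambda>_. 0" _ _ "\<lambda>t. exp (2 * k * t) - 1"])
    show "\<forall>\<^sub>F t in at_right 0. (\<integral>x. \<bar>x\<bar> \<partial>S t) \<le> exp (2 * k * t) - 1"
      using t1 by eventually_elim (simp add: small)
    show "((\<lambda>t. exp (2 * k * t) - 1) \<longlongrightarrow> 0) (at_right 0)"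
      by (auto intro!: tendsto_eq_intros)
  qed auto
  have Qlim: "(Q \<longlongrightarrow> tail_conv2 f y 0) (at_right 0)"
    unfolding Q_def
  proof (rule isCont_expectation_tendsto[OF _ Elim])
    show "\<forall>\<^sub>F t in at_right 0. real_distribution (S t) \<and> integrable (S t) (\<lambda>x. \<bar>x\<bar>)"
      using t1 by eventually_elim (simp add: small S)
    show "((\<lambda>t. b\<^sub>0 * t) \<longlongrightarrow> 0) (at_right 0)" by (auto intro!: tendsto_eq_intros)
    show "isCont (tail_conv2 f y) 0" by (rule isCont_tail_conv2[OF fint fnn])
    show "0 \<le> tail_conv2 f y z \<and> tail_conv2 f y z \<le> L\<^sup>2" for z
      unfolding L_def using tail_conv2_nonneg[OF fint fnn] tail_conv2_le[OF fint fnn] by blast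
  qed measurable
  \<comment> \<open>The derivative of the probability of no large jump produces
    \<open>- L * tail_conv f y 0\<close>, since this probability multiplies the leading one-jump
    term.\<close>
  have explim: "((\<lambda>t. (exp (- (L * t)) - 1) / t + L) \<longlongrightarrow> 0) (at_right 0)"
  proof -
    have "((\<lambda>t. exp (- (L * t))) has_real_derivative - L) (at 0)"
      by (auto intro!: derivative_eq_intros)
    then have "((\<lambda>t. (exp (- (L * t)) - 1) / t) \<longlongrightarrow> - L) (at 0)"
      by (simp add: has_field_derivative_iff)
    then have "((\<lambda>t. (exp (- (L * t)) - 1) / t) \<longlongrightarrow> - L) (at_right 0)"
      by (rule filterlim_mono) (auto simp: at_within_le_at)
    from tendsto_add[OF this tendsto_const[of L]] show ?thesis by simp
  qed
  \<comment> \<open>Collects, after division by \<open>t\<^sup>2\<close>, all errors that vanish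
    with \<open>t\<close> while \<eta> stays fixed.\<close>
  define h where "h t = t * ?C + L * t\<^sup>2 * ?C + \<bar>((exp (- (L * t)) - 1) / t + L) * tail_conv f y 0\<bar>
    + \<bar>(exp (- (L * t)) - 1) * (b\<^sub>0 * m)\<bar> + \<bar>exp (- (L * t)) * Q t - tail_conv2 f y 0\<bar> / 2 + L ^ 3 * t" for t
  have el: "((\<lambda>t. exp (- (L * t))) \<longlongrightarrow> 1) (at_right 0)"
    by (auto intro!: tendsto_eq_intros)
  have "(h \<longlongrightarrow> 0 * ?C + L * 0\<^sup>2 * ?C + \<bar>0 * tail_conv f y 0\<bar>
    + \<bar>(1 - 1) * (b\<^sub>0 * m)\<bar> + \<bar>1 * tail_conv2 f y 0 - tail_conv2 f y 0\<bar> / 2 + L ^ 3 * 0) (at_right 0)"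
    unfolding h_def by (intro tendsto_intros explim el Qlim) auto
  then have "(h \<longlongrightarrow> 0) (at_right 0)" by simp
  then have hsmall: "\<forall>\<^sub>F t in at_right 0. h t < \<delta>" by (rule order_tendstoD(2)[OF _ \<delta>])
  have k1: "\<forall>\<^sub>F t in at_right 0. 2 * k * t < 1"
    by (rule order_tendstoD(2)[of _ 0]) (auto intro!: tendsto_eq_intros)
  \<comment> \<open>The room \<open>6 * \<eta>\<close> below \<open>y\<close> and \<open>r\<close>
    is shared evenly: a drift below \<open>3 * \<eta>\<close> leaves at least
    \<open>3 * \<eta>\<close> for the small jumps to cover.\<close>
  have d1: "\<forall>\<^sub>F t in at_right 0. \<bar>b\<^sub>0 * t\<bar> < 3 * \<eta>"
    by (rule order_tendstoD(2)[of _ 0]) (use \<eta> in \<open>auto intro!: tendsto_eq_intros\<close>)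
  show ?thesis using t1 hsmall k1 d1
  proof eventually_elim
    case (elim t)
    define x where "x = exp (- (L * t))"
    have t: "0 < t" "t < 1" and x: "0 < x" "x \<le> 1" using elim L by (auto simp: x_def)
    define E where "E = (\<integral>x. \<bar>x\<bar> \<partial>S t)"
    interpret S: real_distribution "S t" using S t by simp
    have E: "0 \<le> E" "E \<le> 4 * k * t"
    proof -
      \<comment> \<open>With \<open>u = 2 * k * t < 1\<close>,
        \<open>exp u - 1 \<le> u + u\<^sup>2 \<le> 2 * u\<close>; this is the origin of the
        4.\<close>
      have "exp (2 * k * t) \<le> 1 + 2 * k * t + (2 * k * t)\<^sup>2"
        using k t elim by (intro exp_bound) auto
      also have "(2 * k * t)\<^sup>2 \<le> 2 * k * t"
      proof -
        have "(2 * k * t) * (2 * k * t) \<le> 1 * (2 * k * t)" by (rule mult_right_mono) (use k t elim in auto)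
        then show ?thesis by (simp add: power2_eq_square)
      qed
      finally show "E \<le> 4 * k * t" using small(2)[OF t] by (simp add: E_def)
    qed (simp add: E_def)
    have tail: "measure (S t) {x. 3 * \<eta> \<le> \<bar>x\<bar>} \<le> t ^ 3 * ?C" by (rule small(3)[OF t])
    have pt: "0 \<le> p t" "p t \<le> t ^ 3 * ?C"
    proof -
      have "p t \<le> measure (S t) {x. 3 * \<eta> \<le> \<bar>x\<bar>}"
        unfolding p_def using elim \<eta> by (intro S.finite_measure_mono) auto
      then show "p t \<le> t ^ 3 * ?C" using tail by simp
    qed (simp add: p_def)
    have "\<bar>G t - tail_conv f y 0 - m * (b\<^sub>0 * t)\<bar>
        \<le> e * (\<bar>b\<^sub>0 * t\<bar> + E) + m * E + L * measure (S t) {x. 3 * \<eta> \<le> \<bar>x\<bar>}"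
      unfolding G_def E_def
    proof (rule linear_approximation_expectation[where r=r, OF _ _ _ _ lin m e])
      show "0 \<le> tail_conv f y z \<and> tail_conv f y z \<le> L" for z
        unfolding L_def using tail_conv_nonneg[OF fint fnn] tail_conv_le[OF fint fnn] by blast
      show "real_distribution (S t)" "integrable (S t) (\<lambda>x. \<bar>x\<bar>)" using S small(1) t by auto
    qed (use elim \<eta> in auto)
    also have "\<dots> \<le> e * (\<bar>b\<^sub>0\<bar> * t + 4 * k * t) + m * (4 * k * t) + L * (t ^ 3 * ?C)"
      using E e m L tail t by (intro add_mono mult_left_mono) (auto simp: abs_mult)
    also have "\<dots> = t * (e * (\<bar>b\<^sub>0\<bar> + 4 * k) + 4 * m * k + L * t\<^sup>2 * ?C)"
      by (simp add: algebra_simps power2_eq_square power3_eq_cube)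
    finally have "\<bar>G t - tail_conv f y 0 - m * (b\<^sub>0 * t)\<bar> / t \<le> e * (\<bar>b\<^sub>0\<bar> + 4 * k) + 4 * m * k + L * t\<^sup>2 * ?C"
      using t by (simp add: field_simps)
    moreover have "\<bar>x * ((G t - tail_conv f y 0 - m * (b\<^sub>0 * t)) / t)\<bar> \<le> \<bar>G t - tail_conv f y 0 - m * (b\<^sub>0 * t)\<bar> / t"
    proof -
      have "x * \<bar>G t - tail_conv f y 0 - m * (b\<^sub>0 * t)\<bar> \<le> 1 * \<bar>G t - tail_conv f y 0 - m * (b\<^sub>0 * t)\<bar>"
        using x by (intro mult_right_mono) auto
      from divide_right_mono[OF this, of t] show ?thesis using x t by (simp add: abs_mult)
    qed
    ultimately have B1: "\<bar>x * ((G t - tail_conv f y 0 - m * (b\<^sub>0 * t)) / t)\<bar>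
        \<le> e * (\<bar>b\<^sub>0\<bar> + 4 * k) + 4 * m * k + L * t\<^sup>2 * ?C" by linarith
    have "x * p t \<le> t ^ 3 * ?C" using pt x by (meson mult_left_le_one_le less_imp_le order_trans)
    then have B2: "\<bar>x * p t / t\<^sup>2\<bar> \<le> t * ?C"
      using t x pt by (simp add: field_simps power2_eq_square power3_eq_cube)
    have B3: "\<bar>(?P t - x * (p t + t * G t + t\<^sup>2 / 2 * Q t)) / t\<^sup>2\<bar> \<le> L ^ 3 * t"
      using R[of t] t by (simp add: x_def field_simps power2_eq_square power3_eq_cube)
    \<comment> \<open>The summands are, in order: the remainder for three or more large jumps, no
      large jump, the one-jump term beyond its drift part, the damping of its leading part by
      \<open>x\<close>, the damping of its drift part, and the two-jump term.\<close>
    have "1 / t * (1 / t * ?P t - tail_conv f y 0) - (b\<^sub>0 * m + tail_conv2 f y 0 / 2 - L * tail_conv f y 0)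
      = (?P t - x * (p t + t * G t + t\<^sup>2 / 2 * Q t)) / t\<^sup>2 + x * p t / t\<^sup>2
        + x * ((G t - tail_conv f y 0 - m * (b\<^sub>0 * t)) / t) + ((x - 1) / t + L) * tail_conv f y 0
        + (x - 1) * (b\<^sub>0 * m) + (x * Q t - tail_conv2 f y 0) / 2"
      using t by (simp add: field_simps power2_eq_square)
    moreover have "\<bar>a1 + a2 + a3 + a4 + a5 + a6\<bar> \<le> e0 + \<delta>"
      if "\<bar>a1\<bar> \<le> v" "\<bar>a2\<bar> \<le> w" "\<bar>a3\<bar> \<le> e0 + z" "w + z + \<bar>a4\<bar> + \<bar>a5\<bar> + \<bar>a6\<bar> + v < \<delta>"
      for a1 a2 a3 a4 a5 a6 e0 v w z :: real using that by linarith
    note this[OF B3 B2 B1, of "((x - 1) / t + L) * tail_conv f y 0" "(x - 1) * (b\<^sub>0 * m)"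
      "(x * Q t - tail_conv2 f y 0) / 2"]
    moreover have "t * ?C + L * t\<^sup>2 * ?C + \<bar>((x - 1) / t + L) * tail_conv f y 0\<bar>
      + \<bar>(x - 1) * (b\<^sub>0 * m)\<bar> + \<bar>(x * Q t - tail_conv2 f y 0) / 2\<bar> + L ^ 3 * t < \<delta>"
      using elim(2) by (simp add: h_def x_def)
    ultimately show ?case by (simp only:)
  qed
qed

text \<open>Replacing a truncation function \<open>c\<close> by the hard truncation at a level below which \<open>c = 1\<close>
  moves the term linear in the small jumps into the quadratic one.\<close>

lemma hard_truncation_change:
  fixes s c :: "real \<Rightarrow> real"
  assumes s[measurable]: "s \<in> borel_measurable borel" and nn: "\<And>x. 0 \<le> s x"
    and int: "integrable lborel (\<lambda>x. s x * min 1 \<bar>x\<bar>)" and c[measurable]: "c \<in> borel_measurable borel"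
    and c01: "\<And>x. 0 \<le> c x" "\<And>x. c x \<le> 1"
    and c1: "\<And>x. \<bar>x\<bar> \<le> \<eta> \<Longrightarrow> c x = 1" and c0: "\<And>x. \<epsilon> < \<bar>x\<bar> \<Longrightarrow> c x = 0"
    and \<eta>: "0 < \<eta>" "\<eta> \<le> \<epsilon>" and \<epsilon>: "\<epsilon> \<le> 1" "2 * \<epsilon> < y"
    and B: "\<And>u. y - \<epsilon> \<le> u \<Longrightarrow> s u \<le> B"
  defines "f \<equiv> \<lambda>x. indicator (- {-\<eta>..\<eta>}) x * s x" and "g \<equiv> \<lambda>x. (1 - c x) * s x"
  shows "\<bar>(tail_conv2 f y 0 / 2 - (\<integral>x. f x \<partial>lborel) * tail_conv f y 0)
    - ((\<integral>x. (LBINT u=0..ereal x. s (y - u)) * (c x * s x) \<partial>lborel) + tail_conv2 g y 0 / 2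
      - (\<integral>x. g x \<partial>lborel) * tail_conv f y 0)\<bar> \<le> B * (\<integral>x. indicator {-\<eta>..\<eta>} x * \<bar>x\<bar> * s x \<partial>lborel)"
proof -
  have [measurable]: "f \<in> borel_measurable borel" "g \<in> borel_measurable borel"
    unfolding f_def g_def by measurable
  \<comment> \<open>The jumps on which the two truncations disagree: those that the hard threshold
    counts as large and \<open>c\<close> counts, with weight, as small.\<close>
  define r where "r x = (c x - indicator {-\<eta>..\<eta>} x) * s x" for x
  have [measurable]: "r \<in> borel_measurable borel" unfolding r_def by measurable
  have cle: "c x * s x \<le> s x" for x using c01(2)[of x] nn[of x] by (simp add: mult_left_le_one_le c01 mult_left_le)
  have gnn: "0 \<le> g x" for x using c01 nn by (simp add: g_def)
  have rnn: "0 \<le> r x" for x using c01[of x] c1[of x] nn[of x] by (auto simp: r_def split: split_indicator)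
  have g: "integrable lborel g"
    using int gnn \<eta> \<epsilon> c1 c01 nn by (intro integrable_away_zero[of s g \<eta>]) (auto simp: g_def mult_left_le_one_le)
  have r: "integrable lborel r"
    using int rnn \<eta> \<epsilon> c1 c01 nn cle
    by (intro integrable_away_zero[of s r \<eta>]) (auto simp: r_def split: split_indicator)
  have fgr: "f = (\<lambda>x. g x + r x)"
    by (rule ext) (auto simp: f_def g_def r_def algebra_simps split: split_indicator)
  have r0: "r x = 0" if "\<epsilon> < \<bar>x\<bar>" for x
    using that \<eta> c0 by (auto simp: r_def split: split_indicator)
  have gs: "g u = s u" if "y - \<epsilon> \<le> u" for u
    using that c0[of u] \<epsilon> by (simp add: g_def)
  \<comment> \<open>A single jump from \<open>r\<close> has size at most
    \<open>\<epsilon> < y\<close> and cannot reach \<open>y\<close>.\<close>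
  have tf0: "tail_conv f y 0 = tail_conv g y 0"
  proof -
    have "indicator {y..} (0 + u) * r u = 0" for u using \<epsilon> \<eta> r0[of u] by (auto split: split_indicator)
    then have "tail_conv r y 0 = 0" unfolding tail_conv_def by (simp only: integral_zero)
    then show ?thesis unfolding fgr tail_conv_add[OF g r] by simp
  qed
  let ?W = "\<lambda>x. tail_conv g y x - tail_conv g y 0"
  \<comment> \<open>For these \<open>x\<close> the increment involves only jumps of size at least
    \<open>y - \<epsilon> > \<epsilon>\<close>, where \<open>g\<close> and \<open>s\<close>
    coincide.\<close>
  have W: "?W x = (LBINT u=0..ereal x. s (y - u))" if "\<bar>x\<bar> \<le> \<epsilon>" for x
    by (rule tail_conv_diff_interval_integral[OF g s gs that])
  have Wle: "\<bar>?W x\<bar> \<le> B * \<bar>x\<bar>" if "\<bar>x\<bar> \<le> \<epsilon>" for x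
  proof -
    have "\<bar>g u - 0\<bar> \<le> B" if "\<bar>u - y\<bar> \<le> \<bar>x\<bar>" for u
    proof -
      have "y - \<epsilon> \<le> u" using that \<open>\<bar>x\<bar> \<le> \<epsilon>\<close> by linarith
      then show ?thesis using gs B nn by simp
    qed
    from tail_conv_diff_bound[OF g this] show ?thesis by simp
  qed
  have small: "integrable lborel (\<lambda>x. indicator {-\<eta>..\<eta>} x * \<bar>x\<bar> * s x)"
    by (rule Bochner_Integration.integrable_bound[OF int])
      (use \<eta> \<epsilon> nn in \<open>auto simp: abs_mult split: split_indicator\<close>)
  have B0: "0 \<le> B" using B[of y] nn[of y] \<eta> by simp
  have Wr: "integrable lborel (\<lambda>x. ?W x * r x)"
  proof (rule Bochner_Integration.integrable_bound)
    show "integrable lborel (\<lambda>x. B * \<epsilon> * r x)" using r by simp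
    show "AE x in lborel. norm (?W x * r x) \<le> norm (B * \<epsilon> * r x)"
    proof (rule AE_I2)
      fix x
      show "norm (?W x * r x) \<le> norm (B * \<epsilon> * r x)"
      proof (cases "\<bar>x\<bar> \<le> \<epsilon>")
        case True
        have "\<bar>?W x\<bar> \<le> B * \<epsilon>" using Wle[OF True] mult_left_mono[OF True B0] by linarith
        then have "\<bar>?W x\<bar> * r x \<le> (B * \<epsilon>) * r x" using rnn by (rule mult_right_mono)
        then show ?thesis using rnn B0 \<eta> by (simp add: abs_mult)
      qed (simp add: r0)
    qed
  qed measurable
  have bound: "\<bar>?W x * (indicator {-\<eta>..\<eta>} x * s x)\<bar> \<le> B * (indicator {-\<eta>..\<eta>} x * \<bar>x\<bar> * s x)" for x
  proof (cases "x \<in> {-\<eta>..\<eta>}")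
    case True
    then have "\<bar>?W x\<bar> \<le> B * \<bar>x\<bar>" using \<eta> by (intro Wle) auto
    then have "\<bar>?W x\<bar> * s x \<le> B * \<bar>x\<bar> * s x" using nn by (rule mult_right_mono)
    then show ?thesis using True nn by (simp add: abs_mult)
  qed simp
  have Ws: "integrable lborel (\<lambda>x. ?W x * (indicator {-\<eta>..\<eta>} x * s x))"
  proof (rule Bochner_Integration.integrable_bound)
    show "integrable lborel (\<lambda>x. B * (indicator {-\<eta>..\<eta>} x * \<bar>x\<bar> * s x))" using small by simp
    show "AE x in lborel. norm (?W x * (indicator {-\<eta>..\<eta>} x * s x)) \<le> norm (B * (indicator {-\<eta>..\<eta>} x * \<bar>x\<bar> * s x))"
    proof (rule AE_I2)
      show "norm (?W x * (indicator {-\<eta>..\<eta>} x * s x)) \<le> norm (B * (indicator {-\<eta>..\<eta>} x * \<bar>x\<bar> * s x))" for x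
        using bound[of x] unfolding real_norm_def by linarith
    qed
  qed measurable
  \<comment> \<open>The density \<open>c * s\<close> splits into \<open>r\<close> and the jumps
    within [-\<eta>, \<eta>]. The first part is also produced by the pairs of jumps under the hard
    threshold; the second is not and becomes the error.\<close>
  have "(\<integral>x. (LBINT u=0..ereal x. s (y - u)) * (c x * s x) \<partial>lborel)
      = (\<integral>x. ?W x * r x + ?W x * (indicator {-\<eta>..\<eta>} x * s x) \<partial>lborel)"
  proof (rule Bochner_Integration.integral_cong)
    fix x
    show "(LBINT u=0..ereal x. s (y - u)) * (c x * s x) = ?W x * r x + ?W x * (indicator {-\<eta>..\<eta>} x * s x)"
    proof (cases "\<bar>x\<bar> \<le> \<epsilon>")
      case True
      then show ?thesis unfolding W[OF True] by (simp add: r_def algebra_simps)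
    next
      case False
      then have "c x = 0" "r x = 0" "x \<notin> {-\<eta>..\<eta>}" using c0 r0 \<eta> by auto
      then show ?thesis by simp
    qed
  qed simp
  also have "\<dots> = (\<integral>x. ?W x * r x \<partial>lborel) + (\<integral>x. ?W x * (indicator {-\<eta>..\<eta>} x * s x) \<partial>lborel)"
    by (rule Bochner_Integration.integral_add[OF Wr Ws])
  finally have A: "(\<integral>x. (LBINT u=0..ereal x. s (y - u)) * (c x * s x) \<partial>lborel)
    = (\<integral>x. ?W x * r x \<partial>lborel) + (\<integral>x. ?W x * (indicator {-\<eta>..\<eta>} x * s x) \<partial>lborel)" .
  \<comment> \<open>Splitting off the value of the tail at 0 separates the wanted increments from a
    multiple of the mass of \<open>r\<close>, which cancels against the larger jump rate
    \<open>\<integral> f = \<integral> g + \<integral> r\<close> in the last term.\<close>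
  have "(\<integral>x. tail_conv g y x * r x \<partial>lborel) = (\<integral>x. ?W x * r x + tail_conv g y 0 * r x \<partial>lborel)"
    by (simp add: algebra_simps)
  also have "\<dots> = (\<integral>x. ?W x * r x \<partial>lborel) + tail_conv g y 0 * (\<integral>x. r x \<partial>lborel)"
    using Wr r by (subst Bochner_Integration.integral_add) auto
  finally have cross: "(\<integral>x. tail_conv g y x * r x \<partial>lborel)
      = (\<integral>x. ?W x * r x \<partial>lborel) + tail_conv g y 0 * (\<integral>x. r x \<partial>lborel)" .
  have "tail_conv2 f y 0 = tail_conv2 g y 0 + 2 * (\<integral>x. tail_conv g y x * r x \<partial>lborel)"
    unfolding fgr by (rule tail_conv2_add_small[OF g r gnn rnn r0 \<epsilon>(2)])
  then have "tail_conv2 f y 0 = tail_conv2 g y 0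
      + 2 * ((\<integral>x. ?W x * r x \<partial>lborel) + tail_conv g y 0 * (\<integral>x. r x \<partial>lborel))"
    unfolding cross .
  moreover have "(\<integral>x. f x \<partial>lborel) = (\<integral>x. g x \<partial>lborel) + (\<integral>x. r x \<partial>lborel)"
    unfolding fgr by (rule Bochner_Integration.integral_add[OF g r])
  ultimately have "(tail_conv2 f y 0 / 2 - (\<integral>x. f x \<partial>lborel) * tail_conv f y 0)
    - ((\<integral>x. (LBINT u=0..ereal x. s (y - u)) * (c x * s x) \<partial>lborel) + tail_conv2 g y 0 / 2
      - (\<integral>x. g x \<partial>lborel) * tail_conv f y 0) = - (\<integral>x. ?W x * (indicator {-\<eta>..\<eta>} x * s x) \<partial>lborel)"
    unfolding A tf0 by (simp add: algebra_simps)
  moreover have "\<bar>\<integral>x. ?W x * (indicator {-\<eta>..\<eta>} x * s x) \<partial>lborel\<bar>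
      \<le> B * (\<integral>x. indicator {-\<eta>..\<eta>} x * \<bar>x\<bar> * s x \<partial>lborel)"
  proof (rule order_trans[OF integral_abs_bound])
    have "(\<integral>x. \<bar>?W x * (indicator {-\<eta>..\<eta>} x * s x)\<bar> \<partial>lborel)
        \<le> (\<integral>x. B * (indicator {-\<eta>..\<eta>} x * \<bar>x\<bar> * s x) \<partial>lborel)"
      using Ws small bound by (intro integral_mono) auto
    then show "(\<integral>x. \<bar>?W x * (indicator {-\<eta>..\<eta>} x * s x)\<bar> \<partial>lborel)
        \<le> B * (\<integral>x. indicator {-\<eta>..\<eta>} x * \<bar>x\<bar> * s x \<partial>lborel)"
      by (simp only: integral_mult_right_zero)
  qed
  ultimately show ?thesis by (simp only: abs_minus_cancel)
qed

section \<open>Removing the threshold\<close>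

lemma truncation_functionD:
  assumes "truncation_function \<epsilon> c" "0 < \<epsilon>"
  shows "c \<in> borel_measurable borel" "0 \<le> c x" "c x \<le> 1"
    "\<bar>x\<bar> \<le> \<epsilon> / 2 \<Longrightarrow> c x = 1" "\<epsilon> < \<bar>x\<bar> \<Longrightarrow> c x = 0"
proof -
  have b: "indicator {-\<epsilon>/2..\<epsilon>/2} x \<le> c x" "c x \<le> indicator {-\<epsilon>..\<epsilon>} x" for x
    using assms by (auto simp: truncation_function_def)
  have "c differentiable_on UNIV"
    using assms(1) by (auto simp: truncation_function_def smooth_def dest: spec[of _ 0])
  then show "c \<in> borel_measurable borel"
    by (intro borel_measurable_continuous_onI differentiable_imp_continuous_on)
  show ge0: "0 \<le> c x" using b(1)[of x] by (rule order_trans[rotated]) simp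
  show le1: "c x \<le> 1" using b(2)[of x] by (rule order_trans) (simp add: indicator_def)
  show "c x = 1" if "\<bar>x\<bar> \<le> \<epsilon> / 2"
  proof -
    have "x \<in> {-\<epsilon>/2..\<epsilon>/2}" using that by (auto simp: abs_le_iff)
    then show ?thesis using b(1)[of x] le1 by simp
  qed
  show "c x = 0" if "\<epsilon> < \<bar>x\<bar>"
  proof -
    have "x \<notin> {-\<epsilon>..\<epsilon>}" using that by (auto simp: abs_le_iff)
    then show ?thesis using b(2)[of x] ge0 by simp
  qed
qed

theorem proposition3p5:
  fixes M :: "'a measure" and X :: "real \<Rightarrow> 'a \<Rightarrow> real"
    and \<sigma> b y \<epsilon> :: real and \<nu> :: "real measure" and s c :: "real \<Rightarrow> real"
  assumes "y > 0" and "0 < \<epsilon>" and "\<epsilon> < min (y / 2) 1"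
    and "truncation_function \<epsilon> c"
    and "levy_process_with_triplet M X (\<sigma>\<^sup>2) b \<nu>"
    and "s \<in> borel_measurable borel" and "\<And>x. 0 \<le> s x"
    and "\<nu> = density lborel (\<lambda>x. ennreal (s x))"
    and "bounded (s ` (- {-\<epsilon>..\<epsilon>}))"
    and "\<exists>U. open U \<and> y \<in> U \<and> continuous_on U s"
    and "\<sigma> = 0"
    and "(\<integral>\<^sup>+ x\<in>{x. \<bar>x\<bar> \<le> 1}. ennreal \<bar>x\<bar> \<partial>\<nu>) < \<infinity>"
  defines "b\<^sub>0 \<equiv> b - (LINT x:{x. \<bar>x\<bar> \<le> 1}|\<nu>. x)"
  shows "\<exists>d\<^sub>2 :: real.
    ((\<lambda>t. 1 / t * (1 / t * measure M {\<omega> \<in> space M. X t \<omega> \<ge> y} - measure \<nu> {y..}))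
       \<longlongrightarrow> d\<^sub>2 / 2) (at_right 0) \<and>
    d\<^sub>2 / 2 = b\<^sub>0 * s y
      + (\<integral>x. (LBINT u=0..x. s (y - u)) * small_part c s x \<partial>lborel)
      + 1 / 2 * (\<integral>x. (\<integral>u. indicator {y..} (x + u)
                          * large_part c s u * large_part c s x \<partial>lborel) \<partial>lborel)
      - large_mass c \<nu> * measure \<nu> {y..}"
proof -
  note y = assms(1) and \<epsilon> = assms(2,3) and s[measurable] = assms(6) and nn = assms(7) and \<nu> = assms(8)
  note c = truncation_functionD[OF assms(4) \<epsilon>(1)]
  note c(1)[measurable]
  have X: "levy_process_with_triplet M X 0 b \<nu>" using assms(5,11) by simp
  have sets\<nu>[measurable_cong]: "sets \<nu> = sets borel" by (simp add: \<nu>)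
  have dens: "(\<integral>x. h x \<partial>\<nu>) = (\<integral>x. s x * h x \<partial>lborel)"
    if [measurable]: "h \<in> borel_measurable borel" for h :: "real \<Rightarrow> real"
    unfolding \<nu> using nn by (simp add: integral_density)
  \<comment> \<open>The defining integral of a Levy measure controls the jumps beyond 1, the assumed
    first moment those up to 1.\<close>
  have fv: "integrable \<nu> (\<lambda>x. min 1 \<bar>x\<bar>)"
  proof (rule integrableI_bounded)
    have "(\<integral>\<^sup>+x. ennreal (norm (min 1 \<bar>x\<bar>)) \<partial>\<nu>)
        \<le> (\<integral>\<^sup>+x. ennreal (min 1 (x\<^sup>2)) + ennreal \<bar>x\<bar> * indicator {x. \<bar>x\<bar> \<le> 1} x \<partial>\<nu>)"
    proof (rule nn_integral_mono)
      fix x :: real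
      show "ennreal (norm (min 1 \<bar>x\<bar>)) \<le> ennreal (min 1 (x\<^sup>2)) + ennreal \<bar>x\<bar> * indicator {x. \<bar>x\<bar> \<le> 1} x"
      proof (cases "\<bar>x\<bar> \<le> 1")
        case False
        then have "1 \<le> x\<^sup>2" using one_le_power[of "\<bar>x\<bar>" 2] by simp
        then show ?thesis using False by simp
      qed (simp add: add_increasing)
    qed
    also have "\<dots> = (\<integral>\<^sup>+x. ennreal (min 1 (x\<^sup>2)) \<partial>\<nu>) + (\<integral>\<^sup>+x\<in>{x. \<bar>x\<bar> \<le> 1}. ennreal \<bar>x\<bar> \<partial>\<nu>)"
      by (rule nn_integral_add) measurable
    also have "\<dots> < \<infinity>"
      using X assms(12) by (simp add: levy_process_with_triplet_def levy_measure_def)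
    finally show "(\<integral>\<^sup>+x. ennreal (norm (min 1 \<bar>x\<bar>)) \<partial>\<nu>) < \<infinity>" .
  qed measurable
  then have fvs: "integrable lborel (\<lambda>x. s x * min 1 \<bar>x\<bar>)"
    unfolding \<nu> using nn by (simp add: integrable_density)
  have b0: "b\<^sub>0 = b - (\<integral>x. indicator {-1..1} x * x \<partial>\<nu>)"
  proof -
    have "(\<integral>x. indicator {x. \<bar>x\<bar> \<le> 1} x *\<^sub>R x \<partial>\<nu>) = (\<integral>x. indicator {-1..1} x * x \<partial>\<nu>)"
      by (rule Bochner_Integration.integral_cong) (auto split: split_indicator)
    then show ?thesis by (simp add: b\<^sub>0_def set_lebesgue_integral_def)
  qed
  \<comment> \<open>From \<open>\<epsilon> < y / 2\<close> the half-line starts at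
    \<open>y - \<epsilon> > \<epsilon>\<close>, inside the region where \<open>s\<close> is
    bounded.\<close>
  obtain B where B: "\<And>u. y - \<epsilon> \<le> u \<Longrightarrow> s u \<le> B"
  proof -
    obtain B where "\<forall>v\<in>s ` (- {-\<epsilon>..\<epsilon>}). norm v \<le> B" using assms(9) unfolding bounded_iff by blast
    then have B: "norm (s u) \<le> B" if "u \<in> - {-\<epsilon>..\<epsilon>}" for u using that by blast
    show thesis
    proof (rule that)
      fix u assume "y - \<epsilon> \<le> u"
      then have "u \<in> - {-\<epsilon>..\<epsilon>}" using \<epsilon> by auto
      from B[OF this] show "s u \<le> B" by simp
    qed
  qed
  define g where "g = large_part c s"
  have g_eq: "g = (\<lambda>x. (1 - c x) * s x)" by (rule ext) (simp add: g_def large_part_def)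
  define T where "T = measure \<nu> {y..}"
  define k where "k \<eta> = (\<integral>x. indicator {-\<eta>..\<eta>} x * \<bar>x\<bar> \<partial>\<nu>)" for \<eta> :: real
  define D where "D = b\<^sub>0 * s y + (\<integral>x. (LBINT u=0..ereal x. s (y - u)) * (c x * s x) \<partial>lborel)
    + tail_conv2 g y 0 / 2 - (\<integral>x. g x \<partial>lborel) * T"
  \<comment> \<open>Jumps of size at most \<open>\<eta> < y\<close> do not reach \<open>y\<close>,
    so the cut-off leaves the tail of \<nu> unchanged and one \<open>T\<close> serves every such
    threshold.\<close>
  have tail: "tail_conv (\<lambda>x. indicator (- {-\<eta>..\<eta>}) x * s x) y 0 = T" if "\<eta> < y" for \<eta>
  proof -
    have "T = (\<integral>x. indicator {y..} x \<partial>\<nu>)"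
      using sets_eq_imp_space_eq[OF sets\<nu>] by (simp add: T_def)
    also have "\<dots> = (\<integral>x. s x * indicator {y..} x \<partial>lborel)" by (rule dens) measurable
    also have "\<dots> = (\<integral>u. indicator {y..} (0 + u) * (indicator (- {-\<eta>..\<eta>}) u * s u) \<partial>lborel)"
      by (rule Bochner_Integration.integral_cong) (use that in \<open>auto split: split_indicator\<close>)
    finally show ?thesis by (simp add: tail_conv_def)
  qed
  \<comment> \<open>This is where finite variation removes the threshold: all errors that survive
    the limit in \<open>t\<close> are controlled by this moment or by the continuity of
    \<open>s\<close> at \<open>y\<close>.\<close>
  have klim: "(\<lambda>n. k (1 / real (Suc n))) \<longlonglongrightarrow> 0"
  proof -
    have "(\<lambda>n. k (1 / real (Suc n))) \<longlonglongrightarrow> (\<integral>x. 0 \<partial>\<nu>)"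
      unfolding k_def
    proof (rule integral_dominated_convergence[where w="\<lambda>x. min 1 \<bar>x\<bar>"])
      show "AE x in \<nu>. (\<lambda>n. indicator {- (1 / real (Suc n))..1 / real (Suc n)} x * \<bar>x\<bar>) \<longlonglongrightarrow> 0"
      proof (rule AE_I2)
        fix x :: real
        show "(\<lambda>n. indicator {- (1 / real (Suc n))..1 / real (Suc n)} x * \<bar>x\<bar>) \<longlonglongrightarrow> 0"
        proof (cases "x = 0")
          case False
          have "\<forall>\<^sub>F n in sequentially. 1 / real (Suc n) < \<bar>x\<bar>"
            using LIMSEQ_Suc[OF lim_1_over_n] by (rule order_tendstoD(2)) (use False in simp)
          then have "\<forall>\<^sub>F n in sequentially. indicator {- (1 / real (Suc n))..1 / real (Suc n)} x * \<bar>x\<bar> = 0"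
            by eventually_elim (auto simp: indicator_def)
          then show ?thesis by (rule tendsto_eventually)
        qed simp
      qed
      show "AE x in \<nu>. norm (indicator {- (1 / real (Suc n))..1 / real (Suc n)} x * \<bar>x\<bar>) \<le> min 1 \<bar>x\<bar>" for n
      proof (rule AE_I2)
        have "norm (indicator {-d..d} x * \<bar>x\<bar>) \<le> min 1 \<bar>x\<bar>" if "d \<le> 1" for d x :: real
          using that by (auto split: split_indicator)
        then show "norm (indicator {- (1 / real (Suc n))..1 / real (Suc n)} x * \<bar>x\<bar>) \<le> min 1 \<bar>x\<bar>" for x :: real
          by simp
      qed
    qed (use fv in auto)
    then show ?thesis by simp
  qed
  have lim: "((\<lambda>t. 1 / t * (1 / t * measure M {\<omega> \<in> space M. X t \<omega> \<ge> y} - T)) \<longlongrightarrow> D) (at_right 0)"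
  proof (rule tendstoI)
    fix e :: real assume e: "0 < e"
    \<comment> \<open>Chosen so that the linearization error
      \<open>e' * (\<bar>b\<^sub>0\<bar> + 4 * k \<eta>)\<close> is at most \<open>e / 4\<close>
      once \<open>k \<eta> < 1\<close>.\<close>
    define e' where "e' = e / (4 * (\<bar>b\<^sub>0\<bar> + 4))"
    have e': "0 < e'" "e' * (\<bar>b\<^sub>0\<bar> + 4) = e / 4" using e by (simp_all add: e'_def field_simps)
    \<comment> \<open>\<open>r < y - \<epsilon>\<close> keeps the continuity window beyond
      \<epsilon>, hence clear of [-\<eta>, \<eta>], where the cut-off acts.\<close>
    obtain r where r: "0 < r" "r < y - \<epsilon>" "\<And>u. \<bar>u - y\<bar> \<le> r \<Longrightarrow> \<bar>s u - s y\<bar> \<le> e'"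
    proof -
      obtain U where "open U" "y \<in> U" "continuous_on U s" using assms(10) by blast
      then have "isCont s y" by (simp add: continuous_on_eq_continuous_at)
      then obtain d where d: "0 < d" "\<And>u. dist u y < d \<Longrightarrow> dist (s u) (s y) < e'"
        using e' unfolding continuous_at_eps_delta by blast
      show thesis
      proof (rule that[of "min (d / 2) ((y - \<epsilon>) / 2)"])
        show "\<bar>s u - s y\<bar> \<le> e'" if "\<bar>u - y\<bar> \<le> min (d / 2) ((y - \<epsilon>) / 2)" for u
          using d(2)[of u] that d(1) by (simp add: dist_real_def)
        show "min (d / 2) ((y - \<epsilon>) / 2) < y - \<epsilon>"
          by (rule le_less_trans[OF min.cobounded2]) (use y \<epsilon> in simp)
      qed (use d y \<epsilon> in auto)
    qed
    \<comment> \<open>A threshold below \<open>\<epsilon> / 2\<close> makes \<open>c\<close> equal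
      to 1 on [-\<eta>, \<eta>]; the sixths provide the room that the fixed-threshold estimate asks
      for.\<close>
    have "\<forall>\<^sub>F n in sequentially. 1 / real (Suc n) < min (\<epsilon> / 2) (min (y / 6) (r / 6))"
      using LIMSEQ_Suc[OF lim_1_over_n] by (rule order_tendstoD(2)) (use \<epsilon> y r in simp)
    moreover have "\<forall>\<^sub>F n in sequentially. k (1 / real (Suc n)) < 1"
      using klim by (rule order_tendstoD(2)) simp
    \<comment> \<open>\<open>4 * s y\<close> stems from the one-jump error and \<open>B\<close> from
      the change of truncation; both multiply \<open>k \<eta>\<close>.\<close>
    moreover have "\<forall>\<^sub>F n in sequentially. (4 * s y + B) * k (1 / real (Suc n)) < e / 4"
      using tendsto_mult_left[OF klim, of "4 * s y + B"] by (rule order_tendstoD(2)) (use e in simp)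
    ultimately have "\<forall>\<^sub>F n in sequentially. 1 / real (Suc n) < min (\<epsilon> / 2) (min (y / 6) (r / 6)) \<and>
        k (1 / real (Suc n)) < 1 \<and> (4 * s y + B) * k (1 / real (Suc n)) < e / 4"
      by eventually_elim blast
    then obtain n where n: "1 / real (Suc n) < min (\<epsilon> / 2) (min (y / 6) (r / 6))"
        "k (1 / real (Suc n)) < 1" "(4 * s y + B) * k (1 / real (Suc n)) < e / 4"
      using eventually_happens'[OF sequentially_bot] by blast
    define \<eta> where "\<eta> = 1 / real (Suc n)"
    have \<eta>: "0 < \<eta>" "\<eta> < \<epsilon> / 2" "6 * \<eta> \<le> y" "6 * \<eta> \<le> r" and k1: "k \<eta> < 1" and k2: "(4 * s y + B) * k \<eta> < e / 4"
      using n by (auto simp: \<eta>_def simp del: of_nat_Suc)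
    have \<eta>1: "\<eta> \<le> 1" using \<eta> \<epsilon> by simp
    define f where "f x = indicator (- {-\<eta>..\<eta>}) x * s x" for x
    have [measurable]: "f \<in> borel_measurable borel" unfolding f_def by measurable
    have f: "integrable lborel f"
      using fvs nn \<eta> \<eta>1 by (intro integrable_away_zero[of s f \<eta>]) (auto simp: f_def split: split_indicator)
    have tf: "tail_conv f y 0 = T" using tail[of \<eta>] \<eta> y by (simp add: f_def[abs_def])
    have lin: "\<bar>tail_conv f y z - tail_conv f y 0 - s y * z\<bar> \<le> e' * \<bar>z\<bar>" if "\<bar>z\<bar> \<le> r" for z
    proof (rule tail_conv_diff_bound[OF f])
      fix u assume "\<bar>u - y\<bar> \<le> \<bar>z\<bar>"
      then have u: "\<bar>u - y\<bar> \<le> r" using that by simp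
      then have "u \<notin> {-\<eta>..\<eta>}" using r \<eta> \<epsilon> by auto
      then show "\<bar>f u - s y\<bar> \<le> e'" using r(3)[OF u] by (simp add: f_def)
    qed
    have ev: "\<forall>\<^sub>F t in at_right 0. \<bar>1 / t * (1 / t * measure M {\<omega> \<in> space M. X t \<omega> \<ge> y} - T)
      - (b\<^sub>0 * s y + tail_conv2 f y 0 / 2 - (\<integral>x. f x \<partial>lborel) * T)\<bar>
        \<le> e' * (\<bar>b\<^sub>0\<bar> + 4 * k \<eta>) + 4 * s y * k \<eta> + e / 4"
      using levy_second_order_estimate[OF X s nn \<nu> fv \<eta>(1) \<eta>1 \<eta>(3,4), of "s y" e' "e / 4"]
        lin nn[of y] e e' tf unfolding b0 k_def f_def[abs_def] by simp
    have ks: "(\<integral>x. indicator {-\<eta>..\<eta>} x * \<bar>x\<bar> * s x \<partial>lborel) = k \<eta>"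
      unfolding k_def by (subst dens) (auto simp: mult_ac)
    have chg: "\<bar>(tail_conv2 f y 0 / 2 - (\<integral>x. f x \<partial>lborel) * T)
      - ((\<integral>x. (LBINT u=0..ereal x. s (y - u)) * (c x * s x) \<partial>lborel) + tail_conv2 g y 0 / 2
        - (\<integral>x. g x \<partial>lborel) * T)\<bar> \<le> B * k \<eta>"
    proof -
      have c1: "c x = 1" if "\<bar>x\<bar> \<le> \<eta>" for x using that \<eta> by (intro c(4)) simp
      have "\<eta> \<le> \<epsilon>" "\<epsilon> \<le> 1" "2 * \<epsilon> < y" using \<eta> \<epsilon> by auto
      from hard_truncation_change[OF s nn fvs c(1,2,3) c1 c(5) \<eta>(1) this B]
      show ?thesis unfolding g_eq f_def[abs_def, symmetric] tf ks .
    qed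
    show "\<forall>\<^sub>F t in at_right 0. dist (1 / t * (1 / t * measure M {\<omega> \<in> space M. X t \<omega> \<ge> y} - T)) D < e"
      using ev
    proof eventually_elim
      case (elim t)
      have "e' * (\<bar>b\<^sub>0\<bar> + 4 * k \<eta>) \<le> e' * (\<bar>b\<^sub>0\<bar> + 4)"
        using e' k1 by (intro mult_left_mono) auto
      then have "e' * (\<bar>b\<^sub>0\<bar> + 4 * k \<eta>) \<le> e / 4" using e' by simp
      moreover have "4 * s y * k \<eta> + B * k \<eta> < e / 4" using k2 by (simp add: algebra_simps)
      \<comment> \<open>The budget: \<open>e1\<close> is the linearization error,
        \<open>e2 + e3\<close> are the errors proportional to \<open>k \<eta>\<close>, and the
        explicit \<open>e / 4\<close> is the slack in \<open>t\<close>. Their sum stays below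
        \<open>3 * e / 4\<close>.\<close>
      moreover have "\<bar>z - (p + a + v1 - v2)\<bar> < e"
        if "\<bar>z - (p + u1 - u2)\<bar> \<le> e1 + e2 + e / 4" "\<bar>u1 - u2 - (a + v1 - v2)\<bar> \<le> e3" "e1 \<le> e / 4" "e2 + e3 < e / 4"
        for z p a u1 u2 v1 v2 e1 e2 e3 using that e by linarith
      ultimately show ?case using elim chg unfolding D_def dist_real_def by blast
    qed
  qed
  have "(\<integral>x. (\<integral>u. indicator {y..} (x + u) * large_part c s u * large_part c s x \<partial>lborel) \<partial>lborel)
      = tail_conv2 g y 0"
    by (simp add: tail_conv2_def tail_conv_def g_def)
  moreover have mass: "large_mass c \<nu> = (\<integral>x. g x \<partial>lborel)"
    unfolding large_mass_def g_eq by (subst dens) (auto simp: mult.commute)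
  ultimately have "D = b\<^sub>0 * s y + (\<integral>x. (LBINT u=0..x. s (y - u)) * small_part c s x \<partial>lborel)
      + 1 / 2 * (\<integral>x. (\<integral>u. indicator {y..} (x + u) * large_part c s u * large_part c s x \<partial>lborel) \<partial>lborel)
      - large_mass c \<nu> * measure \<nu> {y..}"
    by (simp add: D_def T_def small_part_def)
  \<comment> \<open>The witness is \<open>d\<^sub>2 = 2 * D\<close>, since both conjuncts speak of
    its half.\<close>
  moreover have "2 * D / 2 = D" by simp
  ultimately show ?thesis using lim unfolding T_def by metis
qed

end
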